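(* Assume (A1) and (A2) below. Then for every $D>0$ and $P>0$, $$R_{\mathrm{nr}}(D,P)=R(D,P).$$ (A1) For each fixed $\mu\in\mathcal P(\mathcal X)$, the map $\nu\mapsto d(\mu,\nu)$ is convex. (A2) This assumption has two parts. - For every $D>0$ and $P>0$, $R(D,P)<\infty$. - For every $D>0$, $P>0$ and $\epsilon>0$ there is a Markov kernel $p_{\tilde X|X}$ such that $\tilde X$ is discrete with support $\tilde{\mathcal X}\subseteq\mathcal X$, $|\tilde{\mathcal X}|<\infty$, and all of the following hold: - $I(X;\tilde X)\le R(D,P)+\epsilon$; - $\mathbb E[\Delta(X,\tilde X)]\le D+\epsilon$; - $\mathbb E[\max_{\tilde x\in\tilde{\mathcal X}}\Delta(X,\tilde x)]<\infty$; - $d(p_X,p_{\tilde X})\le P+\epsilon$; - $d(p_X,\gamma)<\infty$ for every distribution $\gamma$ supported on $\tilde{\mathcal X}$.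
   Context: Let $\mathcal X$ be a Polish metric space with its Borel $\sigma$-algebra, and let $\mathcal P(\mathcal X)$ be the set of Borel probability measures on $\mathcal X$. Let $X\sim p_X\in\mathcal P(\mathcal X)$, and let $\{X_t\}_{t\ge1}$ be i.i.d. with marginal $p_X$. Let $\Delta:\mathcal X\times\mathcal X\to[0,\infty)$ be a measurable distortion function with $\Delta(x,\hat x)=0$ iff $x=\hat x$. Let $d:\mathcal P(\mathcal X)\times\mathcal P(\mathcal X)\to[0,\infty]$ be a divergence with $d(\mu,\nu)=0$ iff $\mu=\nu$. The rate-distortion-perception function is $$R(D,P):=\inf I(X;\hat X),$$ where the infimum is over Markov kernels $p_{\hat X|X}$ from $\mathcal X$ to $\mathcal X$ with $\mathbb E[\Delta(X,\hat X)]\le D$ and $d(p_X,p_{\hat X})\le P$. Logarithms are base 2. Operational definitions. A rate $R$ is achievable with common randomness if, for all sufficiently large $n$, there exist: - a distribution $p_Q$ on a Polish space; - an encoder kernel $p_{Z|X^nQ}$ with $Z$ taking values in a countable set; - a decoder kernel $p_{\hat X^n|ZQ}$ with $\hat X^n\in\mathcal X^n$; such that, under $p_X^{n}p_Qp_{Z|X^nQ}p_{\hat X^n|ZQ}$, the following hold: - $\frac1nH(Z|Q)\le R$; - $\frac1n\sum_{t=1}^n\mathbb E[\Delta(X_t,\hat X_t)]\le D$; - $d(p_X,p_{\hat X_t})\le P$ for all $t\in[1:n]$. $R_{\mathrm{cr}}(D,P)$ is the infimum of such $R$. $R_{\mathrm{pr}}(D,P)$ is defined in the same way with $Q$ constant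 (private randomness only). $R_{\mathrm{nr}}(D,P)$ is defined in the same way with $Q$ constant, $Z$ a deterministic function of $X^n$, and $\hat X^n$ a deterministic function of $Z$ (no randomness). *)

theory Defs
  imports "HOL-Probability.Probability"
begin

definition prob_meas :: "'a::polish_space measure \<Rightarrow> bool" where
  "prob_meas \<mu> \<longleftrightarrow> prob_space \<mu> \<and> sets \<mu> = sets (borel :: 'a measure)"

definition markov_kernel :: "('a::polish_space \<Rightarrow> 'a measure) \<Rightarrow> bool" where
  "markov_kernel K \<longleftrightarrow> K \<in> (borel :: 'a measure) \<rightarrow>\<^sub>M prob_algebra (borel :: 'a measure)"

definition mix :: "real \<Rightarrow> 'a::polish_space measure \<Rightarrow> 'a measure \<Rightarrow> 'a measure" where
  "mix l \<nu>1 \<nu>2 = measure_of (space (borel :: 'a measure)) (sets (borel :: 'a measure))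
     (\<lambda>A. ennreal l * emeasure \<nu>1 A + ennreal (1 - l) * emeasure \<nu>2 A)"

text \<open>Integrand for KL divergence in bits: t log2 t - (t - 1)/ln 2 (nonnegative).\<close>
definition kl_fun :: "real \<Rightarrow> real" where
  "kl_fun t = (if t = 0 then 0 else t * log 2 t) - (t - 1) / ln 2"

text \<open>KL divergence D(P||Q) (base 2), valued in [0,\<infinity>]; \<infinity> unless P << Q.
  For probability measures P, Q with P << Q and f = dP/dQ this equals
  the integral of f log2 f dQ.\<close>
definition KL2 :: "'b measure \<Rightarrow> 'b measure \<Rightarrow> ennreal" where
  "KL2 P Q = (if absolutely_continuous Q P
      then (\<integral>\<^sup>+ z. ennreal (kl_fun (enn2real (RN_deriv Q P z))) \<partial>Q)
      else \<infinity>)"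

definition joint :: "'a::polish_space measure \<Rightarrow> ('a \<Rightarrow> 'a measure) \<Rightarrow> ('a \<times> 'a) measure" where
  "joint M K = M \<bind> (\<lambda>x. distr (K x) (borel \<Otimes>\<^sub>M borel) (\<lambda>y. (x, y)))"

definition outlaw :: "'a::polish_space measure \<Rightarrow> ('a \<Rightarrow> 'a measure) \<Rightarrow> 'a measure" where
  "outlaw M K = M \<bind> K"

definition mutual_info :: "'a::polish_space measure \<Rightarrow> ('a \<Rightarrow> 'a measure) \<Rightarrow> ennreal" where
  "mutual_info M K = KL2 (joint M K) (M \<Otimes>\<^sub>M outlaw M K)"

definition exp_dist :: "'a::polish_space measure \<Rightarrow> ('a \<Rightarrow> 'a \<Rightarrow> real) \<Rightarrow> ('a \<Rightarrow> 'a measure) \<Rightarrow> ennreal" where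
  "exp_dist M \<Delta> K = (\<integral>\<^sup>+ x. (\<integral>\<^sup>+ y. ennreal (\<Delta> x y) \<partial>K x) \<partial>M)"

definition RDP :: "'a::polish_space measure \<Rightarrow> ('a \<Rightarrow> 'a \<Rightarrow> real)
    \<Rightarrow> ('a measure \<Rightarrow> 'a measure \<Rightarrow> ennreal) \<Rightarrow> real \<Rightarrow> real \<Rightarrow> ereal" where
  "RDP M \<Delta> d D P = Inf {enn2ereal (mutual_info M K) | K.
      markov_kernel K \<and> enn2ereal (exp_dist M \<Delta> K) \<le> ereal D
      \<and> enn2ereal (d M (outlaw M K)) \<le> ereal P}"

text \<open>Entropy (bits) of a Z-valued (Z = nat, any countable alphabet) discrete variable f under N.\<close>
definition entropy_disc :: "'b measure \<Rightarrow> ('b \<Rightarrow> nat) \<Rightarrow> ennreal" where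
  "entropy_disc N f = (\<Sum>z. ennreal (- (measure N (f -` {z} \<inter> space N)
                                * log 2 (measure N (f -` {z} \<inter> space N)))))"

text \<open>Achievability without any randomness at block length n: deterministic encoder
  f : X^n -> Z (countable, encoded as nat) and deterministic decoder g : Z -> X^n
  (g z t is the t-th output symbol).  X^n is i.i.d. with law M.\<close>
definition nr_code :: "'a::polish_space measure \<Rightarrow> ('a \<Rightarrow> 'a \<Rightarrow> real)
    \<Rightarrow> ('a measure \<Rightarrow> 'a measure \<Rightarrow> ennreal) \<Rightarrow> real \<Rightarrow> real \<Rightarrow> real \<Rightarrow> nat \<Rightarrow> bool" where
  "nr_code M \<Delta> d D P R n \<longleftrightarrow> (\<exists>(f :: (nat \<Rightarrow> 'a) \<Rightarrow> nat) (g :: nat \<Rightarrow> nat \<Rightarrow> 'a).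
      f \<in> (\<Pi>\<^sub>M i\<in>{..<n}. (borel :: 'a measure)) \<rightarrow>\<^sub>M count_space UNIV
    \<and> enn2ereal (entropy_disc (\<Pi>\<^sub>M i\<in>{..<n}. M) f) \<le> ereal (real n * R)
    \<and> enn2ereal (\<Sum>t<n. \<integral>\<^sup>+ x. ennreal (\<Delta> (x t) (g (f x) t)) \<partial>(\<Pi>\<^sub>M i\<in>{..<n}. M))
         \<le> ereal (real n * D)
    \<and> (\<forall>t<n. enn2ereal (d M (distr (\<Pi>\<^sub>M i\<in>{..<n}. M) borel (\<lambda>x. g (f x) t))) \<le> ereal P))"

definition achievable_nr :: "'a::polish_space measure \<Rightarrow> ('a \<Rightarrow> 'a \<Rightarrow> real)
    \<Rightarrow> ('a measure \<Rightarrow> 'a measure \<Rightarrow> ennreal) \<Rightarrow> real \<Rightarrow> real \<Rightarrow> real \<Rightarrow> bool" where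
  "achievable_nr M \<Delta> d D P R \<longleftrightarrow> (\<exists>N. \<forall>n\<ge>N. n > 0 \<longrightarrow> nr_code M \<Delta> d D P R n)"

definition R_nr :: "'a::polish_space measure \<Rightarrow> ('a \<Rightarrow> 'a \<Rightarrow> real)
    \<Rightarrow> ('a measure \<Rightarrow> 'a measure \<Rightarrow> ennreal) \<Rightarrow> real \<Rightarrow> real \<Rightarrow> ereal" where
  "R_nr M \<Delta> d D P = Inf (ereal ` {R. achievable_nr M \<Delta> d D P R})"

end

theory Submission
  imports Defs "HOL-Real_Asymp.Real_Asymp"
begin

text \<open>
  Converse: for a code $(f, g)$ let $p$ be the law of $Z = f(X^n)$, and let $r$ be the density of the
  channel obtained by feeding a symbol at a uniformly random position of the block. Then
  $Y = p(Z) \prod_t r(X_t, g(Z)_t)$ has mean at most 1, so $E \ln Y \le 0$, which says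
  $n I \le H(Z)$ for that channel.

  Achievability: mixing a near-optimal finite kernel with a little of a better one gives strict slack
  in both constraints. Codewords are drawn from the output law; $x^n$ is mapped to the first one that
  rejection sampling accepts, so for each typical $x^n$ the output has almost the law prescribed by the
  kernel. Randomness is removed by giving each pattern of events $X_i \in E$, $i < \delta n$, a codebook
  of its own: since every pattern is exponentially unlikely, the marginals of the outputs concentrate,
  and all codebooks can be fixed at once. This needs a set $E$ of probability strictly between
  0 and 1; otherwise the source is a point mass.
\<close>

section \<open>Kernels and densities\<close>

lemma prob_measD:
  assumes "prob_meas \<mu>"
  shows "prob_space \<mu>" "sets \<mu> = sets borel" "space \<mu> = UNIV"
  using assms sets_eq_imp_space_eq[of \<mu> borel] by (auto simp: prob_meas_def)

lemma prob_meas_in_prob_algebra: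
  "prob_meas \<mu> \<Longrightarrow> \<mu> \<in> space (prob_algebra borel)"
  by (auto simp: prob_meas_def space_prob_algebra)

lemma prob_meas_eqI:
  assumes "prob_meas \<mu>" "prob_meas \<nu>" "\<And>A. A \<in> sets borel \<Longrightarrow> emeasure \<mu> A = emeasure \<nu> A"
  shows "\<mu> = \<nu>"
  using assms by (intro measure_eqI) (auto simp: prob_meas_def)

lemma prob_meas_return: "prob_meas (return borel s)"
  by (simp add: prob_meas_def prob_space_return)

lemma finite_imp_borel: "finite S \<Longrightarrow> (S :: 'a::t1_space set) \<in> sets borel"
  by (intro borel_closed finite_imp_closed)

lemma countable_imp_borel: "countable C \<Longrightarrow> (C :: 'a::t1_space set) \<in> sets borel"
  by (rule sets.countable[rotated]) auto

lemma AE_mem_iff_emeasure_eq_1: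
  assumes "prob_meas \<mu>" "A \<in> sets borel"
  shows "(AE x in \<mu>. x \<in> A) \<longleftrightarrow> emeasure \<mu> A = 1"
proof -
  interpret prob_space \<mu> by (rule prob_measD[OF assms(1)])
  show ?thesis
    using assms by (subst prob_eq_1[symmetric]) (auto simp: prob_measD emeasure_eq_measure)
qed

lemma measure_singleton_eq_0_iff_AE:
  assumes "prob_meas \<mu>"
  shows "measure \<mu> {c} = 0 \<longleftrightarrow> (AE x in \<mu>. x \<noteq> c)"
proof -
  interpret prob_space \<mu> by (rule prob_measD[OF assms])
  show ?thesis
    using AE_iff_null_sets[of "{c}" \<mu>] prob_measD[OF assms]
    by (simp add: null_sets_def emeasure_eq_measure)
qed

lemma markov_kernelD:
  assumes "markov_kernel K"
  shows "K \<in> borel \<rightarrow>\<^sub>M subprob_algebra borel" "prob_meas (K x)"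
  using assms measurable_space[of K borel "prob_algebra borel" x]
  by (auto simp: markov_kernel_def prob_meas_def space_prob_algebra intro: measurable_prob_algebraD)

lemma prob_meas_outlaw:
  assumes "prob_meas M" "markov_kernel K"
  shows "prob_meas (outlaw M K)"
  using prob_space_bind'[OF prob_meas_in_prob_algebra[OF assms(1)], of K borel]
    sets_bind'[OF prob_meas_in_prob_algebra[OF assms(1)], of K borel] assms(2)
  by (simp add: prob_meas_def outlaw_def markov_kernel_def)

lemma measurable_markov_kernel:
  assumes "prob_meas M" "markov_kernel K"
  shows "K \<in> M \<rightarrow>\<^sub>M subprob_algebra borel"
  using markov_kernelD(1)[OF assms(2)] prob_measD(2)[OF assms(1)]
  by (simp cong: measurable_cong_sets)

lemma nn_integral_outlaw:
  assumes "prob_meas M" "markov_kernel K" "h \<in> borel_measurable borel"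
  shows "(\<integral>\<^sup>+y. h y \<partial>outlaw M K) = (\<integral>\<^sup>+x. \<integral>\<^sup>+y. h y \<partial>K x \<partial>M)"
  unfolding outlaw_def
  by (rule nn_integral_bind[OF assms(3) measurable_markov_kernel[OF assms(1,2)]])

lemma emeasure_outlaw:
  assumes "prob_meas M" "markov_kernel K" "A \<in> sets borel"
  shows "emeasure (outlaw M K) A = (\<integral>\<^sup>+x. emeasure (K x) A \<partial>M)"
  using nn_integral_outlaw[OF assms(1,2), of "indicator A"] assms(3)
    prob_measD(2)[OF prob_meas_outlaw[OF assms(1,2)]]
      prob_measD(2)[OF markov_kernelD(2)[OF assms(2)]]
  by simp

lemma AE_outlaw:
  assumes "prob_meas M" "markov_kernel K" "Measurable.pred borel P"
  shows "(AE y in outlaw M K. P y) \<longleftrightarrow> (AE x in M. AE y in K x. P y)"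
  unfolding outlaw_def by (rule AE_bind[OF measurable_markov_kernel[OF assms(1,2)] assms(3)])

lemma AE_outlaw_memD:
  assumes "prob_meas M" "markov_kernel K" "countable C" "AE y in outlaw M K. y \<in> C"
  shows "AE x in M. AE y in K x. y \<in> C"
  using assms AE_outlaw[OF assms(1,2), of "\<lambda>y. y \<in> C"] countable_imp_borel[OF assms(3)] by simp

lemma measurable_joint_kernel:
  assumes "prob_meas M" "markov_kernel K"
  shows "(\<lambda>x. distr (K x) (borel \<Otimes>\<^sub>M borel) (\<lambda>y. (x, y))) \<in> M \<rightarrow>\<^sub>M subprob_algebra (borel \<Otimes>\<^sub>M borel)"
proof -
  have [measurable_cong]: "sets M = sets borel" by (rule prob_measD[OF assms(1)])
  show ?thesis
    by (intro measurable_distr2[OF _ measurable_markov_kernel[OF assms]]) measurable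
qed

lemma sets_joint:
  assumes "prob_meas M" "markov_kernel K"
  shows "sets (joint M K) = sets (borel \<Otimes>\<^sub>M borel)"
  unfolding joint_def using prob_measD(3)[OF assms(1)]
  by (intro sets_bind_measurable[OF measurable_joint_kernel[OF assms]]) simp

lemma nn_integral_joint:
  assumes M: "prob_meas M" and K: "markov_kernel K"
    and h: "h \<in> borel_measurable (borel \<Otimes>\<^sub>M borel)"
  shows "(\<integral>\<^sup>+z. h z \<partial>joint M K) = (\<integral>\<^sup>+x. \<integral>\<^sup>+y. h (x, y) \<partial>K x \<partial>M)"
proof -
  have "(\<integral>\<^sup>+z. h z \<partial>joint M K) = (\<integral>\<^sup>+x. \<integral>\<^sup>+z. h z \<partial>distr (K x) (borel \<Otimes>\<^sub>M borel) (\<lambda>y. (x, y)) \<partial>M)"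
    unfolding joint_def by (rule nn_integral_bind[OF h measurable_joint_kernel[OF M K]])
  also have "\<dots> = (\<integral>\<^sup>+x. \<integral>\<^sup>+y. h (x, y) \<partial>K x \<partial>M)"
    using h prob_measD(2)[OF markov_kernelD(2)[OF K]]
    by (intro nn_integral_cong nn_integral_distr) (auto cong: measurable_cong_sets)
  finally show ?thesis .
qed

lemma KL2_density:
  assumes "sigma_finite_measure Q" and [measurable]: "f \<in> borel_measurable Q"
    and "\<And>z. 0 \<le> f z" and "P = density Q (\<lambda>z. ennreal (f z))"
  shows "KL2 P Q = (\<integral>\<^sup>+z. ennreal (kl_fun (f z)) \<partial>Q)"
proof -
  interpret sigma_finite_measure Q by fact
  have "AE z in Q. ennreal (f z) = RN_deriv Q P z"
    using assms by (intro RN_deriv_unique) auto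
  then have "AE z in Q. enn2real (RN_deriv Q P z) = f z"
    by eventually_elim (metis assms(3) enn2real_ennreal)
  then have "(\<integral>\<^sup>+z. ennreal (kl_fun (enn2real (RN_deriv Q P z))) \<partial>Q)
      = (\<integral>\<^sup>+z. ennreal (kl_fun (f z)) \<partial>Q)"
    by (intro nn_integral_cong_AE) auto
  moreover have "absolutely_continuous Q P"
    using assms(4) by (auto intro: absolutely_continuousI_density)
  ultimately show ?thesis
    by (simp add: KL2_def)
qed

lemma nn_integral_countable_support:
  fixes \<nu> :: "'a::polish_space measure"
  assumes \<nu>[measurable_cong]: "sets \<nu> = sets borel" and C: "countable C"
    and AE_C: "AE y in \<nu>. y \<in> C"
    and [measurable]: "h \<in> borel_measurable borel"
  shows "(\<integral>\<^sup>+y. h y \<partial>\<nu>) = (\<integral>\<^sup>+c. h c * emeasure \<nu> {c} \<partial>count_space C)"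
proof -
  have "(\<integral>\<^sup>+y. h y \<partial>\<nu>) = (\<integral>\<^sup>+y. (\<integral>\<^sup>+c. h c * indicator {c} y \<partial>count_space C) \<partial>\<nu>)"
  proof (rule nn_integral_cong_AE, use AE_C in eventually_elim)
    fix y assume y: "y \<in> C"
    have "(\<integral>\<^sup>+c. h c * indicator {c} y \<partial>count_space C)
        = (\<integral>\<^sup>+c. h y * indicator {y} c \<partial>count_space C)"
      by (intro nn_integral_cong) (auto split: split_indicator)
    also have "\<dots> = h y"
      using y by (subst nn_integral_cmult_indicator) auto
    finally show "h y = (\<integral>\<^sup>+c. h c * indicator {c} y \<partial>count_space C)" by simp
  qed
  also have "\<dots> = (\<integral>\<^sup>+c. (\<integral>\<^sup>+y. h c * indicator {c} y \<partial>\<nu>) \<partial>count_space C)"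
    by (intro nn_integral_count_space_nn_integral C) measurable
  also have "\<dots> = (\<integral>\<^sup>+c. h c * emeasure \<nu> {c} \<partial>count_space C)"
    using \<nu> by (intro nn_integral_cong nn_integral_cmult_indicator) auto
  finally show ?thesis .
qed

text \<open>The density of \<open>K x\<close> with respect to the output law when the latter is atomic; it is \<open>0\<close> off
  the atoms because \<open>x / 0 = 0\<close>.\<close>

definition kernel_density :: "'a::polish_space measure \<Rightarrow> ('a \<Rightarrow> 'a measure) \<Rightarrow> 'a \<Rightarrow> 'a \<Rightarrow> real" where
  "kernel_density M K x y = measure (K x) {y} / measure (outlaw M K) {y}"

lemma kernel_density_nonneg: "0 \<le> kernel_density M K x y"
  by (simp add: kernel_density_def)

lemma measurable_measure_singleton:
  fixes K :: "'b \<Rightarrow> 'a::polish_space measure"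
  assumes "K \<in> N \<rightarrow>\<^sub>M subprob_algebra borel"
  shows "(\<lambda>(x, y). measure (K x) {y}) \<in> borel_measurable (N \<Otimes>\<^sub>M borel)"
proof -
  have "(SIGMA z:space (N \<Otimes>\<^sub>M (borel :: 'a measure)). {snd z}) =
      {w \<in> space ((N \<Otimes>\<^sub>M borel) \<Otimes>\<^sub>M borel). dist (snd (fst w)) (snd w) = (0::real)}"
    by (auto simp: space_pair_measure)
  also have "\<dots> \<in> sets ((N \<Otimes>\<^sub>M borel) \<Otimes>\<^sub>M borel)"
    by measurable
  finally have "(\<lambda>z. measure (K (fst z)) {snd z}) \<in> borel_measurable (N \<Otimes>\<^sub>M borel)"
    using assms
    by (intro measure_measurable_subprob_algebra2[of _ _ borel]
      measurable_compose[OF measurable_fst])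
  then show ?thesis by (simp add: case_prod_beta')
qed

lemma measurable_kernel_density:
  assumes M: "prob_meas M" and K: "markov_kernel K"
  shows "case_prod (kernel_density M K) \<in> borel_measurable (borel \<Otimes>\<^sub>M borel)"
proof -
  have "outlaw M K \<in> space (subprob_algebra borel)"
    using prob_meas_outlaw[OF M K]
    by (auto simp: space_subprob_algebra prob_meas_def prob_space_imp_subprob_space)
  then have [measurable]: "(\<lambda>(x::'a, y). measure (outlaw M K) {y})
      \<in> borel_measurable (borel \<Otimes>\<^sub>M borel)"
    by (intro measurable_measure_singleton) auto
  have [measurable]: "(\<lambda>(x, y). measure (K x) {y}) \<in> borel_measurable (borel \<Otimes>\<^sub>M borel)"
    by (intro measurable_measure_singleton markov_kernelD K)
  have "case_prod (kernel_density M K) =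
      (\<lambda>z. (\<lambda>(x, y). measure (K x) {y}) z / (\<lambda>(x::'a, y). measure (outlaw M K) {y}) z)"
    by (auto simp: kernel_density_def fun_eq_iff)
  also have "\<dots> \<in> borel_measurable (borel \<Otimes>\<^sub>M borel)" by measurable
  finally show ?thesis .
qed

lemma measurable_kernel_density_section:
  assumes "prob_meas M" "markov_kernel K"
  shows "kernel_density M K x \<in> borel_measurable borel"
  using measurable_compose[OF measurable_Pair1' measurable_kernel_density[OF assms], of x] by simp

lemma AE_measure_singleton_eq_0:
  assumes M: "prob_meas M" and K: "markov_kernel K" and C: "countable C"
  shows "AE x in M. \<forall>c\<in>C. measure (outlaw M K) {c} = 0 \<longrightarrow> measure (K x) {c} = 0"
proof (subst AE_ball_countable[OF C], intro ballI)
  fix c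
  have "measure (outlaw M K) {c} = 0 \<longleftrightarrow> (AE x in M. measure (K x) {c} = 0)"
    using AE_outlaw[OF M K, of "\<lambda>y. y \<noteq> c"]
    by (simp add: measure_singleton_eq_0_iff_AE prob_meas_outlaw M K markov_kernelD)
  then show "AE x in M. measure (outlaw M K) {c} = 0 \<longrightarrow> measure (K x) {c} = 0"
    by (cases "measure (outlaw M K) {c} = 0") auto
qed

lemma nn_integral_atomic_density:
  assumes \<mu>: "prob_meas \<mu>" "AE y in \<mu>. y \<in> C" and \<nu>: "prob_meas \<nu>" "AE y in \<nu>. y \<in> C"
    and C: "countable C" and null: "\<And>c. c \<in> C \<Longrightarrow> measure \<nu> {c} = 0 \<Longrightarrow> measure \<mu> {c} = 0"
    and f: "f \<in> borel_measurable borel" "\<And>y. f y = measure \<mu> {y} / measure \<nu> {y}"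
    and h[measurable]: "h \<in> borel_measurable borel"
  shows "(\<integral>\<^sup>+y. h y \<partial>\<mu>) = (\<integral>\<^sup>+y. ennreal (f y) * h y \<partial>\<nu>)"
proof -
  interpret \<mu>: prob_space \<mu> by (rule prob_measD[OF \<mu>(1)])
  interpret \<nu>: prob_space \<nu> by (rule prob_measD[OF \<nu>(1)])
  note [measurable] = f(1)
  have "(\<integral>\<^sup>+y. h y \<partial>\<mu>) = (\<integral>\<^sup>+c. h c * emeasure \<mu> {c} \<partial>count_space C)"
    by (intro nn_integral_countable_support prob_measD \<mu> C h)
  also have "\<dots> = (\<integral>\<^sup>+c. (ennreal (f c) * h c) * emeasure \<nu> {c} \<partial>count_space C)"
  proof (intro nn_integral_cong)
    fix c assume "c \<in> space (count_space C)"
    then have "ennreal (f c) * emeasure \<nu> {c} = emeasure \<mu> {c}"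
      using null[of c]
      by (auto simp: f(2) \<mu>.emeasure_eq_measure \<nu>.emeasure_eq_measure simp flip: ennreal_mult')
    then show "h c * emeasure \<mu> {c} = (ennreal (f c) * h c) * emeasure \<nu> {c}"
      by (metis mult.assoc mult.commute)
  qed
  also have "\<dots> = (\<integral>\<^sup>+y. ennreal (f y) * h y \<partial>\<nu>)"
    by (intro nn_integral_countable_support[symmetric] prob_measD \<nu> C) measurable
  finally show ?thesis .
qed

lemma nn_integral_kernel_eq_density:
  assumes M: "prob_meas M" and K: "markov_kernel K"
    and C: "countable C" and AE_C: "AE y in outlaw M K. y \<in> C"
    and [measurable]: "h \<in> borel_measurable (borel \<Otimes>\<^sub>M borel)"
  shows "(\<integral>\<^sup>+x. \<integral>\<^sup>+y. h (x, y) \<partial>K x \<partial>M)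
      = (\<integral>\<^sup>+x. \<integral>\<^sup>+y. ennreal (kernel_density M K x y) * h (x, y) \<partial>outlaw M K \<partial>M)"
  using AE_outlaw_memD[OF M K C AE_C] AE_measure_singleton_eq_0[OF M K C]
proof (intro nn_integral_cong_AE, eventually_elim)
  fix x assume x: "AE y in K x. y \<in> C" "\<forall>c\<in>C. measure (outlaw M K) {c} = 0 \<longrightarrow> measure (K x) {c} = 0"
  have "(\<lambda>y. h (x, y)) \<in> borel_measurable borel" by measurable
  then show "(\<integral>\<^sup>+y. h (x, y) \<partial>K x)
      = (\<integral>\<^sup>+y. ennreal (kernel_density M K x y) * h (x, y) \<partial>outlaw M K)"
    using x by (intro nn_integral_atomic_density[of _ C] markov_kernelD K prob_meas_outlaw M C AE_C
        measurable_kernel_density_section) (auto simp: kernel_density_def)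
qed

lemma nn_integral_kernel_density_le_1:
  assumes M: "prob_meas M" and K: "markov_kernel K"
    and C: "countable C" and AE_C: "AE y in outlaw M K. y \<in> C"
  shows "(\<integral>\<^sup>+y. ennreal (kernel_density M K x y) \<partial>outlaw M K) \<le> 1"
proof -
  interpret q: prob_space "outlaw M K" by (rule prob_measD[OF prob_meas_outlaw[OF M K]])
  interpret k: prob_space "K x" by (rule prob_measD[OF markov_kernelD(2)[OF K]])
  have k: "sets (K x) = sets borel" by (rule prob_measD[OF markov_kernelD(2)[OF K]])
  have "(\<integral>\<^sup>+y. ennreal (kernel_density M K x y) \<partial>outlaw M K) =
      (\<integral>\<^sup>+c. ennreal (kernel_density M K x c) * emeasure (outlaw M K) {c} \<partial>count_space C)"
    using measurable_kernel_density_section[OF M K]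
    by (intro nn_integral_countable_support C AE_C prob_measD prob_meas_outlaw M K) measurable
  also have "\<dots> \<le> (\<integral>\<^sup>+c. emeasure (K x) {c} \<partial>count_space C)"
    by (intro nn_integral_mono)
       (auto simp: kernel_density_def q.emeasure_eq_measure k.emeasure_eq_measure
         intro!: ennreal_leI simp flip: ennreal_mult')
  also have "\<dots> = emeasure (K x) C"
    using k by (intro emeasure_countable_singleton[symmetric] C) auto
  also have "\<dots> \<le> 1" by (rule k.emeasure_le_1)
  finally show ?thesis .
qed

lemma nn_integral_kernel_density_source_le_1:
  assumes M: "prob_meas M" and K: "markov_kernel K"
  shows "(\<integral>\<^sup>+x. ennreal (kernel_density M K x y) \<partial>M) \<le> 1"
proof -
  interpret q: prob_space "outlaw M K" by (rule prob_measD[OF prob_meas_outlaw[OF M K]])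
  have [measurable]: "(\<lambda>x. emeasure (K x) {y}) \<in> borel_measurable M"
    by (rule measurable_emeasure_kernel[OF measurable_markov_kernel[OF M K]]) simp
  have "ennreal (kernel_density M K x y)
      = ennreal (1 / measure (outlaw M K) {y}) * emeasure (K x) {y}" for x
    using finite_measure.emeasure_eq_measure[OF
      prob_space.finite_measure[OF prob_measD(1)[OF markov_kernelD(2)[OF K]]]]
    by (simp add: kernel_density_def flip: ennreal_mult')
  then have "(\<integral>\<^sup>+x. ennreal (kernel_density M K x y) \<partial>M) =
      ennreal (1 / measure (outlaw M K) {y}) * emeasure (outlaw M K) {y}"
    by (simp add: nn_integral_cmult emeasure_outlaw[OF M K])
  also have "\<dots> \<le> 1" by (simp add: q.emeasure_eq_measure flip: ennreal_mult')
  finally show ?thesis .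
qed

lemma joint_eq_density:
  assumes M: "prob_meas M" and K: "markov_kernel K"
    and C: "countable C" and AE_C: "AE y in outlaw M K. y \<in> C"
  shows "joint M K = density (M \<Otimes>\<^sub>M outlaw M K) (\<lambda>z. ennreal (case_prod (kernel_density M K) z))"
proof (rule measure_eqI)
  interpret q: prob_space "outlaw M K" by (rule prob_measD[OF prob_meas_outlaw[OF M K]])
  have [measurable_cong]: "sets M = sets borel" "sets (outlaw M K) = sets borel"
    using prob_measD[OF prob_meas_outlaw[OF M K]] prob_measD[OF M] by auto
  note measurable_kernel_density[OF M K, measurable]
  show "sets (joint M K)
      = sets (density (M \<Otimes>\<^sub>M outlaw M K) (\<lambda>z. ennreal (case_prod (kernel_density M K) z)))"
    unfolding sets_joint[OF M K] sets_density
    by (intro sets_pair_measure_cong) (simp_all add: prob_measD(2) M prob_meas_outlaw K)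
  fix A assume "A \<in> sets (joint M K)"
  then have A[measurable]: "A \<in> sets (borel \<Otimes>\<^sub>M borel)" by (simp add: sets_joint[OF M K])
  have "emeasure (joint M K) A = (\<integral>\<^sup>+x. \<integral>\<^sup>+y. indicator A (x, y) \<partial>K x \<partial>M)"
    using nn_integral_joint[OF M K, of "indicator A"] A by (simp add: sets_joint[OF M K])
  also have "\<dots> = (\<integral>\<^sup>+x. \<integral>\<^sup>+y. ennreal (kernel_density M K x y) * indicator A (x, y) \<partial>outlaw M K \<partial>M)"
    by (rule nn_integral_kernel_eq_density[OF M K C AE_C]) measurable
  also have "\<dots>
      = (\<integral>\<^sup>+z. ennreal (case_prod (kernel_density M K) z) * indicator A z \<partial>(M \<Otimes>\<^sub>M outlaw M K))"
    by (subst q.nn_integral_fst[symmetric]) auto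
  also have "\<dots>
      = emeasure (density (M \<Otimes>\<^sub>M outlaw M K) (\<lambda>z. ennreal (case_prod (kernel_density M K) z))) A"
    by (subst emeasure_density) measurable
  finally show "emeasure (joint M K) A =
      emeasure (density (M \<Otimes>\<^sub>M outlaw M K) (\<lambda>z. ennreal (case_prod (kernel_density M K) z))) A" .
qed

lemma measurable_kl_fun [measurable]: "kl_fun \<in> borel_measurable borel"
  unfolding kl_fun_def by measurable

lemma mutual_info_eq_nn_integral_kl:
  assumes M: "prob_meas M" and K: "markov_kernel K"
    and C: "countable C" and AE_C: "AE y in outlaw M K. y \<in> C"
  shows "mutual_info M K
      = (\<integral>\<^sup>+z. ennreal (kl_fun (case_prod (kernel_density M K) z)) \<partial>(M \<Otimes>\<^sub>M outlaw M K))"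
  unfolding mutual_info_def
proof (rule KL2_density)
  interpret q: prob_space "outlaw M K" by (rule prob_measD[OF prob_meas_outlaw[OF M K]])
  interpret M: prob_space M by (rule prob_measD[OF M])
  interpret pair_prob_space M "outlaw M K" ..
  have [measurable_cong]: "sets M = sets borel" "sets (outlaw M K) = sets borel"
    using prob_measD[OF prob_meas_outlaw[OF M K]] prob_measD[OF M] by auto
  show "sigma_finite_measure (M \<Otimes>\<^sub>M outlaw M K)" ..
  show "case_prod (kernel_density M K) \<in> borel_measurable (M \<Otimes>\<^sub>M outlaw M K)"
    using measurable_kernel_density[OF M K] by measurable
qed (auto simp: kernel_density_nonneg joint_eq_density[OF M K C AE_C])

lemma mutual_info_eq_nn_integral_nn_integral_kl:
  assumes M: "prob_meas M" and K: "markov_kernel K"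
    and C: "countable C" and AE_C: "AE y in outlaw M K. y \<in> C"
  shows "mutual_info M K = (\<integral>\<^sup>+x. \<integral>\<^sup>+y. ennreal (kl_fun (kernel_density M K x y)) \<partial>outlaw M K \<partial>M)"
proof -
  interpret q: prob_space "outlaw M K" by (rule prob_measD[OF prob_meas_outlaw[OF M K]])
  have [measurable_cong]: "sets M = sets borel" "sets (outlaw M K) = sets borel"
    using prob_measD[OF prob_meas_outlaw[OF M K]] prob_measD[OF M] by auto
  note measurable_kernel_density[OF M K, measurable]
  show ?thesis
    unfolding mutual_info_eq_nn_integral_kl[OF M K C AE_C]
    by (subst q.nn_integral_fst[symmetric]) auto
qed

section \<open>Mixtures\<close>

lemma emeasure_mix:
  assumes "prob_meas a" "prob_meas b" "A \<in> sets borel"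
  shows "emeasure (mix l a b) A = ennreal l * emeasure a A + ennreal (1 - l) * emeasure b A"
proof -
  let ?f = "\<lambda>A. ennreal l * emeasure a A + ennreal (1 - l) * emeasure b A"
  show ?thesis
    unfolding mix_def
  proof (rule emeasure_measure_of_sigma)
    show "sigma_algebra (space borel) (sets borel)" by (rule sets.sigma_algebra_axioms)
    show "positive (sets borel) ?f" by (simp add: positive_def)
    show "countably_additive (sets borel) ?f"
    proof (rule countably_additiveI)
      fix F :: "nat \<Rightarrow> 'a set" assume F: "range F \<subseteq> sets borel" "disjoint_family F"
      have "(\<Sum>i. ?f (F i)) = ennreal l * (\<Sum>i. emeasure a (F i))
          + ennreal (1 - l) * (\<Sum>i. emeasure b (F i))"
        by (subst suminf_add[symmetric]) auto
      then show "(\<Sum>i. ?f (F i)) = ?f (\<Union>i. F i)"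
        using F assms(1,2)[THEN prob_measD(2)] by (simp add: suminf_emeasure)
    qed
  qed (use assms in auto)
qed

lemma sets_mix [simp]: "sets (mix l a b) = sets (borel :: 'a::polish_space measure)"
  unfolding mix_def by (rule sets.sets_measure_of_eq)

lemma emeasure_mix_eq_1:
  assumes "prob_meas a" "prob_meas b" "0 \<le> l" "l \<le> 1" "A \<in> sets borel" "emeasure a A = 1"
    "emeasure b A = 1"
  shows "emeasure (mix l a b) A = 1"
  using assms by (simp add: emeasure_mix flip: ennreal_plus)

lemma prob_meas_mix:
  assumes "prob_meas a" "prob_meas b" "0 \<le> l" "l \<le> 1"
  shows "prob_meas (mix l a b)"
proof -
  have "space (mix l a b) = UNIV" using sets_eq_imp_space_eq[OF sets_mix] by auto
  then have "emeasure (mix l a b) (space (mix l a b)) = 1"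
    using prob_space.emeasure_space_1[OF prob_measD(1)] prob_measD(3) assms
    by (metis emeasure_mix_eq_1 sets.top space_borel)
  then show ?thesis by (auto simp: prob_meas_def intro: prob_spaceI)
qed

lemma measure_mix:
  assumes "prob_meas a" "prob_meas b" "0 \<le> l" "l \<le> 1" "A \<in> sets borel"
  shows "measure (mix l a b) A = l * measure a A + (1 - l) * measure b A"
proof -
  interpret a: prob_space a by (rule prob_measD[OF assms(1)])
  interpret b: prob_space b by (rule prob_measD[OF assms(2)])
  show ?thesis
    using assms unfolding measure_def
    by (simp add: emeasure_mix a.emeasure_eq_measure b.emeasure_eq_measure
      flip: ennreal_mult ennreal_plus)
qed

lemma nn_integral_mix:
  assumes a: "prob_meas a" and b: "prob_meas b" and l: "0 \<le> l" "l \<le> 1"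
    and h: "h \<in> borel_measurable borel"
  shows "(\<integral>\<^sup>+y. h y \<partial>mix l a b) = ennreal l * (\<integral>\<^sup>+y. h y \<partial>a) + ennreal (1 - l) * (\<integral>\<^sup>+y. h y \<partial>b)"
proof -
  let ?N = "\<lambda>c. if c then a else b"
  have "prob_meas (?N c)" for c using a b by simp
  then have N: "?N \<in> measure_pmf (bernoulli_pmf l) \<rightarrow>\<^sub>M prob_algebra borel"
    by (auto simp: space_prob_algebra prob_meas_def)
  note N' = measurable_prob_algebraD[OF N]
  have "mix l a b = measure_pmf (bernoulli_pmf l) \<bind> ?N"
  proof (rule measure_eqI)
    show "sets (mix l a b) = sets (measure_pmf (bernoulli_pmf l) \<bind> ?N)"
      using sets_bind_measurable[OF N'] by simp
    fix A assume "A \<in> sets (mix l a b)"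
    then show "emeasure (mix l a b) A = emeasure (measure_pmf (bernoulli_pmf l) \<bind> ?N) A"
      using l by (subst emeasure_bind[OF _ N']) (simp_all add: emeasure_mix[OF a b] mult.commute)
  qed
  then show ?thesis
    using l by (simp add: nn_integral_bind[OF h N'] mult.commute)
qed

text \<open>Assumption (A1) for a fixed first argument of the divergence.\<close>

definition mix_convex :: "('a::polish_space measure \<Rightarrow> ennreal) \<Rightarrow> bool" where
  "mix_convex \<phi> \<longleftrightarrow> (\<forall>\<nu>1 \<nu>2 l. prob_meas \<nu>1 \<longrightarrow> prob_meas \<nu>2 \<longrightarrow> 0 \<le> l \<longrightarrow> l \<le> 1 \<longrightarrow>
     \<phi> (mix l \<nu>1 \<nu>2) \<le> ennreal l * \<phi> \<nu>1 + ennreal (1 - l) * \<phi> \<nu>2)"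

lemma mix_convexD:
  "mix_convex \<phi> \<Longrightarrow> prob_meas \<nu>1 \<Longrightarrow> prob_meas \<nu>2 \<Longrightarrow> 0 \<le> l \<Longrightarrow> l \<le> 1 \<Longrightarrow>
     \<phi> (mix l \<nu>1 \<nu>2) \<le> ennreal l * \<phi> \<nu>1 + ennreal (1 - l) * \<phi> \<nu>2"
  by (auto simp: mix_convex_def)

definition finite_mixture ::
  "'i set \<Rightarrow> ('i \<Rightarrow> real) \<Rightarrow> ('i \<Rightarrow> 'a::polish_space measure) \<Rightarrow> 'a measure \<Rightarrow> bool" where
  "finite_mixture I w \<nu> \<gamma> \<longleftrightarrow> prob_meas \<gamma> \<and>
      (\<forall>A\<in>sets borel. emeasure \<gamma> A = (\<Sum>i\<in>I. ennreal (w i) * emeasure (\<nu> i) A))"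

lemma finite_mixture_unique: "finite_mixture I w \<nu> \<gamma> \<Longrightarrow> finite_mixture I w \<nu> \<gamma>' \<Longrightarrow> \<gamma> = \<gamma>'"
  by (auto simp: finite_mixture_def intro: prob_meas_eqI)

lemma sum_insert_rescaled_weights:
  fixes w :: "'i \<Rightarrow> real" and F :: "'i \<Rightarrow> ennreal"
  assumes "finite I" "i \<notin> I" "w i < 1" "\<And>j. j \<in> I \<Longrightarrow> 0 \<le> w j"
  shows "(\<Sum>j\<in>insert i I. ennreal (w j) * F j) =
    ennreal (w i) * F i + ennreal (1 - w i) * (\<Sum>j\<in>I. ennreal (w j / (1 - w i)) * F j)"
proof -
  have "ennreal (1 - w i) * (ennreal (w j / (1 - w i)) * F j) = ennreal (w j) * F j"
    if "j \<in> I" for j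
    using assms that by (simp add: mult.assoc[symmetric] flip: ennreal_mult')
  then show ?thesis using assms by (simp add: sum_distrib_left)
qed

lemma mix_convex_ex_finite_mixture:
  assumes \<phi>: "mix_convex \<phi>" and "finite I" and "\<And>i. i \<in> I \<Longrightarrow> prob_meas (\<nu> i)"
    and "\<And>i. i \<in> I \<Longrightarrow> 0 \<le> w i" "sum w I = 1"
  obtains \<gamma> where "finite_mixture I w \<nu> \<gamma>" "\<phi> \<gamma> \<le> (\<Sum>i\<in>I. ennreal (w i) * \<phi> (\<nu> i))"
proof -
  from assms(2-) have "\<exists>\<gamma>. finite_mixture I w \<nu> \<gamma> \<and> \<phi> \<gamma> \<le> (\<Sum>i\<in>I. ennreal (w i) * \<phi> (\<nu> i))"
  proof (induction I arbitrary: w rule: finite_induct)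
    case empty
    then show ?case by simp
  next
    case (insert i I)
    have wi: "0 \<le> w i" "w i \<le> 1" "sum w I = 1 - w i"
      using insert.prems(2,3) insert.hyps sum_nonneg[of I w] by auto
    show ?case
    proof (cases "w i = 1")
      case True
      then have "\<forall>j\<in>I. w j = 0"
        using wi insert.prems(2) insert.hyps by (subst sum_nonneg_eq_0_iff[symmetric]) auto
      then show ?thesis
        using True insert by (intro exI[of _ "\<nu> i"]) (auto simp: finite_mixture_def)
    next
      case False
      define v where "v = (\<lambda>j. w j / (1 - w i))"
      have "sum v I = 1"
        using False wi by (simp add: v_def flip: sum_divide_distrib)
      moreover have "0 \<le> v j" if "j \<in> I" for j
        using that wi insert.prems(2) by (auto simp: v_def)
      ultimately obtain \<gamma> where \<gamma>: "finite_mixture I v \<nu> \<gamma>" "\<phi> \<gamma> \<le> (\<Sum>j\<in>I. ennreal (v j) * \<phi> (\<nu> j))"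
        using insert.IH[of v] insert.prems(1) by blast
      have rescale: "(\<Sum>j\<in>insert i I. ennreal (w j) * F j) =
          ennreal (w i) * F i + ennreal (1 - w i) * (\<Sum>j\<in>I. ennreal (v j) * F j)" for F
        unfolding v_def using insert.hyps insert.prems(2) False wi(2)
        by (intro sum_insert_rescaled_weights) auto
      have "prob_meas (mix (w i) (\<nu> i) \<gamma>)"
        using insert.prems(1) \<gamma>(1) wi by (intro prob_meas_mix) (auto simp: finite_mixture_def)
      then have "finite_mixture (insert i I) w \<nu> (mix (w i) (\<nu> i) \<gamma>)"
        using insert.prems(1) \<gamma>(1)
        by (simp add: finite_mixture_def emeasure_mix rescale del: sum.insert)
      moreover have "\<phi> (mix (w i) (\<nu> i) \<gamma>) \<le> ennreal (w i) * \<phi> (\<nu> i) + ennreal (1 - w i) * \<phi> \<gamma>"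
        using insert.prems(1) \<gamma>(1) wi by (intro mix_convexD \<phi>) (auto simp: finite_mixture_def)
      then have "\<phi> (mix (w i) (\<nu> i) \<gamma>) \<le> (\<Sum>j\<in>insert i I. ennreal (w j) * \<phi> (\<nu> j))"
        unfolding rescale by (rule order_trans) (intro add_mono mult_left_mono \<gamma>(2), auto)
      ultimately show ?thesis by blast
    qed
  qed
  then show thesis using that by blast
qed

lemma mix_convex_finite_mixture_le:
  assumes "mix_convex \<phi>" "finite_mixture I w \<nu> \<gamma>" "finite I" "\<And>i. i \<in> I \<Longrightarrow> prob_meas (\<nu> i)"
    and "\<And>i. i \<in> I \<Longrightarrow> 0 \<le> w i" "sum w I = 1"
  shows "\<phi> \<gamma> \<le> (\<Sum>i\<in>I. ennreal (w i) * \<phi> (\<nu> i))"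
  using mix_convex_ex_finite_mixture[of \<phi> I \<nu> w] finite_mixture_unique[OF assms(2)] assms by metis

lemma weighted_sum_le_ennreal:
  fixes w :: "'i \<Rightarrow> real" and a :: "'i \<Rightarrow> ennreal"
  assumes "\<And>i. i \<in> I \<Longrightarrow> 0 \<le> w i" "sum w I = 1" "\<And>i. i \<in> I \<Longrightarrow> a i \<le> c"
  shows "(\<Sum>i\<in>I. ennreal (w i) * a i) \<le> c"
proof -
  have "(\<Sum>i\<in>I. ennreal (w i) * a i) \<le> (\<Sum>i\<in>I. ennreal (w i) * c)"
    using assms by (intro sum_mono mult_left_mono) auto
  also have "\<dots> = c"
    using assms by (simp add: sum_distrib_right[symmetric] sum_ennreal)
  finally show ?thesis .
qed

section \<open>Convexity of mutual information in the kernel\<close>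

lemma kl_fun_ge_tangent:
  assumes "0 < a" "0 \<le> t"
  shows "kl_fun a + log 2 a * (t - a) \<le> kl_fun t"
proof (cases "t = 0")
  case True
  then show ?thesis using assms by (simp add: kl_fun_def log_def field_simps)
next
  case False
  then have t: "0 < t" using assms by simp
  have "ln (a / t) \<le> a / t - 1" using assms t by (intro ln_le_minus_one) auto
  then have "t * (ln a - ln t) \<le> t * (a / t - 1)" using assms t
    by (intro mult_left_mono) (auto simp: ln_div)
  also have "\<dots> = a - t" using t by (simp add: field_simps)
  finally have "(a * ln a - (a - 1) + ln a * (t - a)) / ln 2 \<le> (t * ln t - (t - 1)) / ln 2"
    by (intro divide_right_mono) (auto simp: algebra_simps)
  then show ?thesis using assms t
    by (simp add: kl_fun_def log_def diff_divide_distrib add_divide_distrib)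
qed

lemma kl_fun_nonneg: "0 \<le> t \<Longrightarrow> 0 \<le> kl_fun t"
  using kl_fun_ge_tangent[of 1 t] by (simp add: kl_fun_def)

lemma convex_on_kl_fun: "convex_on {0..} kl_fun"
proof (rule convex_onI)
  fix t x y :: real assume t: "0 < t" "t < 1" and xy: "x \<in> {0..}" "y \<in> {0..}"
  define z where "z = (1 - t) * x + t * y"
  have "0 \<le> z" using t xy by (simp add: z_def)
  then consider "z = 0" | "0 < z" by linarith
  then have "kl_fun z \<le> (1 - t) * kl_fun x + t * kl_fun y"
  proof cases
    case 1
    then have "x = 0" "y = 0"
      using t xy add_nonneg_eq_0_iff[of "(1 - t) * x" "t * y"] by (auto simp: z_def)
    then show ?thesis using 1 by (simp add: algebra_simps)
  next
    case 2
    have "kl_fun z = (1 - t) * (kl_fun z + log 2 z * (x - z)) + t * (kl_fun z + log 2 z * (y - z))"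
      by (simp add: z_def algebra_simps)
    also have "\<dots> \<le> (1 - t) * kl_fun x + t * kl_fun y"
      using t xy 2 by (intro add_mono mult_left_mono kl_fun_ge_tangent) auto
    finally show ?thesis .
  qed
  then show "kl_fun ((1 - t) *\<^sub>R x + t *\<^sub>R y) \<le> (1 - t) * kl_fun x + t * kl_fun y"
    by (simp add: z_def)
qed simp

lemma kl_fun_perspective_convex:
  assumes l: "0 \<le> l" "l \<le> 1" and nonneg: "0 \<le> q1" "0 \<le> q2" "0 \<le> k1" "0 \<le> k2"
    and null: "q1 = 0 \<Longrightarrow> k1 = 0" "q2 = 0 \<Longrightarrow> k2 = 0"
    and q: "q = l * q1 + (1 - l) * q2" and k: "k = l * k1 + (1 - l) * k2"
  shows "kl_fun (k / q) * q \<le> l * (kl_fun (k1 / q1) * q1) + (1 - l) * (kl_fun (k2 / q2) * q2)"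
proof (cases "q = 0")
  case True
  then show ?thesis using assms by (simp add: kl_fun_nonneg)
next
  case False
  then have q0: "0 < q" using assms by (simp add: less_le)
  define t where "t = (1 - l) * q2 / q"
  have "0 \<le> l * q1" "0 \<le> (1 - l) * q2" using l nonneg by auto
  then have t: "0 \<le> t" "t \<le> 1" using q0 by (auto simp: t_def q)
  have compl: "1 - t = l * q1 / q" using q0 by (simp add: t_def field_simps q)
  have "k1 = q1 * (k1 / q1)" "k2 = q2 * (k2 / q2)" using null by auto
  then have "k / q = (l * (q1 * (k1 / q1)) + (1 - l) * (q2 * (k2 / q2))) / q"
    unfolding k by (simp only:)
  also have "\<dots> = (1 - t) * (k1 / q1) + t * (k2 / q2)"
    unfolding compl unfolding t_def add_divide_distrib
    by (simp only: mult.assoc times_divide_eq_left)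
  finally have "kl_fun (k / q) \<le> (1 - t) * kl_fun (k1 / q1) + t * kl_fun (k2 / q2)"
    using convex_onD[OF convex_on_kl_fun t, of "k1 / q1" "k2 / q2"] nonneg by simp
  then have "kl_fun (k / q) * q \<le> ((1 - t) * kl_fun (k1 / q1) + t * kl_fun (k2 / q2)) * q"
    using q0 by (intro mult_right_mono) auto
  also have "\<dots> = ((1 - t) * q) * kl_fun (k1 / q1) + (t * q) * kl_fun (k2 / q2)"
    by (simp add: algebra_simps)
  also have "(1 - t) * q = l * q1" using q0 by (simp add: compl)
  also have "t * q = (1 - l) * q2" using q0 by (simp add: t_def)
  finally show ?thesis by (simp add: mult_ac)
qed

lemma markov_kernel_mix:
  assumes K1: "markov_kernel K1" and K2: "markov_kernel K2" and l: "0 \<le> l" "l \<le> 1"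
  shows "markov_kernel (\<lambda>x. mix l (K1 x) (K2 x))"
  unfolding markov_kernel_def
proof (intro measurable_prob_algebraI measurable_subprob_algebra)
  fix x
  have "prob_meas (mix l (K1 x) (K2 x))"
    by (intro prob_meas_mix markov_kernelD K1 K2 l)
  then show "prob_space (mix l (K1 x) (K2 x))" "subprob_space (mix l (K1 x) (K2 x))"
    by (auto simp: prob_meas_def prob_space_imp_subprob_space)
next
  fix A :: "'a set" assume A: "A \<in> sets borel"
  have [measurable]: "(\<lambda>x. emeasure (K1 x) A) \<in> borel_measurable borel"
    "(\<lambda>x. emeasure (K2 x) A) \<in> borel_measurable borel"
    using A by (auto intro!: measurable_emeasure_kernel markov_kernelD K1 K2)
  show "(\<lambda>x. emeasure (mix l (K1 x) (K2 x)) A) \<in> borel_measurable borel"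
    by (subst emeasure_mix) (auto intro!: markov_kernelD K1 K2 A)
qed simp

lemma nn_integral_nn_integral_mix:
  assumes M: "prob_meas M" and K1: "markov_kernel K1" and K2: "markov_kernel K2"
    and l: "0 \<le> l" "l \<le> 1"
    and [measurable]: "h \<in> borel_measurable (borel \<Otimes>\<^sub>M borel)"
  shows "(\<integral>\<^sup>+x. \<integral>\<^sup>+y. h (x, y) \<partial>mix l (K1 x) (K2 x) \<partial>M) =
    ennreal l * (\<integral>\<^sup>+x. \<integral>\<^sup>+y. h (x, y) \<partial>K1 x \<partial>M) + ennreal (1 - l) * (\<integral>\<^sup>+x. \<integral>\<^sup>+y. h (x, y) \<partial>K2 x \<partial>M)"
proof -
  have [measurable_cong]: "sets M = sets borel" by (rule prob_measD[OF M])
  have [measurable]: "(\<lambda>x. \<integral>\<^sup>+y. h (x, y) \<partial>K x) \<in> borel_measurable M" if K: "markov_kernel K" for K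
    by (rule nn_integral_measurable_subprob_algebra2[OF _ measurable_markov_kernel[OF M K]])
      measurable
  have "(\<integral>\<^sup>+x. \<integral>\<^sup>+y. h (x, y) \<partial>mix l (K1 x) (K2 x) \<partial>M) =
      (\<integral>\<^sup>+x. (ennreal l * (\<integral>\<^sup>+y. h (x, y) \<partial>K1 x) + ennreal (1 - l) * (\<integral>\<^sup>+y. h (x, y) \<partial>K2 x)) \<partial>M)"
    by (intro nn_integral_cong nn_integral_mix markov_kernelD K1 K2 l) measurable
  then show ?thesis
    using K1 K2 by (simp add: nn_integral_add nn_integral_cmult)
qed

lemma exp_dist_mix:
  assumes "prob_meas M" "markov_kernel K1" "markov_kernel K2" "0 \<le> l" "l \<le> 1"
    and [measurable]: "case_prod \<Delta> \<in> borel_measurable (borel \<Otimes>\<^sub>M borel)"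
  shows "exp_dist M \<Delta> (\<lambda>x. mix l (K1 x) (K2 x)) = ennreal l * exp_dist M \<Delta> K1
      + ennreal (1 - l) * exp_dist M \<Delta> K2"
  using nn_integral_nn_integral_mix[OF assms(1-5), of "\<lambda>(x, y). ennreal (\<Delta> x y)"]
  by (simp add: exp_dist_def)

lemma outlaw_mix:
  assumes M: "prob_meas M" and K1: "markov_kernel K1" and K2: "markov_kernel K2"
    and l: "0 \<le> l" "l \<le> 1"
  shows "outlaw M (\<lambda>x. mix l (K1 x) (K2 x)) = mix l (outlaw M K1) (outlaw M K2)"
proof (rule prob_meas_eqI)
  show "prob_meas (outlaw M (\<lambda>x. mix l (K1 x) (K2 x)))"
    by (intro prob_meas_outlaw M markov_kernel_mix K1 K2 l)
  show "prob_meas (mix l (outlaw M K1) (outlaw M K2))"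
    by (intro prob_meas_outlaw M prob_meas_mix K1 K2 l)
  fix A :: "'a set" assume A[measurable]: "A \<in> sets borel"
  have "(\<lambda>z. indicator A (snd z)) \<in> borel_measurable ((borel :: 'a measure) \<Otimes>\<^sub>M borel)"
    by measurable
  from nn_integral_nn_integral_mix[OF M K1 K2 l this]
  show "emeasure (outlaw M (\<lambda>x. mix l (K1 x) (K2 x))) A
      = emeasure (mix l (outlaw M K1) (outlaw M K2)) A"
    by (simp add: emeasure_outlaw emeasure_mix M K1 K2 l A markov_kernel_mix prob_meas_outlaw
      prob_measD markov_kernelD)
qed

lemma nn_integral_kl_eq_atoms:
  assumes M: "prob_meas M" and K: "markov_kernel K"
    and C: "countable C" and AE_C: "AE y in outlaw M K. y \<in> C"
  shows "(\<integral>\<^sup>+y. ennreal (kl_fun (kernel_density M K x y)) \<partial>outlaw M K) =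
    (\<integral>\<^sup>+c. ennreal (kl_fun (kernel_density M K x c) * measure (outlaw M K) {c}) \<partial>count_space C)"
proof -
  interpret q: prob_space "outlaw M K" by (rule prob_measD[OF prob_meas_outlaw[OF M K]])
  note measurable_kernel_density_section[OF M K, measurable]
  have "(\<integral>\<^sup>+y. ennreal (kl_fun (kernel_density M K x y)) \<partial>outlaw M K) =
      (\<integral>\<^sup>+c. ennreal (kl_fun (kernel_density M K x c)) * emeasure (outlaw M K) {c} \<partial>count_space C)"
    by (intro nn_integral_countable_support C AE_C prob_measD prob_meas_outlaw M K) measurable
  then show ?thesis by (simp add: q.emeasure_eq_measure ennreal_mult'')
qed

lemma measurable_nn_integral_kl_kernel_density:
  assumes M: "prob_meas M" and K: "markov_kernel K"
  shows "(\<lambda>x. \<integral>\<^sup>+y. ennreal (kl_fun (kernel_density M K x y)) \<partial>outlaw M K) \<in> borel_measurable M"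
proof -
  note [measurable] = measurable_kernel_density[OF M K]
  interpret q: prob_space "outlaw M K" by (rule prob_measD(1)[OF prob_meas_outlaw[OF M K]])
  have [measurable_cong]: "sets M = sets borel" "sets (outlaw M K) = sets borel"
    using prob_measD[OF prob_meas_outlaw[OF M K]] prob_measD[OF M] by auto
  show ?thesis by measurable
qed

lemma AE_outlaw_mix_mem:
  assumes M: "prob_meas M" and K1: "markov_kernel K1" and K2: "markov_kernel K2"
    and l: "0 \<le> l" "l \<le> 1"
    and C: "countable C" and AE_C: "AE y in outlaw M K1. y \<in> C" "AE y in outlaw M K2. y \<in> C"
  shows "AE y in outlaw M (\<lambda>x. mix l (K1 x) (K2 x)). y \<in> C"
  using AE_C l countable_imp_borel[OF C]
  by (simp add: AE_mem_iff_emeasure_eq_1 outlaw_mix M K1 K2 prob_meas_mix prob_meas_outlaw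
    emeasure_mix_eq_1)

lemma nn_integral_kl_mix_le:
  assumes M: "prob_meas M" and K1: "markov_kernel K1" and K2: "markov_kernel K2"
    and l: "0 \<le> l" "l \<le> 1"
    and C: "countable C" and AE_C: "AE y in outlaw M K1. y \<in> C" "AE y in outlaw M K2. y \<in> C"
    and null: "\<forall>c\<in>C. measure (outlaw M K1) {c} = 0 \<longrightarrow> measure (K1 x) {c} = 0"
      "\<forall>c\<in>C. measure (outlaw M K2) {c} = 0 \<longrightarrow> measure (K2 x) {c} = 0"
  defines "K \<equiv> \<lambda>x. mix l (K1 x) (K2 x)"
    and "J \<equiv> \<lambda>K. \<integral>\<^sup>+y. ennreal (kl_fun (kernel_density M K x y)) \<partial>outlaw M K"
  shows "J K \<le> ennreal l * J K1 + ennreal (1 - l) * J K2"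
proof -
  have K: "markov_kernel K" unfolding K_def by (intro markov_kernel_mix K1 K2 l)
  have AE_K: "AE y in outlaw M K. y \<in> C" unfolding K_def
    by (rule AE_outlaw_mix_mem[OF M K1 K2 l C AE_C])
  let ?t = "\<lambda>K c. kl_fun (kernel_density M K x c) * measure (outlaw M K) {c}"
  have "ennreal (?t K c) \<le> ennreal l * ennreal (?t K1 c) + ennreal (1 - l) * ennreal (?t K2 c)"
    if c: "c \<in> C" for c
  proof -
    have "?t K c \<le> l * ?t K1 c + (1 - l) * ?t K2 c"
      unfolding kernel_density_def using null c l
      by (intro kl_fun_perspective_convex l)
         (auto simp: K_def outlaw_mix M K1 K2 l measure_mix prob_meas_outlaw markov_kernelD)
    then have "ennreal (?t K c) \<le> ennreal (l * ?t K1 c + (1 - l) * ?t K2 c)" by (rule ennreal_leI)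
    also have "\<dots> = ennreal l * ennreal (?t K1 c) + ennreal (1 - l) * ennreal (?t K2 c)"
      using l by (subst ennreal_plus) (auto simp: ennreal_mult' kernel_density_nonneg kl_fun_nonneg)
    finally show ?thesis .
  qed
  then have "J K
      \<le> (\<integral>\<^sup>+c. (ennreal l * ennreal (?t K1 c)
          + ennreal (1 - l) * ennreal (?t K2 c)) \<partial>count_space C)"
    unfolding J_def nn_integral_kl_eq_atoms[OF M K C AE_K] by (intro nn_integral_mono) simp
  also have "\<dots> = ennreal l * J K1 + ennreal (1 - l) * J K2"
    by (simp add: J_def nn_integral_add nn_integral_cmult nn_integral_kl_eq_atoms[OF M K1 C AE_C(1)]
        nn_integral_kl_eq_atoms[OF M K2 C AE_C(2)])
  finally show ?thesis .
qed

lemma mutual_info_mix_le: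
  assumes M: "prob_meas M" and K1: "markov_kernel K1" and K2: "markov_kernel K2"
    and l: "0 \<le> l" "l \<le> 1"
    and C: "countable C" and AE_C: "AE y in outlaw M K1. y \<in> C" "AE y in outlaw M K2. y \<in> C"
  shows "mutual_info M (\<lambda>x. mix l (K1 x) (K2 x)) \<le> ennreal l * mutual_info M K1
      + ennreal (1 - l) * mutual_info M K2"
proof -
  let ?K = "\<lambda>x. mix l (K1 x) (K2 x)"
  have K: "markov_kernel ?K" by (intro markov_kernel_mix K1 K2 l)
  note AE_K = AE_outlaw_mix_mem[OF M K1 K2 l C AE_C]
  define J where "J K x = (\<integral>\<^sup>+y. ennreal (kl_fun (kernel_density M K x y)) \<partial>outlaw M K)" for K x
  have [measurable]: "J K1 \<in> borel_measurable M" "J K2 \<in> borel_measurable M"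
    unfolding J_def by (intro measurable_nn_integral_kl_kernel_density M K1 K2)+
  have "AE x in M. J ?K x \<le> ennreal l * J K1 x + ennreal (1 - l) * J K2 x"
    using AE_measure_singleton_eq_0[OF M K1 C] AE_measure_singleton_eq_0[OF M K2 C]
    unfolding J_def by eventually_elim (rule nn_integral_kl_mix_le[OF M K1 K2 l C AE_C])
  then have "(\<integral>\<^sup>+x. J ?K x \<partial>M) \<le> (\<integral>\<^sup>+x. (ennreal l * J K1 x + ennreal (1 - l) * J K2 x) \<partial>M)"
    by (rule nn_integral_mono_AE)
  also have "\<dots> = ennreal l * (\<integral>\<^sup>+x. J K1 x \<partial>M) + ennreal (1 - l) * (\<integral>\<^sup>+x. J K2 x \<partial>M)"
    by (simp add: nn_integral_add nn_integral_cmult)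
  finally show ?thesis
    by (simp add: J_def mutual_info_eq_nn_integral_nn_integral_kl[OF M _ C] K K1 K2 AE_C AE_K)
qed

section \<open>The converse\<close>

abbreviation iid :: "nat \<Rightarrow> 'a measure \<Rightarrow> (nat \<Rightarrow> 'a) measure" where
  "iid n M \<equiv> \<Pi>\<^sub>M i\<in>{..<n}. M"

lemma enn2ereal_le_ereal_iff: "enn2ereal a \<le> ereal P \<longleftrightarrow> 0 \<le> P \<and> a \<le> ennreal P"
proof (cases "0 \<le> P")
  case True
  then show ?thesis
    by (metis e2ennreal_ereal e2ennreal_enn2ereal enn2ereal_ennreal less_eq_ennreal.rep_eq)
next
  case False
  then show ?thesis using order_trans[OF enn2ereal_nonneg[of a], of "ereal P"] by auto
qed

lemma enn2ereal_le_of_mult_le: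
  assumes "0 < n" "of_nat n * a \<le> b" "enn2ereal b \<le> ereal (real n * B)"
  shows "enn2ereal a \<le> ereal B"
proof -
  from assms have B: "0 \<le> B" "b \<le> ennreal (real n * B)"
    by (auto simp: enn2ereal_le_ereal_iff zero_le_mult_iff)
  have "ennreal (real n) * a \<le> ennreal (real n) * ennreal B"
    using order_trans[OF assms(2) B(2)] B(1)
    by (simp add: ennreal_of_nat_eq_real_of_nat ennreal_mult)
  then have "a \<le> ennreal B"
    using assms(1) by (subst (asm) ennreal_mult_le_mult_iff) auto
  then show ?thesis using B(1) by (simp add: enn2ereal_le_ereal_iff)
qed

lemma nn_integral_PiM_update:
  assumes "prob_space M" "finite I" "i \<in> I" and F: "F \<in> borel_measurable (\<Pi>\<^sub>M i\<in>I. M)"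
  shows "(\<integral>\<^sup>+x. \<integral>\<^sup>+w. F (w(i := x)) \<partial>(\<Pi>\<^sub>M i\<in>I. M) \<partial>M) = (\<integral>\<^sup>+w. F w \<partial>(\<Pi>\<^sub>M i\<in>I. M))"
proof -
  interpret M: prob_space M by fact
  interpret product_prob_space "\<lambda>_. M" I ..
  define J where "J = I - {i}"
  have J: "finite J" "i \<notin> J" "I = insert i J" using assms by (auto simp: J_def)
  have [measurable]: "(\<lambda>w. F (w(i := x))) \<in> borel_measurable (\<Pi>\<^sub>M i\<in>J'. M)"
    if "x \<in> space M" "insert i J = insert i J'" for x J'
    using that
    by (intro measurable_compose[OF _ F[unfolded J(3)]] measurable_fun_upd[where J = J']) auto
  have "(\<integral>\<^sup>+w. F (w(i := x)) \<partial>(\<Pi>\<^sub>M i\<in>insert i J. M)) = (\<integral>\<^sup>+w. F (w(i := x)) \<partial>(\<Pi>\<^sub>M i\<in>J. M))"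
    if x: "x \<in> space M" for x
    using x by (subst product_nn_integral_insert[OF J(1,2)]) (auto simp: M.emeasure_space_1)
  then have "(\<integral>\<^sup>+x. \<integral>\<^sup>+w. F (w(i := x)) \<partial>(\<Pi>\<^sub>M i\<in>insert i J. M) \<partial>M)
      = (\<integral>\<^sup>+x. \<integral>\<^sup>+w. F (w(i := x)) \<partial>(\<Pi>\<^sub>M i\<in>J. M) \<partial>M)"
    by (intro nn_integral_cong) auto
  also have "\<dots> = (\<integral>\<^sup>+w. F w \<partial>(\<Pi>\<^sub>M i\<in>insert i J. M))"
    by (rule product_nn_integral_insert_rev[symmetric]) (use J F[unfolded J(3)] in auto)
  finally show ?thesis by (simp add: J(3))
qed

lemma nn_integral_nat_valued:
  fixes f :: "'b \<Rightarrow> nat"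
  assumes [measurable]: "f \<in> N \<rightarrow>\<^sub>M count_space UNIV" "\<And>z. F z \<in> borel_measurable N"
  shows "(\<integral>\<^sup>+w. F (f w) w \<partial>N) = (\<Sum>z. \<integral>\<^sup>+w. F z w * indicator (f -` {z} \<inter> space N) w \<partial>N)"
proof -
  have "(\<integral>\<^sup>+w. F (f w) w \<partial>N) = (\<integral>\<^sup>+w. (\<Sum>z. F z w * indicator (f -` {z} \<inter> space N) w) \<partial>N)"
  proof (rule nn_integral_cong)
    fix w assume "w \<in> space N"
    then have "(\<lambda>z. F z w * indicator (f -` {z} \<inter> space N) w)
        = (\<lambda>z. if z = f w then F (f w) w else 0)"
      by (auto simp: fun_eq_iff split: split_indicator)
    then show "F (f w) w = (\<Sum>z. F z w * indicator (f -` {z} \<inter> space N) w)"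
      using sums_single[of "f w" "\<lambda>_. F (f w) w"] by (simp add: sums_iff)
  qed
  also have "\<dots> = (\<Sum>z. \<integral>\<^sup>+w. F z w * indicator (f -` {z} \<inter> space N) w \<partial>N)"
    by (intro nn_integral_suminf)
      (auto intro!: borel_measurable_times_ennreal borel_measurable_indicator
      measurable_sets[OF assms(1)] assms)
  finally show ?thesis .
qed

lemma nn_integral_neg_ln_prob_eq_entropy:
  fixes f :: "'b \<Rightarrow> nat"
  assumes N: "prob_space N" and [measurable]: "f \<in> N \<rightarrow>\<^sub>M count_space UNIV"
  shows "(\<integral>\<^sup>+w. ennreal (- ln (measure N (f -` {f w} \<inter> space N))) \<partial>N)
      = ennreal (ln 2) * entropy_disc N f"
proof -
  interpret prob_space N by fact
  define p where "p z = measure N (f -` {z} \<inter> space N)" for z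
  have "0 \<le> p z" "p z \<le> 1" for z by (auto simp: p_def)
  then have neg_ln: "0 \<le> - ln (p z)" for z by (cases "p z = 0") (auto simp: less_le)
  have "(\<integral>\<^sup>+w. ennreal (- ln (p (f w))) \<partial>N)
      = (\<Sum>z. ennreal (- ln (p z)) * emeasure N (f -` {z} \<inter> space N))"
    by (subst nn_integral_nat_valued[where F = "\<lambda>z w. ennreal (- ln (p z))"])
       (auto intro!: suminf_cong nn_integral_cmult_indicator)
  also have "\<dots> = (\<Sum>z. ennreal (ln 2) * ennreal (- (p z * log 2 (p z))))"
  proof (intro suminf_cong)
    fix z
    have "- ln (p z) * p z = ln 2 * (- (p z * log 2 (p z)))"
      by (simp add: log_def)
    then show "ennreal (- ln (p z)) * emeasure N (f -` {z} \<inter> space N)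
        = ennreal (ln 2) * ennreal (- (p z * log 2 (p z)))"
      using neg_ln[of z]
      by (simp only: emeasure_eq_measure ennreal_mult'[symmetric] ln_gt_zero less_imp_le
        flip: p_def)
  qed
  also have "\<dots> = ennreal (ln 2) * entropy_disc N f"
    by (simp add: entropy_disc_def p_def)
  finally show ?thesis by (simp add: p_def)
qed

lemma (in prob_space) AE_prob_vimage_pos:
  fixes f :: "'a \<Rightarrow> nat"
  assumes [measurable]: "f \<in> M \<rightarrow>\<^sub>M count_space UNIV"
  shows "AE w in M. 0 < prob (f -` {f w} \<inter> space M)"
proof -
  have "AE w in M. f w = z \<longrightarrow> 0 < prob (f -` {z} \<inter> space M)" for z
  proof (cases "prob (f -` {z} \<inter> space M) = 0")
    case True
    then have "f -` {z} \<inter> space M \<in> null_sets M"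
      by (intro null_setsI) (auto simp: emeasure_eq_measure)
    then show ?thesis by (rule AE_mp[OF AE_not_in]) auto
  qed (simp add: zero_less_measure_iff)
  then have "AE w in M. \<forall>z. f w = z \<longrightarrow> 0 < prob (f -` {z} \<inter> space M)"
    by (subst AE_all_countable) blast
  then show ?thesis by (rule eventually_mono) blast
qed

lemma sum_ln_le_mult_prod:
  fixes r :: "'i \<Rightarrow> real"
  assumes I: "finite I" and r: "\<forall>i\<in>I. 0 < r i" and p: "0 < p" "p \<le> 1"
  shows "(\<Sum>i\<in>I. ennreal (ln (r i) - 1 + 1 / r i)) + of_nat (card I + 1)
    \<le> ennreal (p * (\<Prod>i\<in>I. r i)) + (ennreal (- ln p) + (\<Sum>i\<in>I. ennreal (1 / r i)))"
proof -
  let ?Y = "p * (\<Prod>i\<in>I. r i)"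
  have Y: "0 < ?Y" using r p by (intro mult_pos_pos prod_pos) auto
  have "(\<Sum>i\<in>I. ln (r i)) = ln ?Y - ln p"
    using r p I by (subst ln_mult) (auto intro!: prod_pos ln_prod[symmetric])
  also have "\<dots> \<le> ?Y - 1 - ln p" using ln_le_minus_one[OF Y] by simp
  finally have real_le: "(\<Sum>i\<in>I. ln (r i) - 1 + 1 / r i) + real (card I + 1)
      \<le> ?Y + (- ln p + (\<Sum>i\<in>I. 1 / r i))"
    by (simp add: sum.distrib sum_subtractf)
  have "0 \<le> ln (r i) - 1 + 1 / r i" if "i \<in> I" for i
    using r that ln_le_minus_one[of "1 / r i"] by (auto simp: ln_div)
  then have "(\<Sum>i\<in>I. ennreal (ln (r i) - 1 + 1 / r i)) + of_nat (card I + 1) =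
      ennreal ((\<Sum>i\<in>I. ln (r i) - 1 + 1 / r i) + real (card I + 1))"
    by (subst ennreal_plus) (auto simp: sum_ennreal ennreal_of_nat_eq_real_of_nat
      intro!: sum_nonneg)
  also have "\<dots> \<le> ennreal (?Y + (- ln p + (\<Sum>i\<in>I. 1 / r i)))"
    using real_le by (rule ennreal_leI)
  also have "\<dots> = ennreal ?Y + (ennreal (- ln p) + (\<Sum>i\<in>I. ennreal (1 / r i)))"
  proof -
    have "0 \<le> - ln p" "0 \<le> (\<Sum>i\<in>I. 1 / r i)" "(\<Sum>i\<in>I. ennreal (1 / r i)) = ennreal (\<Sum>i\<in>I. 1 / r i)"
      using r p by (auto simp: less_imp_le sum_ennreal intro!: sum_nonneg)
    then show ?thesis using Y by (simp only: ennreal_plus add_nonneg_nonneg less_imp_le)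
  qed
  finally show ?thesis .
qed

text \<open>\<open>E ln Y \<le> E Y - 1 \<le> 0\<close> for \<open>Y = p \<Prod>\<^sub>i r\<^sub>i\<close>. Adding \<open>\<Sum>\<^sub>i (1 / r\<^sub>i - 1)\<close> on both sides makes every
  term nonnegative, so that no integrability is needed.\<close>

lemma (in prob_space) sum_nn_integral_ln_le:
  fixes r :: "'i \<Rightarrow> 'a \<Rightarrow> real" and p :: "'a \<Rightarrow> real"
  assumes I: "finite I" and [measurable]: "\<And>i. i \<in> I \<Longrightarrow> r i \<in> borel_measurable M"
    and r_pos: "AE w in M. \<forall>i\<in>I. 0 < r i w"
    and [measurable]: "p \<in> borel_measurable M" and p_bounds: "AE w in M. 0 < p w \<and> p w \<le> 1"
    and le_1: "(\<integral>\<^sup>+w. ennreal (p w * (\<Prod>i\<in>I. r i w)) \<partial>M) \<le> 1"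
  shows "(\<Sum>i\<in>I. \<integral>\<^sup>+w. ennreal (ln (r i w) - 1 + 1 / r i w) \<partial>M) + of_nat (card I)
    \<le> (\<integral>\<^sup>+w. ennreal (- ln (p w)) \<partial>M) + (\<Sum>i\<in>I. \<integral>\<^sup>+w. ennreal (1 / r i w) \<partial>M)"
proof -
  define Y where "Y w = p w * (\<Prod>i\<in>I. r i w)" for w
  have [measurable]: "Y \<in> borel_measurable M" unfolding Y_def by measurable
  have "AE w in M. (\<Sum>i\<in>I. ennreal (ln (r i w) - 1 + 1 / r i w)) + of_nat (card I + 1)
      \<le> ennreal (Y w) + (ennreal (- ln (p w)) + (\<Sum>i\<in>I. ennreal (1 / r i w)))"
    using r_pos p_bounds unfolding Y_def by eventually_elim (intro sum_ln_le_mult_prod I, auto)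
  note integrated = nn_integral_mono_AE[OF this]
  let ?lhs = "(\<Sum>i\<in>I. \<integral>\<^sup>+w. ennreal (ln (r i w) - 1 + 1 / r i w) \<partial>M) + of_nat (card I)"
  let ?rhs = "(\<integral>\<^sup>+w. ennreal (- ln (p w)) \<partial>M) + (\<Sum>i\<in>I. \<integral>\<^sup>+w. ennreal (1 / r i w) \<partial>M)"
  have "1 + ?lhs = (\<integral>\<^sup>+w. (\<Sum>i\<in>I. ennreal (ln (r i w) - 1 + 1 / r i w)) + of_nat (card I + 1) \<partial>M)"
    by (subst nn_integral_add) (auto simp: nn_integral_sum emeasure_space_1 ac_simps)
  also note integrated
  also have "(\<integral>\<^sup>+w. ennreal (Y w) + (ennreal (- ln (p w)) + (\<Sum>i\<in>I. ennreal (1 / r i w))) \<partial>M)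
      = (\<integral>\<^sup>+w. ennreal (Y w) \<partial>M) + ?rhs"
    by (subst nn_integral_add, measurable, subst nn_integral_add) (auto simp: nn_integral_sum)
  also have "\<dots> \<le> 1 + ?rhs"
    using le_1 by (intro add_right_mono) (simp add: Y_def)
  finally show ?thesis by (subst (asm) ennreal_add_left_cancel_le) auto
qed

lemma nn_integral_kl_fun_eq:
  fixes f :: "'b \<Rightarrow> real"
  assumes [measurable]: "f \<in> borel_measurable N" and f: "\<And>z. 0 \<le> f z"
  shows "ennreal (ln 2) * (\<integral>\<^sup>+z. ennreal (kl_fun (f z)) \<partial>N) =
    (\<integral>\<^sup>+z. ennreal (f z) * ennreal (ln (f z) - 1 + 1 / f z) \<partial>N) + emeasure N {z \<in> space N. f z = 0}"
proof -
  have "ennreal (ln 2) * ennreal (kl_fun (f z)) = ennreal (f z) * ennreal (ln (f z) - 1 + 1 / f z)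
      + indicator {z \<in> space N. f z = 0} z"
    if "z \<in> space N" for z
  proof (cases "f z = 0")
    case True
    then show ?thesis using that by (simp add: kl_fun_def flip: ennreal_mult')
  next
    case False
    then have "ln 2 * kl_fun (f z) = f z * (ln (f z) - 1 + 1 / f z)"
      by (simp add: kl_fun_def log_def field_simps)
    then show ?thesis using False f[of z] by (simp flip: ennreal_mult')
  qed
  then have "ennreal (ln 2) * (\<integral>\<^sup>+z. ennreal (kl_fun (f z)) \<partial>N) =
      (\<integral>\<^sup>+z. ennreal (f z) * ennreal (ln (f z) - 1 + 1 / f z)
          + indicator {z \<in> space N. f z = 0} z \<partial>N)"
    by (simp add: nn_integral_cmult[symmetric] cong: nn_integral_cong)
  then show ?thesis by (simp add: nn_integral_add)
qed

lemma (in prob_space) nn_integral_mult_inverse_eq: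
  fixes f :: "'a \<Rightarrow> real"
  assumes [measurable]: "f \<in> borel_measurable M" and f: "\<And>z. 0 \<le> f z"
  shows "(\<integral>\<^sup>+z. ennreal (f z) * ennreal (1 / f z) \<partial>M) + emeasure M {z \<in> space M. f z = 0} = 1"
proof -
  have "ennreal (f z) * ennreal (1 / f z) + indicator {z \<in> space M. f z = 0} z = 1"
    if "z \<in> space M" for z
    using that f[of z] by (cases "f z = 0") (auto simp flip: ennreal_mult')
  then have "(\<integral>\<^sup>+z. ennreal (f z) * ennreal (1 / f z) + indicator {z \<in> space M. f z = 0} z \<partial>M) = 1"
    by (simp add: emeasure_space_1 cong: nn_integral_cong)
  then show ?thesis by (simp add: nn_integral_add)
qed

text \<open>The channel seen by a symbol placed at a uniformly random position of the block.\<close>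

definition code_kernel ::
  "'a::polish_space measure \<Rightarrow> nat \<Rightarrow> ((nat \<Rightarrow> 'a) \<Rightarrow> nat) \<Rightarrow> (nat \<Rightarrow> nat \<Rightarrow> 'a) \<Rightarrow> 'a \<Rightarrow> 'a measure" where
  "code_kernel M n enc dec x =
    distr (uniform_count_measure {..<n} \<Otimes>\<^sub>M iid n M) borel (\<lambda>(t, w). dec (enc (w(t := x))) t)"

locale block_code =
  fixes M :: "'a::polish_space measure" and n :: nat
    and enc :: "(nat \<Rightarrow> 'a) \<Rightarrow> nat" and dec :: "nat \<Rightarrow> nat \<Rightarrow> 'a"
  assumes M: "prob_meas M" and n: "0 < n"
    and measurable_enc_borel: "enc \<in> iid n borel \<rightarrow>\<^sub>M count_space UNIV"
begin

abbreviation "K \<equiv> code_kernel M n enc dec"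
abbreviation "q \<equiv> outlaw M K"
abbreviation "r \<equiv> kernel_density M K"

sublocale M: prob_space M by (rule prob_measD[OF M])
sublocale iid: product_prob_space "\<lambda>_. M" "{..<n}" ..
sublocale pos: prob_space "uniform_count_measure {..<n}"
  using n by (intro prob_space_uniform_count_measure) (auto simp: lessThan_empty_iff)
sublocale pos_iid: pair_prob_space "uniform_count_measure {..<n}" "iid n M" ..

lemma sets_M [measurable_cong]: "sets M = sets borel" by (rule prob_measD[OF M])

lemma measurable_enc [measurable]: "enc \<in> iid n M \<rightarrow>\<^sub>M count_space UNIV"
  using measurable_enc_borel by (subst measurable_cong_sets[OF sets_PiM_cong[OF refl sets_M] refl])

lemma measurable_dec_enc [measurable]: "(\<lambda>w. dec (enc w) t) \<in> iid n M \<rightarrow>\<^sub>M borel"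
  by (rule measurable_compose[OF measurable_enc]) auto

lemma measurable_coord [measurable (raw)]: "t < n \<Longrightarrow> (\<lambda>w. w t) \<in> iid n M \<rightarrow>\<^sub>M borel"
  using measurable_component_singleton[of t "{..<n}" "\<lambda>_. M"]
  by (simp add: measurable_cong_sets[OF refl sets_M])

lemma measurable_dec_enc_update:
  assumes "t < n" "X \<in> N \<rightarrow>\<^sub>M M" "W \<in> N \<rightarrow>\<^sub>M iid n M"
  shows "(\<lambda>z. dec (enc ((W z)(t := X z))) t) \<in> N \<rightarrow>\<^sub>M borel"
  using assms
  by (intro measurable_compose[OF _ measurable_dec_enc] measurable_fun_upd[where J = "{..<n}"]) auto

lemma measurable_code_map:
  "(\<lambda>(x, t, w). dec (enc (w(t := x))) t)
      \<in> borel \<Otimes>\<^sub>M (uniform_count_measure {..<n} \<Otimes>\<^sub>M iid n M) \<rightarrow>\<^sub>M borel"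
proof -
  let ?N = "(borel :: 'a measure) \<Otimes>\<^sub>M (uniform_count_measure {..<n} \<Otimes>\<^sub>M iid n M)"
  have "(\<lambda>z. (\<lambda>t z. dec (enc ((snd (snd z))(t := fst z))) t) (fst (snd z)) z) \<in> ?N \<rightarrow>\<^sub>M borel"
  proof (rule measurable_compose_countable'[where I = "{..<n}"])
    show "(\<lambda>z. dec (enc ((snd (snd z))(t := fst z))) t) \<in> ?N \<rightarrow>\<^sub>M borel" if "t \<in> {..<n}" for t
      using that by (intro measurable_dec_enc_update) auto
    show "(\<lambda>z. fst (snd z)) \<in> ?N \<rightarrow>\<^sub>M count_space {..<n}" by measurable
  qed simp
  then show ?thesis by (simp add: case_prod_beta')
qed

lemma markov_kernel_code: "markov_kernel K"
proof -
  have "uniform_count_measure {..<n} \<Otimes>\<^sub>M iid n M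
      \<in> space (prob_algebra (uniform_count_measure {..<n} \<Otimes>\<^sub>M iid n M))"
    by (auto simp: space_prob_algebra intro: pos_iid.prob_space_axioms)
  then show ?thesis
    unfolding markov_kernel_def code_kernel_def[abs_def] using measurable_code_map
    by (intro measurable_distr_prob_space2[OF measurable_const]) (simp_all add: case_prod_beta')
qed

lemma prob_meas_output: "prob_meas q" by (rule prob_meas_outlaw[OF M markov_kernel_code])

sublocale q: prob_space q by (rule prob_measD[OF prob_meas_output])
sublocale M_q: pair_prob_space M q ..

lemma sets_output [measurable_cong]: "sets q = sets borel" by (rule prob_measD[OF prob_meas_output])

lemma nn_integral_code_kernel:
  assumes [measurable]: "h \<in> borel_measurable borel"
  shows "(\<integral>\<^sup>+y. h y \<partial>K x) = ennreal (1 / n) * (\<Sum>t<n. \<integral>\<^sup>+w. h (dec (enc (w(t := x))) t) \<partial>iid n M)"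
proof -
  have [measurable]: "(\<lambda>(t, w). dec (enc (w(t := x))) t)
      \<in> uniform_count_measure {..<n} \<Otimes>\<^sub>M iid n M \<rightarrow>\<^sub>M borel"
    using measurable_compose[OF measurable_Pair1' measurable_code_map, of x] by simp
  have "(\<integral>\<^sup>+y. h y \<partial>K x) = (\<integral>\<^sup>+z. h ((\<lambda>(t, w). dec (enc (w(t := x))) t) z)
      \<partial>(uniform_count_measure {..<n} \<Otimes>\<^sub>M iid n M))"
    unfolding code_kernel_def by (subst nn_integral_distr) auto
  also have "\<dots> = (\<integral>\<^sup>+t. \<integral>\<^sup>+w. h (dec (enc (w(t := x))) t) \<partial>iid n M \<partial>uniform_count_measure {..<n})"
    by (subst iid.P.nn_integral_fst[symmetric]) auto
  finally show ?thesis
    by (simp add: uniform_count_measure_def nn_integral_point_measure_finite sum_distrib_left)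
qed

lemma sum_nn_integral_code:
  assumes [measurable]: "\<phi> \<in> borel_measurable (borel \<Otimes>\<^sub>M borel)"
  shows "(\<Sum>t<n. \<integral>\<^sup>+w. \<phi> (w t, dec (enc w) t) \<partial>iid n M) = of_nat n * (\<integral>\<^sup>+x. \<integral>\<^sup>+y. \<phi> (x, y) \<partial>K x \<partial>M)"
proof -
  have [measurable]: "(\<lambda>x. \<integral>\<^sup>+w. \<phi> (x, dec (enc (w(t := x))) t) \<partial>iid n M) \<in> borel_measurable M"
    if t: "t < n" for t
  proof -
    have [measurable]: "(\<lambda>z. dec (enc ((snd z)(t := fst z))) t) \<in> M \<Otimes>\<^sub>M iid n M \<rightarrow>\<^sub>M borel"
      using t by (intro measurable_dec_enc_update) auto
    have "(\<lambda>(x, w). \<phi> (x, dec (enc (w(t := x))) t)) \<in> borel_measurable (M \<Otimes>\<^sub>M iid n M)"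
      unfolding case_prod_beta' by measurable
    then show ?thesis by (rule iid.P.borel_measurable_nn_integral)
  qed
  have "of_nat n * (\<integral>\<^sup>+x. \<integral>\<^sup>+y. \<phi> (x, y) \<partial>K x \<partial>M)
      = of_nat n
          * (\<integral>\<^sup>+x. ennreal (1 / n) * (\<Sum>t<n. \<integral>\<^sup>+w. \<phi> (x, dec (enc (w(t := x))) t) \<partial>iid n M) \<partial>M)"
    by (intro arg_cong2[where f = "(*)"] nn_integral_cong refl nn_integral_code_kernel) measurable
  also have "\<dots>
      = of_nat n * ennreal (1 / n) * (\<Sum>t<n. \<integral>\<^sup>+x. \<integral>\<^sup>+w. \<phi> (x, dec (enc (w(t := x))) t) \<partial>iid n M \<partial>M)"
    by (subst nn_integral_cmult, measurable, subst nn_integral_sum) (auto simp: mult.assoc)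
  also have "of_nat n * ennreal (1 / n) = 1"
    using n by (simp add: ennreal_of_nat_eq_real_of_nat flip: ennreal_mult')
  also have "(\<Sum>t<n. \<integral>\<^sup>+x. \<integral>\<^sup>+w. \<phi> (x, dec (enc (w(t := x))) t) \<partial>iid n M \<partial>M)
      = (\<Sum>t<n. \<integral>\<^sup>+w. \<phi> (w t, dec (enc w) t) \<partial>iid n M)"
  proof (intro sum.cong refl)
    fix t assume "t \<in> {..<n}"
    then show "(\<integral>\<^sup>+x. \<integral>\<^sup>+w. \<phi> (x, dec (enc (w(t := x))) t) \<partial>iid n M \<partial>M)
        = (\<integral>\<^sup>+w. \<phi> (w t, dec (enc w) t) \<partial>iid n M)"
      using nn_integral_PiM_update[OF M.prob_space_axioms finite_lessThan, of t n
        "\<lambda>w. \<phi> (w t, dec (enc w) t)"] by simp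
  qed
  finally show ?thesis by simp
qed

lemma finite_mixture_output:
  "finite_mixture {..<n} (\<lambda>_. 1 / n) (\<lambda>t. distr (iid n M) borel (\<lambda>w. dec (enc w) t)) q"
  unfolding finite_mixture_def
proof (intro conjI ballI)
  fix A :: "'a set" assume A[measurable]: "A \<in> sets borel"
  have "ennreal (1 / n) * of_nat n = 1"
    using n by (simp add: ennreal_of_nat_eq_real_of_nat flip: ennreal_mult')
  then have "emeasure q A
      = ennreal (1 / n) * (of_nat n * (\<integral>\<^sup>+x. \<integral>\<^sup>+y. indicator A (snd (x, y)) \<partial>K x \<partial>M))"
    using nn_integral_outlaw[OF M markov_kernel_code, of "indicator A"] A sets_output
    by (simp add: mult.assoc[symmetric])
  also have "\<dots> = (\<Sum>t<n. ennreal (1 / n) * (\<integral>\<^sup>+w. indicator A (dec (enc w) t) \<partial>iid n M))"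
    by (subst sum_nn_integral_code[symmetric]) (auto simp: sum_distrib_left)
  also have "\<dots> = (\<Sum>t<n. ennreal (1 / n) * emeasure (distr (iid n M) borel (\<lambda>w. dec (enc w) t)) A)"
    by (intro sum.cong refl) (simp flip: nn_integral_indicator add: nn_integral_distr)
  finally show "emeasure q A
      = (\<Sum>t<n. ennreal (1 / n) * emeasure (distr (iid n M) borel (\<lambda>w. dec (enc w) t)) A)" .
qed (rule prob_meas_output)

definition codebook :: "'a set" where "codebook = (\<lambda>(z, t). dec z t) ` UNIV"

lemma countable_codebook: "countable codebook"
  unfolding codebook_def by (intro countable_image) auto

lemma AE_output_codebook: "AE y in q. y \<in> codebook"
proof -
  have "emeasure (distr (iid n M) borel (\<lambda>w. dec (enc w) t)) codebook = 1" for t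
  proof -
    have "(\<lambda>w. dec (enc w) t) -` codebook \<inter> space (iid n M) = space (iid n M)"
      by (auto simp: codebook_def)
    then show ?thesis
      using countable_imp_borel[OF countable_codebook]
      by (simp add: emeasure_distr iid.P.emeasure_space_1)
  qed
  then have "emeasure q codebook = 1"
    using finite_mixture_output countable_imp_borel[OF countable_codebook] n
    by (simp add: finite_mixture_def ennreal_of_nat_eq_real_of_nat flip: ennreal_mult')
  then show ?thesis
    using AE_mem_iff_emeasure_eq_1[OF prob_meas_output countable_imp_borel[OF countable_codebook]]
    by simp
qed

lemma measurable_density [measurable]: "case_prod r \<in> borel_measurable (borel \<Otimes>\<^sub>M borel)"
  by (rule measurable_kernel_density[OF M markov_kernel_code])

lemma sum_nn_integral_code_density:
  assumes [measurable]: "\<phi> \<in> borel_measurable (borel \<Otimes>\<^sub>M borel)"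
  shows "(\<Sum>t<n. \<integral>\<^sup>+w. \<phi> (w t, dec (enc w) t) \<partial>iid n M)
      = of_nat n * (\<integral>\<^sup>+z. ennreal (case_prod r z) * \<phi> z \<partial>(M \<Otimes>\<^sub>M q))"
proof -
  have "(\<integral>\<^sup>+x. \<integral>\<^sup>+y. \<phi> (x, y) \<partial>K x \<partial>M) = (\<integral>\<^sup>+x. \<integral>\<^sup>+y. ennreal (r x y) * \<phi> (x, y) \<partial>q \<partial>M)"
    by (rule nn_integral_kernel_eq_density[OF M markov_kernel_code countable_codebook
      AE_output_codebook]) measurable
  also have "\<dots> = (\<integral>\<^sup>+z. ennreal (case_prod r z) * \<phi> z \<partial>(M \<Otimes>\<^sub>M q))"
    by (subst q.nn_integral_fst[symmetric]) auto
  finally show ?thesis by (simp add: sum_nn_integral_code)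
qed

definition prob_msg :: "nat \<Rightarrow> real" where
  "prob_msg z = measure (iid n M) (enc -` {z} \<inter> space (iid n M))"

definition symbol_density :: "nat \<Rightarrow> (nat \<Rightarrow> 'a) \<Rightarrow> real" where
  "symbol_density t w = r (w t) (dec (enc w) t)"

lemma measurable_symbol_density [measurable]:
  "t < n \<Longrightarrow> symbol_density t \<in> borel_measurable (iid n M)"
  unfolding symbol_density_def[abs_def] by measurable

lemma nn_integral_likelihood_le_1:
  "(\<integral>\<^sup>+w. ennreal (prob_msg (enc w) * (\<Prod>t<n. symbol_density t w)) \<partial>iid n M) \<le> 1"
proof -
  let ?F = "\<lambda>z w. ennreal (prob_msg z) * (\<Prod>t<n. ennreal (r (w t) (dec z t)))"
  have r_section: "(\<lambda>x. ennreal (r x y)) \<in> borel_measurable M" for y by measurable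
  then have [measurable]: "(\<lambda>w. ennreal (r (w t) y)) \<in> borel_measurable (iid n M)"
    if "t < n" for t y
    using measurable_compose[OF measurable_component_singleton[of t "{..<n}"
      "\<lambda>_. M"] r_section] that by simp
  have "(\<integral>\<^sup>+w. ennreal (prob_msg (enc w) * (\<Prod>t<n. symbol_density t w)) \<partial>iid n M)
      = (\<integral>\<^sup>+w. ?F (enc w) w \<partial>iid n M)"
    by (simp add: symbol_density_def ennreal_mult prob_msg_def prod_nonneg kernel_density_nonneg
      prod_ennreal)
  also have "\<dots> = (\<Sum>z. \<integral>\<^sup>+w. ?F z w * indicator (enc -` {z} \<inter> space (iid n M)) w \<partial>iid n M)"
    by (rule nn_integral_nat_valued) measurable
  also have "\<dots> \<le> (\<Sum>z. emeasure (iid n M) (enc -` {z} \<inter> space (iid n M)))"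
  proof (intro suminf_le)
    fix z
    have "(\<integral>\<^sup>+w. ?F z w * indicator (enc -` {z} \<inter> space (iid n M)) w \<partial>iid n M)
        \<le> (\<integral>\<^sup>+w. ?F z w \<partial>iid n M)"
      by (intro nn_integral_mono) (auto split: split_indicator)
    also have "\<dots> = ennreal (prob_msg z) * (\<Prod>t<n. \<integral>\<^sup>+x. ennreal (r x (dec z t)) \<partial>M)"
      by (subst nn_integral_cmult, measurable,
          subst iid.product_nn_integral_prod[where f = "\<lambda>t x. ennreal (r x (dec z t))"])
         (auto intro: r_section)
    also have "\<dots> \<le> ennreal (prob_msg z) * 1"
      by (intro mult_left_mono prod_le_1)
        (auto simp: nn_integral_kernel_density_source_le_1[OF M markov_kernel_code])
    finally show "(\<integral>\<^sup>+w. ?F z w * indicator (enc -` {z} \<inter> space (iid n M)) w \<partial>iid n M)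
        \<le> emeasure (iid n M) (enc -` {z} \<inter> space (iid n M))"
      by (simp add: prob_msg_def iid.P.emeasure_eq_measure)
  qed auto
  also have "\<dots> = (\<integral>\<^sup>+w. 1 \<partial>iid n M)"
    by (subst nn_integral_nat_valued[where F = "\<lambda>_ _. 1" and f = enc]) auto
  finally show ?thesis by (simp add: iid.P.emeasure_space_1)
qed

lemma AE_symbol_density_pos: "AE w in iid n M. \<forall>t\<in>{..<n}. 0 < symbol_density t w"
proof -
  have "(\<Sum>t<n. \<integral>\<^sup>+w. (if symbol_density t w = 0 then 1 else 0) \<partial>iid n M)
      = of_nat n
          * (\<integral>\<^sup>+z. ennreal (case_prod r z) * (if case_prod r z = 0 then 1 else 0) \<partial>(M \<Otimes>\<^sub>M q))"
    using sum_nn_integral_code_density[of "\<lambda>z. if case_prod r z = 0 then 1 else 0"]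
    by (simp add: symbol_density_def)
  also have "\<dots> = 0" by (simp add: if_distrib[of "(*) _"] cong: if_cong)
  finally have zero: "(\<integral>\<^sup>+w. (if symbol_density t w = 0 then 1 else 0) \<partial>iid n M) = 0"
    if "t < n" for t
    using that by simp
  have "AE w in iid n M. 0 < symbol_density t w" if "t < n" for t
  proof -
    have "AE w in iid n M. (if symbol_density t w = 0 then 1 else 0) = (0::ennreal)"
      using that zero[OF that] by (subst nn_integral_0_iff_AE[symmetric]) auto
    then show ?thesis
      by eventually_elim (auto simp: symbol_density_def less_le kernel_density_nonneg
        split: if_splits)
  qed
  then show ?thesis by (subst AE_ball_countable) auto
qed

proposition mutual_info_le_entropy: "of_nat n * mutual_info M K \<le> entropy_disc (iid n M) enc"
proof -
  let ?H = "ennreal (ln 2) * entropy_disc (iid n M) enc"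
  define A where "A = (\<integral>\<^sup>+z. ennreal (case_prod r z)
      * ennreal (ln (case_prod r z) - 1 + 1 / case_prod r z) \<partial>(M \<Otimes>\<^sub>M q))"
  define B where "B = (\<integral>\<^sup>+z. ennreal (case_prod r z) * ennreal (1 / case_prod r z) \<partial>(M \<Otimes>\<^sub>M q))"
  define m where "m = emeasure (M \<Otimes>\<^sub>M q) {z \<in> space (M \<Otimes>\<^sub>M q). case_prod r z = 0}"
  have "AE w in iid n M. 0 < prob_msg (enc w) \<and> prob_msg (enc w) \<le> 1"
    unfolding prob_msg_def using iid.P.AE_prob_vimage_pos[OF measurable_enc] by eventually_elim simp
  then have "(\<Sum>t<n. \<integral>\<^sup>+w. ennreal (ln (symbol_density t w) - 1 + 1 / symbol_density t w) \<partial>iid n M)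
      + of_nat n
      \<le> (\<integral>\<^sup>+w. ennreal (- ln (prob_msg (enc w))) \<partial>iid n M)
          + (\<Sum>t<n. \<integral>\<^sup>+w. ennreal (1 / symbol_density t w) \<partial>iid n M)"
    using iid.P.sum_nn_integral_ln_le[OF finite_lessThan _ AE_symbol_density_pos _ _
      nn_integral_likelihood_le_1]
    by (simp add: measurable_compose[OF measurable_enc])
  also have "(\<integral>\<^sup>+w. ennreal (- ln (prob_msg (enc w))) \<partial>iid n M) = ?H"
    unfolding prob_msg_def
    by (rule nn_integral_neg_ln_prob_eq_entropy[OF iid.P.prob_space_axioms measurable_enc])
  also have "(\<Sum>t<n. \<integral>\<^sup>+w. ennreal (ln (symbol_density t w) - 1 + 1 / symbol_density t w) \<partial>iid n M)
      = of_nat n * A"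
    using sum_nn_integral_code_density[of
      "\<lambda>z. ennreal (ln (case_prod r z) - 1 + 1 / case_prod r z)"]
    by (simp add: symbol_density_def A_def)
  also have "(\<Sum>t<n. \<integral>\<^sup>+w. ennreal (1 / symbol_density t w) \<partial>iid n M) = of_nat n * B"
    using sum_nn_integral_code_density[of "\<lambda>z. ennreal (1 / case_prod r z)"]
    by (simp add: symbol_density_def B_def)
  finally have "of_nat n * A + of_nat n + of_nat n * m \<le> ?H + of_nat n * B + of_nat n * m"
    by (rule add_right_mono)
  then have "of_nat n + of_nat n * (A + m) \<le> of_nat n * (B + m) + ?H"
    by (simp add: distrib_left ac_simps)
  also have "B + m = 1"
    unfolding B_def m_def
    by (rule M_q.nn_integral_mult_inverse_eq) (auto simp: kernel_density_nonneg)
  also have "A + m = ennreal (ln 2) * mutual_info M K"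
    unfolding A_def m_def mutual_info_eq_nn_integral_kl[OF M markov_kernel_code countable_codebook
      AE_output_codebook]
    by (rule nn_integral_kl_fun_eq[symmetric]) (auto simp: kernel_density_nonneg)
  finally have "of_nat n * (ennreal (ln 2) * mutual_info M K) \<le> ?H"
    by (subst (asm) mult_1_right, subst (asm) ennreal_add_left_cancel_le) auto
  then have "ennreal (ln 2) * (of_nat n * mutual_info M K) \<le> ?H" by (simp only: mult.left_commute)
  then show ?thesis by (subst (asm) ennreal_mult_le_mult_iff) auto
qed

end

proposition RDP_le_of_nr_code:
  assumes M: "prob_meas M" and [measurable]: "case_prod \<Delta> \<in> borel_measurable (borel \<Otimes>\<^sub>M borel)"
    and d: "mix_convex (d M)" and n: "0 < n" and code: "nr_code M \<Delta> d D P R n"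
  shows "RDP M \<Delta> d D P \<le> ereal R"
proof -
  from code obtain enc dec where enc: "enc \<in> iid n borel \<rightarrow>\<^sub>M count_space UNIV"
    and entropy: "enn2ereal (entropy_disc (iid n M) enc) \<le> ereal (real n * R)"
    and distortion: "enn2ereal (\<Sum>t<n. \<integral>\<^sup>+x. ennreal (\<Delta> (x t) (dec (enc x) t)) \<partial>iid n M)
        \<le> ereal (real n * D)"
    and perception: "\<And>t. t < n \<Longrightarrow> enn2ereal (d M (distr (iid n M) borel (\<lambda>x. dec (enc x) t)))
        \<le> ereal P"
    unfolding nr_code_def by blast
  interpret block_code M n enc dec by standard fact+
  have "d M q \<le> (\<Sum>t<n. ennreal (1 / n) * d M (distr (iid n M) borel (\<lambda>x. dec (enc x) t)))"
    using n by (intro mix_convex_finite_mixture_le[OF d finite_mixture_output])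
      (auto simp: prob_meas_def intro: iid.P.prob_space_distr)
  also have "\<dots> \<le> ennreal P"
    using n perception by (intro weighted_sum_le_ennreal) (auto simp: enn2ereal_le_ereal_iff)
  finally have "d M q \<le> ennreal P" .
  moreover have "enn2ereal (mutual_info M K) \<le> ereal R"
    using n mutual_info_le_entropy entropy by (rule enn2ereal_le_of_mult_le)
  moreover have "of_nat n * exp_dist M \<Delta> K
      \<le> (\<Sum>t<n. \<integral>\<^sup>+x. ennreal (\<Delta> (x t) (dec (enc x) t)) \<partial>iid n M)"
    using sum_nn_integral_code[of "\<lambda>(x, y). ennreal (\<Delta> x y)"] by (simp add: exp_dist_def)
  from enn2ereal_le_of_mult_le[OF n this distortion] have "enn2ereal (exp_dist M \<Delta> K) \<le> ereal D" .
  moreover have "0 \<le> P" using perception[OF n] by (simp add: enn2ereal_le_ereal_iff)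
  ultimately show ?thesis
    unfolding RDP_def using markov_kernel_code
    by (intro Inf_lower2[of "enn2ereal (mutual_info M K)"]) (auto simp: enn2ereal_le_ereal_iff)
qed

section \<open>Random selection\<close>

lemma (in prob_space) ex_le_nn_integral:
  assumes [measurable]: "F \<in> borel_measurable M"
  obtains w where "w \<in> space M" "F w \<le> (\<integral>\<^sup>+w. F w \<partial>M)"
proof -
  let ?c = "\<integral>\<^sup>+w. F w \<partial>M"
  have "\<exists>w\<in>space M. F w \<le> ?c"
  proof (rule ccontr)
    assume "\<not> ?thesis"
    then have less: "?c < F w" if "w \<in> space M" for w using that by (auto simp: not_le)
    obtain w where "w \<in> space M" using not_empty by auto
    then have "?c \<noteq> \<infinity>" using order.strict_trans2[OF less[of w] top_greatest] by auto
    have "\<not> (AE w in M. F w \<le> ?c)"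
    proof
      assume "AE w in M. F w \<le> ?c"
      then have "AE w in M. False" by (rule AE_mp) (auto intro!: AE_I2 dest: less)
      then show False by simp
    qed
    then have "(\<integral>\<^sup>+w. ?c \<partial>M) < (\<integral>\<^sup>+w. F w \<partial>M)"
      using \<open>?c \<noteq> \<infinity>\<close> less
      by (intro nn_integral_less) (auto simp: emeasure_space_1 intro!: AE_I2 less_imp_le)
    then show False by (simp add: emeasure_space_1)
  qed
  then show thesis using that by blast
qed

lemma (in prob_space) nn_integral_shifted_square_le:
  assumes [measurable]: "G \<in> borel_measurable M" and G: "\<And>w. 0 \<le> G w" "\<And>w. G w \<le> v"
  shows "(\<integral>\<^sup>+w. ennreal ((a + (G w - expectation G))\<^sup>2) \<partial>M) \<le> ennreal (a\<^sup>2 + v\<^sup>2)"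
proof -
  have int_G: "integrable M G"
    by (rule integrable_const_bound[of _ v]) (use G in auto)
  have mean: "0 \<le> expectation G" "expectation G \<le> v"
    using G integral_mono[OF int_G, of "\<lambda>_. v"] by (auto simp: prob_space)
  have "\<bar>G w - expectation G\<bar> \<le> v" for w using G(1)[of w] G(2)[of w] mean by auto
  then have sq_le: "(G w - expectation G)\<^sup>2 \<le> v\<^sup>2" for w
    using power_mono[of "\<bar>G w - expectation G\<bar>" v 2] by simp
  have int_sq: "integrable M (\<lambda>w. (G w - expectation G)\<^sup>2)"
    by (rule integrable_const_bound[of _ "v\<^sup>2"]) (use sq_le in auto)
  have expand: "(a + (G w - expectation G))\<^sup>2 = a\<^sup>2 + 2 * a * (G w - expectation G)
      + (G w - expectation G)\<^sup>2" for w
    by (simp add: power2_eq_square algebra_simps)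
  have "expectation (\<lambda>w. (a + (G w - expectation G))\<^sup>2)
      = a\<^sup>2 + expectation (\<lambda>w. (G w - expectation G)\<^sup>2)"
    unfolding expand using int_G int_sq by (simp add: prob_space)
  also have "\<dots> \<le> a\<^sup>2 + v\<^sup>2"
    using integral_mono[OF int_sq, of "\<lambda>_. v\<^sup>2"] sq_le by (simp add: prob_space)
  finally have "expectation (\<lambda>w. (a + (G w - expectation G))\<^sup>2) \<le> a\<^sup>2 + v\<^sup>2" .
  moreover have "integrable M (\<lambda>w. (a + (G w - expectation G))\<^sup>2)"
    unfolding expand using int_G int_sq by auto
  ultimately show ?thesis
    by (subst nn_integral_eq_integral) (auto intro: ennreal_leI simp del: ennreal_plus)
qed

lemma (in prob_space) nn_integral_PiM_square_sum_le:
  fixes G :: "'b \<Rightarrow> 'a \<Rightarrow> real"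
  assumes "finite B" and "\<And>b. b \<in> B \<Longrightarrow> G b \<in> borel_measurable M"
    and "\<And>b w. b \<in> B \<Longrightarrow> 0 \<le> G b w" "\<And>b w. b \<in> B \<Longrightarrow> G b w \<le> v b"
  shows "(\<integral>\<^sup>+\<psi>. ennreal ((a + (\<Sum>b\<in>B. G b (\<psi> b) - expectation (G b)))\<^sup>2) \<partial>(\<Pi>\<^sub>M b\<in>B. M))
      \<le> ennreal (a\<^sup>2 + (\<Sum>b\<in>B. (v b)\<^sup>2))"
  using assms
proof (induction B)
  case empty
  interpret empty: product_prob_space "\<lambda>_. M" "{} :: 'b set" ..
  show ?case using empty.P.emeasure_space_1 by simp
next
  case (insert b B)
  interpret B: product_prob_space "\<lambda>_. M" B ..
  define X where "X c w = G c w - expectation (G c)" for c w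
  define A where "A \<psi> = a + (\<Sum>c\<in>B. X c (\<psi> c))" for \<psi>
  have [measurable]: "X c \<in> borel_measurable M" if "c \<in> insert b B" for c
    unfolding X_def[abs_def] using insert.prems(1)[OF that] by measurable
  have [measurable]: "A \<in> borel_measurable (\<Pi>\<^sub>M b\<in>B. M)" unfolding A_def[abs_def] by measurable
  have split_sum: "a + (\<Sum>c\<in>insert b B. X c ((\<psi>(b := w)) c)) = A \<psi> + X b w" for \<psi> w
  proof -
    have "(\<Sum>c\<in>B. X c ((\<psi>(b := w)) c)) = (\<Sum>c\<in>B. X c (\<psi> c))"
      using insert.hyps by (intro sum.cong) auto
    then show ?thesis using insert.hyps by (simp add: A_def)
  qed
  have "(\<integral>\<^sup>+\<psi>. ennreal ((a + (\<Sum>c\<in>insert b B. X c (\<psi> c)))\<^sup>2) \<partial>(\<Pi>\<^sub>M b\<in>insert b B. M)) =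
      (\<integral>\<^sup>+\<psi>. \<integral>\<^sup>+w. ennreal ((A \<psi> + X b w)\<^sup>2) \<partial>M \<partial>(\<Pi>\<^sub>M b\<in>B. M))"
    unfolding split_sum[symmetric] by (rule B.product_nn_integral_insert[OF insert.hyps]) measurable
  also have "\<dots> \<le> (\<integral>\<^sup>+\<psi>. ennreal ((A \<psi>)\<^sup>2) + ennreal ((v b)\<^sup>2) \<partial>(\<Pi>\<^sub>M b\<in>B. M))"
    unfolding X_def using insert.prems
    by (intro nn_integral_mono) (subst ennreal_plus[symmetric], simp, simp,
      intro nn_integral_shifted_square_le, auto)
  also have "\<dots> = (\<integral>\<^sup>+\<psi>. ennreal ((A \<psi>)\<^sup>2) \<partial>(\<Pi>\<^sub>M b\<in>B. M)) + ennreal ((v b)\<^sup>2)"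
    by (subst nn_integral_add) (auto simp: B.P.emeasure_space_1)
  also have "\<dots> \<le> ennreal (a\<^sup>2 + (\<Sum>c\<in>B. (v c)\<^sup>2)) + ennreal ((v b)\<^sup>2)"
    unfolding A_def X_def using insert.prems by (intro add_right_mono insert.IH) auto
  also have "\<dots> = ennreal (a\<^sup>2 + (\<Sum>c\<in>insert b B. (v c)\<^sup>2))"
    using insert.hyps
    by (subst ennreal_plus[symmetric]) (auto simp: sum_nonneg add_nonneg_nonneg ac_simps)
  finally show ?case unfolding X_def .
qed

text \<open>One independent sample \<open>\<Psi> b\<close> of \<open>M2\<close> is drawn for every label \<open>b\<close>. As no label is likely,
  functionals of \<open>(x, \<Psi> (label x))\<close> concentrate around their mean under \<open>M1 \<Otimes>\<^sub>M M2\<close>.\<close>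

locale random_selection = pair_prob_space M1 M2
  for M1 :: "'a measure" and M2 :: "'b measure" +
  fixes label :: "'a \<Rightarrow> 'c" and B :: "'c set" and p :: real
  assumes finite_labels: "finite B"
    and measurable_label [measurable]: "label \<in> M1 \<rightarrow>\<^sub>M count_space B"
    and prob_label_le: "\<And>b. b \<in> B \<Longrightarrow> measure M1 {x \<in> space M1. label x = b} \<le> p"
begin

abbreviation "Sel \<equiv> \<Pi>\<^sub>M b\<in>B. M2"

sublocale Sel: product_prob_space "\<lambda>_. M2" B ..
sublocale M1_Sel: pair_prob_space M1 Sel ..

lemma label_in: "x \<in> space M1 \<Longrightarrow> label x \<in> B"
  using measurable_space[OF measurable_label] by simp

lemma sets_label [measurable]: "{x \<in> space M1. label x = b} \<in> sets M1"
  by measurable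

lemma measurable_select: "(\<lambda>(x, \<Psi>). (x, \<Psi> (label x))) \<in> M1 \<Otimes>\<^sub>M Sel \<rightarrow>\<^sub>M M1 \<Otimes>\<^sub>M M2"
proof -
  have "(\<lambda>z. snd z (label (fst z))) \<in> M1 \<Otimes>\<^sub>M Sel \<rightarrow>\<^sub>M M2"
    by (rule measurable_compose_countable'[OF _
      measurable_compose[OF measurable_fst measurable_label]])
       (auto intro: countable_finite[OF finite_labels])
  then show ?thesis unfolding case_prod_beta' by measurable
qed

lemma sum_prob_label_squared_le: "(\<Sum>b\<in>B. (measure M1 {x \<in> space M1. label x = b})\<^sup>2) \<le> p"
proof -
  have "(\<Sum>b\<in>B. measure M1 {x \<in> space M1. label x = b})
      = measure M1 (\<Union>b\<in>B. {x \<in> space M1. label x = b})"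
    using finite_labels
    by (intro measure_finite_Union[symmetric])
      (auto simp: disjoint_family_on_def M1.emeasure_eq_measure)
  also have "(\<Union>b\<in>B. {x \<in> space M1. label x = b}) = space M1" using label_in by auto
  finally have total: "(\<Sum>b\<in>B. measure M1 {x \<in> space M1. label x = b}) = 1"
    by (simp add: M1.prob_space)
  have "(\<Sum>b\<in>B. (measure M1 {x \<in> space M1. label x = b})\<^sup>2)
      \<le> (\<Sum>b\<in>B. p * measure M1 {x \<in> space M1. label x = b})"
    unfolding power2_eq_square by (intro sum_mono mult_right_mono prob_label_le) auto
  then show ?thesis by (simp add: total flip: sum_distrib_left)
qed

lemma nn_integral_select:
  assumes [measurable]: "F \<in> borel_measurable (M1 \<Otimes>\<^sub>M M2)"
  shows "(\<integral>\<^sup>+\<Psi>. \<integral>\<^sup>+x. F (x, \<Psi> (label x)) \<partial>M1 \<partial>Sel) = (\<integral>\<^sup>+z. F z \<partial>(M1 \<Otimes>\<^sub>M M2))"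
proof -
  have "(\<lambda>(x, \<Psi>). F (x, \<Psi> (label x))) \<in> borel_measurable (M1 \<Otimes>\<^sub>M Sel)"
    using measurable_compose[OF measurable_select assms] by (simp add: case_prod_beta')
  then have "(\<integral>\<^sup>+\<Psi>. \<integral>\<^sup>+x. F (x, \<Psi> (label x)) \<partial>M1 \<partial>Sel) = (\<integral>\<^sup>+x. \<integral>\<^sup>+\<Psi>. F (x, \<Psi> (label x)) \<partial>Sel \<partial>M1)"
    by (rule M1_Sel.Fubini')
  also have "\<dots> = (\<integral>\<^sup>+x. \<integral>\<^sup>+w. F (x, w) \<partial>M2 \<partial>M1)"
  proof (rule nn_integral_cong)
    fix x assume x: "x \<in> space M1"
    then have "distr Sel M2 (\<lambda>\<Psi>. \<Psi> (label x)) = M2"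
      by (intro Sel.PiM_component label_in)
    moreover have "(\<integral>\<^sup>+w. F (x, w) \<partial>distr Sel M2 (\<lambda>\<Psi>. \<Psi> (label x)))
        = (\<integral>\<^sup>+\<Psi>. F (x, \<Psi> (label x)) \<partial>Sel)"
      using measurable_compose[OF measurable_Pair1'[OF x] assms]
        measurable_component_singleton[OF label_in[OF x], of "\<lambda>_. M2"]
      by (intro nn_integral_distr) simp_all
    ultimately show "(\<integral>\<^sup>+\<Psi>. F (x, \<Psi> (label x)) \<partial>Sel) = (\<integral>\<^sup>+w. F (x, w) \<partial>M2)" by simp
  qed
  also have "\<dots> = (\<integral>\<^sup>+z. F z \<partial>(M1 \<Otimes>\<^sub>M M2))" by (rule M2.nn_integral_fst) measurable
  finally show ?thesis .
qed

definition label_part :: "('a \<times> 'b \<Rightarrow> real) \<Rightarrow> 'c \<Rightarrow> 'b \<Rightarrow> real" where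
  "label_part h b w = (\<integral>x. indicator {x \<in> space M1. label x = b} x * h (x, w) \<partial>M1)"

lemma measurable_label_part [measurable (raw)]:
  assumes [measurable]: "h \<in> borel_measurable (M1 \<Otimes>\<^sub>M M2)"
  shows "label_part h b \<in> borel_measurable M2"
  unfolding label_part_def by measurable

lemma label_part_bounds:
  assumes "\<And>z. 0 \<le> h z" "\<And>z. h z \<le> 1"
  shows "0 \<le> label_part h b w" "label_part h b w \<le> measure M1 {x \<in> space M1. label x = b}"
proof -
  show "0 \<le> label_part h b w"
    unfolding label_part_def using assms by (intro Bochner_Integration.integral_nonneg) auto
  have "label_part h b w \<le> (\<integral>x. indicator {x \<in> space M1. label x = b} x \<partial>M1)"
    unfolding label_part_def
    by (rule integral_mono_AE') (use assms in \<open>auto intro!: M1.integrable_const_bound[of _ 1]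
      split: split_indicator\<close>)
  then show "label_part h b w \<le> measure M1 {x \<in> space M1. label x = b}" by simp
qed

lemma sum_label_part:
  assumes [measurable]: "h \<in> borel_measurable (M1 \<Otimes>\<^sub>M M2)" and h: "\<And>z. 0 \<le> h z" "\<And>z. h z \<le> 1"
    and \<Psi>: "\<And>b. b \<in> B \<Longrightarrow> \<Psi> b \<in> space M2"
  shows "(\<Sum>b\<in>B. label_part h b (\<Psi> b)) = (\<integral>x. h (x, \<Psi> (label x)) \<partial>M1)"
proof -
  have "integrable M1 (\<lambda>x. indicator {x \<in> space M1. label x = b} x * h (x, w))"
    if "w \<in> space M2" for b w
    by (rule M1.integrable_const_bound[of _ 1]) (use that h in \<open>auto split: split_indicator\<close>)
  then have "(\<Sum>b\<in>B. label_part h b (\<Psi> b))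
      = (\<integral>x. (\<Sum>b\<in>B. indicator {x \<in> space M1. label x = b} x * h (x, \<Psi> b)) \<partial>M1)"
    unfolding label_part_def using \<Psi> by (intro Bochner_Integration.integral_sum[symmetric]) auto
  also have "\<dots> = (\<integral>x. h (x, \<Psi> (label x)) \<partial>M1)"
  proof (intro Bochner_Integration.integral_cong refl)
    fix x assume "x \<in> space M1"
    then show "(\<Sum>b\<in>B. indicator {x \<in> space M1. label x = b} x * h (x, \<Psi> b)) = h (x, \<Psi> (label x))"
      using label_in[of x] finite_labels
      by (subst sum.mono_neutral_right[of _ "{label x}"]) (auto split: split_indicator)
  qed
  finally show ?thesis .
qed

lemma variance_select_le:
  fixes h :: "'a \<times> 'b \<Rightarrow> real"
  assumes [measurable]: "h \<in> borel_measurable (M1 \<Otimes>\<^sub>M M2)" and h: "\<And>z. 0 \<le> h z" "\<And>z. h z \<le> 1"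
  shows "(\<integral>\<^sup>+\<Psi>. ennreal (((\<integral>x. h (x, \<Psi> (label x)) \<partial>M1) - (\<integral>z. h z \<partial>(M1 \<Otimes>\<^sub>M M2)))\<^sup>2) \<partial>Sel)
      \<le> ennreal p"
proof -
  note bounds = label_part_bounds[of h, OF h]
  have "integrable M2 (label_part h b)" for b
    by (rule M2.integrable_const_bound[of _ "measure M1 {x \<in> space M1. label x = b}"])
      (use bounds in auto)
  then have "(\<Sum>b\<in>B. M2.expectation (label_part h b)) = (\<integral>w. (\<Sum>b\<in>B. label_part h b w) \<partial>M2)"
    by (intro Bochner_Integration.integral_sum[symmetric])
  also have "\<dots> = (\<integral>w. (\<integral>x. h (x, w) \<partial>M1) \<partial>M2)"
    using h by (intro Bochner_Integration.integral_cong refl sum_label_part) auto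
  also have "\<dots> = (\<integral>z. h z \<partial>(M1 \<Otimes>\<^sub>M M2))"
    using h by (subst integral_snd) (auto intro!: integrable_const_bound[of _ 1])
  finally have mean: "(\<integral>z. h z \<partial>(M1 \<Otimes>\<^sub>M M2)) = (\<Sum>b\<in>B. M2.expectation (label_part h b))" ..
  have "(\<integral>\<^sup>+\<Psi>. ennreal (((\<integral>x. h (x, \<Psi> (label x)) \<partial>M1) - (\<integral>z. h z \<partial>(M1 \<Otimes>\<^sub>M M2)))\<^sup>2) \<partial>Sel) =
      (\<integral>\<^sup>+\<Psi>. ennreal ((0 + (\<Sum>b\<in>B. label_part h b (\<Psi> b) - M2.expectation (label_part h b)))\<^sup>2) \<partial>Sel)"
    using h by (intro nn_integral_cong)
      (auto simp: sum_label_part mean sum_subtractf space_PiM PiE_iff)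
  also have "\<dots> \<le> ennreal (0\<^sup>2 + (\<Sum>b\<in>B. (measure M1 {x \<in> space M1. label x = b})\<^sup>2))"
    using bounds by (intro M2.nn_integral_PiM_square_sum_le finite_labels) auto
  also have "\<dots> \<le> ennreal p"
    using sum_prob_label_squared_le by (intro ennreal_leI) simp
  finally show ?thesis .
qed

proposition ex_selection:
  fixes h :: "'i \<Rightarrow> 'a \<times> 'b \<Rightarrow> real"
  assumes h: "\<And>i. i \<in> I \<Longrightarrow> h i \<in> borel_measurable (M1 \<Otimes>\<^sub>M M2)" "\<And>i z. i \<in> I \<Longrightarrow> 0 \<le> h i z"
    "\<And>i z. i \<in> I \<Longrightarrow> h i z \<le> 1"
    and F[measurable]: "F \<in> borel_measurable (M1 \<Otimes>\<^sub>M M2)"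
  obtains \<Psi> where "\<Psi> \<in> B \<rightarrow> space M2"
    "(\<Sum>i\<in>I. ennreal (((\<integral>x. h i (x, \<Psi> (label x)) \<partial>M1) - (\<integral>z. h i z \<partial>(M1 \<Otimes>\<^sub>M M2)))\<^sup>2))
        + (\<integral>\<^sup>+x. F (x, \<Psi> (label x)) \<partial>M1)
      \<le> of_nat (card I) * ennreal p + (\<integral>\<^sup>+z. F z \<partial>(M1 \<Otimes>\<^sub>M M2))"
proof -
  define dev where "dev i \<Psi> = (\<integral>x. h i (x, \<Psi> (label x)) \<partial>M1) - (\<integral>z. h i z \<partial>(M1 \<Otimes>\<^sub>M M2))" for i \<Psi>
  have swap: "(\<lambda>(\<Psi>, x). (x, \<Psi> (label x))) \<in> Sel \<Otimes>\<^sub>M M1 \<rightarrow>\<^sub>M M1 \<Otimes>\<^sub>M M2"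
    using measurable_compose[OF measurable_pair_swap' measurable_select]
    by (simp add: case_prod_beta')
  have [measurable]: "dev i \<in> borel_measurable Sel" if "i \<in> I" for i
  proof -
    have "(\<lambda>(\<Psi>, x). h i (x, \<Psi> (label x))) \<in> borel_measurable (Sel \<Otimes>\<^sub>M M1)"
      using measurable_compose[OF swap h(1)[OF that]] by (simp add: case_prod_beta')
    from M1.borel_measurable_lebesgue_integral[OF this] show ?thesis
      unfolding dev_def[abs_def] by measurable
  qed
  have "(\<lambda>(\<Psi>, x). F (x, \<Psi> (label x))) \<in> borel_measurable (Sel \<Otimes>\<^sub>M M1)"
    using measurable_compose[OF swap F] by (simp add: case_prod_beta')
  then have [measurable]: "(\<lambda>\<Psi>. \<integral>\<^sup>+x. F (x, \<Psi> (label x)) \<partial>M1) \<in> borel_measurable Sel"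
    by (rule M1.borel_measurable_nn_integral)
  obtain \<Psi> where \<Psi>: "\<Psi> \<in> space Sel" and le:
    "(\<Sum>i\<in>I. ennreal ((dev i \<Psi>)\<^sup>2)) + (\<integral>\<^sup>+x. F (x, \<Psi> (label x)) \<partial>M1) \<le>
     (\<integral>\<^sup>+\<Psi>. (\<Sum>i\<in>I. ennreal ((dev i \<Psi>)\<^sup>2)) + (\<integral>\<^sup>+x. F (x, \<Psi> (label x)) \<partial>M1) \<partial>Sel)"
    by (rule Sel.P.ex_le_nn_integral[of "\<lambda>\<Psi>. (\<Sum>i\<in>I. ennreal ((dev i \<Psi>)\<^sup>2))
        + (\<integral>\<^sup>+x. F (x, \<Psi> (label x)) \<partial>M1)"]) measurable
  note le
  also have "(\<integral>\<^sup>+\<Psi>. (\<Sum>i\<in>I. ennreal ((dev i \<Psi>)\<^sup>2)) + (\<integral>\<^sup>+x. F (x, \<Psi> (label x)) \<partial>M1) \<partial>Sel) =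
      (\<Sum>i\<in>I. \<integral>\<^sup>+\<Psi>. ennreal ((dev i \<Psi>)\<^sup>2) \<partial>Sel) + (\<integral>\<^sup>+z. F z \<partial>(M1 \<Otimes>\<^sub>M M2))"
    by (subst nn_integral_add) (auto simp: nn_integral_sum nn_integral_select simp del: sum_ennreal)
  also have "\<dots> \<le> (\<Sum>i\<in>I. ennreal p) + (\<integral>\<^sup>+z. F z \<partial>(M1 \<Otimes>\<^sub>M M2))"
    unfolding dev_def by (intro add_right_mono sum_mono variance_select_le h)
  finally show thesis
    using \<Psi> by (intro that[of \<Psi>]) (auto simp: dev_def space_PiM)
qed

end

section \<open>Rejection sampling\<close>

text \<open>The value \<open>N\<close> means that none of the first \<open>N\<close> samples is accepted.\<close>

primrec first_hit :: "('c \<Rightarrow> bool) \<Rightarrow> (nat \<Rightarrow> 'c) \<Rightarrow> nat \<Rightarrow> nat" where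
  "first_hit acc \<psi> 0 = 0"
| "first_hit acc \<psi> (Suc N) =
    (if first_hit acc \<psi> N < N then first_hit acc \<psi> N else if acc (\<psi> N) then N else Suc N)"

lemma first_hit_le: "first_hit acc \<psi> N \<le> N"
  by (induction N) auto

lemma first_hit_cong: "(\<And>j. j < N \<Longrightarrow> acc (\<psi> j) = acc' (\<psi>' j)) \<Longrightarrow>
    first_hit acc \<psi> N = first_hit acc' \<psi>' N"
  by (induction N) auto

lemma measurable_first_hit:
  assumes "\<And>j. j < N \<Longrightarrow> Measurable.pred X (\<lambda>x. acc x (\<psi> x j))"
  shows "(\<lambda>x. first_hit (acc x) (\<psi> x) N) \<in> X \<rightarrow>\<^sub>M count_space UNIV"
  using assms
proof (induction N)
  case (Suc N)
  have [measurable]: "(\<lambda>x. first_hit (acc x) (\<psi> x) N) \<in> X \<rightarrow>\<^sub>M count_space UNIV"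
    "Measurable.pred X (\<lambda>x. acc x (\<psi> x N))"
    using Suc by auto
  show ?case unfolding first_hit.simps by measurable
qed simp

lemma measurable_at_first_hit:
  assumes acc: "Measurable.pred T acc" and h: "h \<in> borel_measurable T"
  shows "(\<lambda>\<psi>. if first_hit acc \<psi> N < N then h (\<psi> (first_hit acc \<psi> N)) else H)
      \<in> borel_measurable (\<Pi>\<^sub>M i\<in>{..<N}. T)"
proof -
  note coord = measurable_component_singleton[of _ "{..<N}" "\<lambda>_. T"]
  have "(\<lambda>\<psi>. if j < N then h (\<psi> j) else H) \<in> borel_measurable (\<Pi>\<^sub>M i\<in>{..<N}. T)" for j
    by (cases "j < N") (auto intro!: measurable_compose[OF coord h])
  moreover have "(\<lambda>\<psi>. first_hit acc \<psi> N) \<in> (\<Pi>\<^sub>M i\<in>{..<N}. T) \<rightarrow>\<^sub>M count_space UNIV"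
    by (rule measurable_first_hit) (auto intro!: measurable_compose[OF coord acc])
  ultimately show ?thesis by (rule measurable_compose_countable)
qed

lemma nn_integral_first_hit_le:
  assumes "prob_space T" and acc[measurable]: "Measurable.pred T acc"
    and h[measurable]: "h \<in> borel_measurable T"
    and \<alpha>: "measure T {c \<in> space T. acc c} = \<alpha>"
    and \<beta>: "(\<integral>\<^sup>+c. indicator {c \<in> space T. acc c} c * h c \<partial>T) \<le> ennreal \<alpha> * \<beta>"
  shows "(\<integral>\<^sup>+\<psi>. (if first_hit acc \<psi> N < N then h (\<psi> (first_hit acc \<psi> N)) else H) \<partial>(\<Pi>\<^sub>M i\<in>{..<N}. T))
    \<le> ennreal (1 - (1 - \<alpha>) ^ N) * \<beta> + ennreal ((1 - \<alpha>) ^ N) * H"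
proof (induction N arbitrary: H)
  case 0
  interpret T: prob_space T by fact
  interpret product_prob_space "\<lambda>_. T" "{} :: nat set" ..
  show ?case using P.emeasure_space_1 by simp
next
  case (Suc N)
  interpret T: prob_space T by fact
  interpret product_prob_space "\<lambda>_. T" "{..<N}" ..
  have \<alpha>01: "0 \<le> \<alpha>" "\<alpha> \<le> 1" using \<alpha> T.prob_le_1 by auto
  let ?hit = "\<lambda>N H \<psi>. if first_hit acc \<psi> N < N then h (\<psi> (first_hit acc \<psi> N)) else H"
  let ?H = "\<integral>\<^sup>+c. (if acc c then h c else H) \<partial>T"
  have hit_Suc: "?hit (Suc N) H (\<psi>(N := c)) = ?hit N (if acc c then h c else H) \<psi>" for \<psi> c
    using first_hit_le[of acc \<psi> N] first_hit_cong[of N acc "\<psi>(N := c)" acc \<psi>] by auto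
  have measurable_hit: "?hit (Suc N) H \<in> borel_measurable (\<Pi>\<^sub>M i\<in>insert N {..<N}. T)"
    using measurable_at_first_hit[OF acc h, of "Suc N"] by (simp only: lessThan_Suc)
  have "?H
      = (\<integral>\<^sup>+c. indicator {c \<in> space T. acc c} c * h c + H * indicator {c \<in> space T. \<not> acc c} c \<partial>T)"
    by (intro nn_integral_cong) auto
  also have "\<dots> = (\<integral>\<^sup>+c. indicator {c \<in> space T. acc c} c * h c \<partial>T)
      + H * emeasure T {c \<in> space T. \<not> acc c}"
    by (simp add: nn_integral_add nn_integral_cmult)
  also have "emeasure T {c \<in> space T. \<not> acc c} = ennreal (1 - \<alpha>)"
    using T.prob_neg[OF acc[unfolded pred_def]] \<alpha> by (simp add: T.emeasure_eq_measure)
  finally have H_le: "?H \<le> ennreal \<alpha> * \<beta> + ennreal (1 - \<alpha>) * H"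
    using \<beta> by (simp add: add_right_mono mult.commute)
  have "(\<integral>\<^sup>+\<psi>. ?hit (Suc N) H \<psi> \<partial>(\<Pi>\<^sub>M i\<in>{..<Suc N}. T))
      = (\<integral>\<^sup>+\<psi>. \<integral>\<^sup>+c. ?hit (Suc N) H (\<psi>(N := c)) \<partial>T \<partial>(\<Pi>\<^sub>M i\<in>{..<N}. T))"
    unfolding lessThan_Suc by (rule product_nn_integral_insert[OF _ _ measurable_hit]) auto
  also have "\<dots> = (\<integral>\<^sup>+\<psi>. ?hit N ?H \<psi> \<partial>(\<Pi>\<^sub>M i\<in>{..<N}. T))"
    unfolding hit_Suc by (intro nn_integral_cong) (simp add: T.emeasure_space_1)
  also have "\<dots> \<le> ennreal (1 - (1 - \<alpha>) ^ N) * \<beta> + ennreal ((1 - \<alpha>) ^ N) * ?H"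
    by (rule Suc.IH)
  also have "\<dots> \<le> ennreal (1 - (1 - \<alpha>) ^ N) * \<beta> + ennreal ((1 - \<alpha>) ^ N)
      * (ennreal \<alpha> * \<beta> + ennreal (1 - \<alpha>) * H)"
    by (intro add_left_mono mult_left_mono H_le) simp
  also have "\<dots> = (ennreal (1 - (1 - \<alpha>) ^ N) + ennreal ((1 - \<alpha>) ^ N * \<alpha>)) * \<beta>
      + ennreal ((1 - \<alpha>) ^ Suc N) * H"
    using \<alpha>01 by (simp add: distrib_left distrib_right ennreal_mult mult_ac add.assoc)
  also have "ennreal (1 - (1 - \<alpha>) ^ N) + ennreal ((1 - \<alpha>) ^ N * \<alpha>) = ennreal (1 - (1 - \<alpha>) ^ Suc N)"
    using \<alpha>01 by (subst ennreal_plus[symmetric]) (auto simp: power_le_one algebra_simps)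
  finally show ?case .
qed

abbreviation unit_uniform :: "real measure" where
  "unit_uniform \<equiv> uniform_measure lborel {0..1}"

lemma prob_space_unit_uniform: "prob_space unit_uniform"
  by (rule prob_space_uniform_measure) auto

lemma emeasure_unit_uniform_le:
  assumes "0 \<le> s" "0 < L"
  shows "emeasure unit_uniform {u. u * L \<le> s} = ennreal (min 1 (s / L))"
proof -
  have e: "{0..1} \<inter> {u. u * L \<le> s} = {0..min 1 (s / L)}"
    using assms by (auto simp: field_simps)
  have "{u. u * L \<le> s} \<in> sets borel" by measurable
  then show ?thesis
    using assms by (subst emeasure_uniform_measure) (auto simp: e divide_ennreal_def)
qed

lemma nn_integral_accepted_eq:
  assumes "prob_space Q" and [measurable]: "\<rho> \<in> borel_measurable Q" and \<rho>: "\<And>c. 0 \<le> \<rho> c"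
    and L: "0 < L"
    and [measurable]: "g \<in> borel_measurable Q"
  shows "(\<integral>\<^sup>+z. indicator {z \<in> space (Q \<Otimes>\<^sub>M unit_uniform). snd z * L \<le> \<rho> (fst z)} z
      * g (fst z) \<partial>(Q \<Otimes>\<^sub>M unit_uniform)) =
    (\<integral>\<^sup>+c. ennreal (min 1 (\<rho> c / L)) * g c \<partial>Q)"
proof -
  interpret U: prob_space unit_uniform by (rule prob_space_unit_uniform)
  let ?A = "{z \<in> space (Q \<Otimes>\<^sub>M unit_uniform). snd z * L \<le> \<rho> (fst z)}"
  have "(\<integral>\<^sup>+z. indicator ?A z * g (fst z) \<partial>(Q \<Otimes>\<^sub>M unit_uniform))
      = (\<integral>\<^sup>+c. \<integral>\<^sup>+u. indicator ?A (c, u) * g c \<partial>unit_uniform \<partial>Q)"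
    by (subst U.nn_integral_fst[symmetric]) auto
  also have "\<dots> = (\<integral>\<^sup>+c. ennreal (min 1 (\<rho> c / L)) * g c \<partial>Q)"
  proof (rule nn_integral_cong)
    fix c assume c: "c \<in> space Q"
    have "(\<integral>\<^sup>+u. indicator ?A (c, u) * g c \<partial>unit_uniform)
        = (\<integral>\<^sup>+u. indicator {u. u * L \<le> \<rho> c} u * g c \<partial>unit_uniform)"
      using c by (intro nn_integral_cong) (auto simp: space_pair_measure split: split_indicator)
    also have "\<dots> = emeasure unit_uniform {u. u * L \<le> \<rho> c} * g c"
      by (subst nn_integral_multc) auto
    finally show "(\<integral>\<^sup>+u. indicator ?A (c, u) * g c \<partial>unit_uniform) = ennreal (min 1 (\<rho> c / L)) * g c"
      by (simp only: emeasure_unit_uniform_le[OF \<rho> L])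
  qed
  finally show ?thesis .
qed

lemma acceptance_prob_ge:
  assumes Q: "prob_space Q" and \<rho>[measurable]: "\<rho> \<in> borel_measurable Q" and \<rho>_nonneg: "\<And>c. 0 \<le> \<rho> c"
    and L: "0 < L" and mass: "ennreal (1 - \<eta>) \<le> (\<integral>\<^sup>+c. ennreal (min (\<rho> c) L) \<partial>Q)"
  shows "(1 - \<eta>) / L
      \<le> measure (Q \<Otimes>\<^sub>M unit_uniform) {z \<in> space (Q \<Otimes>\<^sub>M unit_uniform). snd z * L \<le> \<rho> (fst z)}"
    (is "_ \<le> ?\<alpha>")
proof -
  interpret Q: prob_space Q by fact
  interpret U: prob_space unit_uniform by (rule prob_space_unit_uniform)
  interpret T: pair_prob_space Q unit_uniform ..
  have acc: "{z \<in> space (Q \<Otimes>\<^sub>M unit_uniform). snd z * L \<le> \<rho> (fst z)} \<in> sets (Q \<Otimes>\<^sub>M unit_uniform)"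
    by measurable
  have "ennreal ?\<alpha> = (\<integral>\<^sup>+c. ennreal (min 1 (\<rho> c / L)) \<partial>Q)"
    using nn_integral_accepted_eq[OF Q \<rho> \<rho>_nonneg L, of "\<lambda>_. 1"] nn_integral_indicator[OF acc]
    by (simp add: T.emeasure_eq_measure)
  then have "ennreal (L * ?\<alpha>) = (\<integral>\<^sup>+c. ennreal L * ennreal (min 1 (\<rho> c / L)) \<partial>Q)"
    using L by (simp add: nn_integral_cmult ennreal_mult')
  also have "\<dots> = (\<integral>\<^sup>+c. ennreal (min (\<rho> c) L) \<partial>Q)"
    using L by (intro nn_integral_cong) (auto simp: min_def field_simps simp flip: ennreal_mult')
  finally have "ennreal (1 - \<eta>) \<le> ennreal (L * ?\<alpha>)" using mass by simp
  then have "1 - \<eta> \<le> L * ?\<alpha>"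
    using L by (subst (asm) ennreal_le_iff) auto
  then show ?thesis using L by (simp add: field_simps)
qed

lemma nn_integral_accepted_le:
  assumes "prob_space Q" and [measurable]: "\<rho> \<in> borel_measurable Q" and \<rho>_nonneg: "\<And>c. 0 \<le> \<rho> c"
    and L: "0 < L"
    and \<alpha>: "0 \<le> \<alpha>" "m / L \<le> \<alpha>" and m: "0 < m" and [measurable]: "h \<in> borel_measurable Q"
  shows "(\<integral>\<^sup>+c. ennreal (min 1 (\<rho> c / L)) * h c \<partial>Q)
      \<le> ennreal \<alpha> * (ennreal (1 / m) * (\<integral>\<^sup>+c. ennreal (\<rho> c) * h c \<partial>Q))"
proof -
  define k where "k = \<alpha> * (1 / m)"
  have "1 / L \<le> k" using \<alpha>(2) m L by (simp add: k_def field_simps)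
  from mult_right_mono[OF this \<rho>_nonneg] have "min 1 (\<rho> c / L) \<le> k * \<rho> c" for c
    by (simp add: min.coboundedI2)
  then have "(\<integral>\<^sup>+c. ennreal (min 1 (\<rho> c / L)) * h c \<partial>Q) \<le> (\<integral>\<^sup>+c. ennreal (k * \<rho> c) * h c \<partial>Q)"
    by (intro nn_integral_mono mult_right_mono ennreal_leI) auto
  also have "\<dots> = ennreal k * (\<integral>\<^sup>+c. ennreal (\<rho> c) * h c \<partial>Q)"
    by (simp add: ennreal_mult''[OF \<rho>_nonneg] mult.assoc nn_integral_cmult)
  also have "ennreal k = ennreal \<alpha> * ennreal (1 / m)"
    unfolding k_def using \<alpha>(1) m by (intro ennreal_mult) auto
  finally show ?thesis by (simp only: mult.assoc)
qed

lemma nn_integral_rejection_le: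
  assumes Q: "prob_space Q" and \<rho>[measurable]: "\<rho> \<in> borel_measurable Q" and \<rho>_nonneg: "\<And>c. 0 \<le> \<rho> c"
    and L: "0 < L" and \<eta>: "\<eta> < 1" and mass: "ennreal (1 - \<eta>) \<le> (\<integral>\<^sup>+c. ennreal (min (\<rho> c) L) \<partial>Q)"
    and h[measurable]: "h \<in> borel_measurable Q"
  defines "acc \<equiv> \<lambda>z. snd z * L \<le> \<rho> (fst z)"
  shows "(\<integral>\<^sup>+\<psi>. (if first_hit acc \<psi> N < N then h (fst (\<psi> (first_hit acc \<psi> N))) else H)
      \<partial>(\<Pi>\<^sub>M i\<in>{..<N}. Q \<Otimes>\<^sub>M unit_uniform))
    \<le> ennreal (1 / (1 - \<eta>)) * (\<integral>\<^sup>+c. ennreal (\<rho> c) * h c \<partial>Q)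
        + ennreal (exp (- ((1 - \<eta>) / L * N))) * H"
proof -
  interpret Q: prob_space Q by fact
  interpret U: prob_space unit_uniform by (rule prob_space_unit_uniform)
  let ?T = "Q \<Otimes>\<^sub>M unit_uniform"
  interpret T: pair_prob_space Q unit_uniform ..
  have acc: "Measurable.pred ?T acc" unfolding acc_def by measurable
  define \<alpha> where "\<alpha> = measure ?T {z \<in> space ?T. acc z}"
  have \<alpha>: "0 \<le> \<alpha>" "\<alpha> \<le> 1" by (simp_all add: \<alpha>_def)
  have \<alpha>_ge: "(1 - \<eta>) / L \<le> \<alpha>"
    unfolding \<alpha>_def acc_def by (rule acceptance_prob_ge[OF Q \<rho> \<rho>_nonneg L mass])
  let ?\<beta> = "ennreal (1 / (1 - \<eta>)) * (\<integral>\<^sup>+c. ennreal (\<rho> c) * h c \<partial>Q)"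
  have "(\<integral>\<^sup>+z. indicator {z \<in> space ?T. acc z} z * h (fst z) \<partial>?T) \<le> ennreal \<alpha> * ?\<beta>"
    unfolding acc_def nn_integral_accepted_eq[OF Q \<rho> \<rho>_nonneg L h]
    using \<eta> by (intro nn_integral_accepted_le[OF Q \<rho> \<rho>_nonneg L \<alpha>(1) \<alpha>_ge _ h]) simp
  then have
    "(\<integral>\<^sup>+\<psi>. (if first_hit acc \<psi> N < N then h (fst (\<psi> (first_hit acc \<psi> N))) else H)
      \<partial>(\<Pi>\<^sub>M i\<in>{..<N}. ?T))
      \<le> ennreal (1 - (1 - \<alpha>) ^ N) * ?\<beta> + ennreal ((1 - \<alpha>) ^ N) * H"
    by (intro nn_integral_first_hit_le[where h = "\<lambda>z. h (fst z)"] T.prob_space_axioms acc)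
      (auto simp: \<alpha>_def)
  also have "\<dots> \<le> 1 * ?\<beta> + ennreal (exp (- ((1 - \<eta>) / L * N))) * H"
  proof (intro add_mono mult_right_mono ennreal_leI)
    have "(1 - \<alpha>) ^ N \<le> exp (- \<alpha>) ^ N"
      using \<alpha>(2) exp_ge_add_one_self[of "- \<alpha>"] by (intro power_mono) auto
    also have "\<dots> = exp (- (\<alpha> * N))" by (simp add: exp_of_nat_mult[symmetric] mult.commute)
    also have "\<dots> \<le> exp (- ((1 - \<eta>) / L * N))" using mult_right_mono[OF \<alpha>_ge, of "real N"] by simp
    finally show "(1 - \<alpha>) ^ N \<le> exp (- ((1 - \<eta>) / L * N))" .
  qed (auto simp: \<alpha> ennreal_le_1)
  finally show ?thesis by simp
qed

definition typical :: "'b measure \<Rightarrow> ('a \<Rightarrow> 'b \<Rightarrow> real) \<Rightarrow> real \<Rightarrow> real \<Rightarrow> 'a \<Rightarrow> bool" where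
  "typical Q \<rho> L \<eta> x \<longleftrightarrow> ennreal (1 - \<eta>) \<le> (\<integral>\<^sup>+c. ennreal (min (\<rho> x c) L) \<partial>Q)"

text \<open>Bounds the expectation of \<open>h\<close> at the source and its reproduction: the three terms account for an
  accepted sample, for the default \<open>y0\<close> after \<open>N\<close> rejections, and for an atypical source.\<close>

definition rejection_bound ::
  "'a measure \<Rightarrow> 'b measure \<Rightarrow> ('a \<Rightarrow> 'b \<Rightarrow> real) \<Rightarrow> real \<Rightarrow> real \<Rightarrow> nat \<Rightarrow> 'b \<Rightarrow> ('a \<times> 'b \<Rightarrow> ennreal) \<Rightarrow>
      ennreal" where
  "rejection_bound P Q \<rho> L \<eta> N y0 h =
    ennreal (1 / (1 - \<eta>)) * (\<integral>\<^sup>+x. \<integral>\<^sup>+c. ennreal (\<rho> x c) * h (x, c) \<partial>Q \<partial>P)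
    + ennreal (exp (- ((1 - \<eta>) / L * N))) * (\<integral>\<^sup>+x. h (x, y0) \<partial>P)
    + (\<integral>\<^sup>+x. (if typical Q \<rho> L \<eta> x then 0 else h (x, y0)) \<partial>P)"

locale rejection_sampler =
  fixes P :: "'a measure" and Q :: "'b measure" and \<rho> :: "'a \<Rightarrow> 'b \<Rightarrow> real" and L \<eta> :: real
    and N :: nat and y0 :: 'b
  assumes prob_space_P: "prob_space P" and prob_space_Q: "prob_space Q"
    and measurable_\<rho> [measurable]: "case_prod \<rho> \<in> borel_measurable (P \<Otimes>\<^sub>M Q)"
    and \<rho>_nonneg: "\<And>x c. 0 \<le> \<rho> x c"
    and L: "0 < L" and \<eta>: "0 \<le> \<eta>" "\<eta> < 1" and y0 [simp]: "y0 \<in> space Q"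
begin

abbreviation "Book \<equiv> \<Pi>\<^sub>M i\<in>{..<N}. Q \<Otimes>\<^sub>M unit_uniform"
abbreviation "good \<equiv> typical Q \<rho> L \<eta>"
abbreviation "bound \<equiv> rejection_bound P Q \<rho> L \<eta> N y0"

sublocale P: prob_space P by (rule prob_space_P)
sublocale Q: prob_space Q by (rule prob_space_Q)
sublocale U: prob_space unit_uniform by (rule prob_space_unit_uniform)
sublocale Q_U: pair_prob_space Q unit_uniform ..
sublocale Book: product_prob_space "\<lambda>_. Q \<Otimes>\<^sub>M unit_uniform" "{..<N}" ..
sublocale P_Book: pair_prob_space P Book ..

definition index :: "'a \<Rightarrow> (nat \<Rightarrow> 'b \<times> real) \<Rightarrow> nat" where
  "index x \<psi> = (if good x then first_hit (\<lambda>z. snd z * L \<le> \<rho> x (fst z)) \<psi> N else N)"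

definition decode :: "(nat \<Rightarrow> 'b \<times> real) \<Rightarrow> nat \<Rightarrow> 'b" where
  "decode \<psi> j = (if j < N then fst (\<psi> j) else y0)"

definition out :: "'a \<Rightarrow> (nat \<Rightarrow> 'b \<times> real) \<Rightarrow> 'b" where
  "out x \<psi> = decode \<psi> (index x \<psi>)"

lemma index_le: "index x \<psi> \<le> N"
  by (simp add: index_def first_hit_le)

lemma measurable_good [measurable]: "Measurable.pred P good"
  unfolding typical_def by measurable

lemma measurable_Book_component: "j < N \<Longrightarrow> (\<lambda>\<psi>. \<psi> j) \<in> Book \<rightarrow>\<^sub>M Q \<Otimes>\<^sub>M unit_uniform"
  by (rule measurable_component_singleton) simp

lemma measurable_index: "(\<lambda>z. index (fst z) (snd z)) \<in> P \<Otimes>\<^sub>M Book \<rightarrow>\<^sub>M count_space UNIV"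
proof -
  have [measurable]: "(\<lambda>z. first_hit (\<lambda>w. snd w * L \<le> \<rho> (fst z) (fst w)) (snd z) N)
      \<in> P \<Otimes>\<^sub>M Book \<rightarrow>\<^sub>M count_space UNIV"
  proof (rule measurable_first_hit)
    fix j assume "j < N"
    then have entry: "(\<lambda>z. snd z j) \<in> P \<Otimes>\<^sub>M Book \<rightarrow>\<^sub>M Q \<Otimes>\<^sub>M unit_uniform"
      by (intro measurable_compose[OF measurable_snd measurable_Book_component])
    have "(\<lambda>w. snd w * L) \<in> borel_measurable (Q \<Otimes>\<^sub>M unit_uniform)" by measurable
    from measurable_compose[OF entry this] have lhs: "(\<lambda>z. snd (snd z j) * L)
        \<in> borel_measurable (P \<Otimes>\<^sub>M Book)" .
    have "(\<lambda>z. \<rho> (fst z) (fst (snd z j))) \<in> borel_measurable (P \<Otimes>\<^sub>M Book)"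
      using measurable_compose[OF measurable_Pair[OF measurable_fst
        measurable_compose[OF entry measurable_fst]] measurable_\<rho>]
      by simp
    from borel_measurable_le[OF lhs this]
    show "Measurable.pred (P \<Otimes>\<^sub>M Book) (\<lambda>z. snd (snd z j) * L \<le> \<rho> (fst z) (fst (snd z j)))"
      by (simp only: pred_def)
  qed
  show ?thesis unfolding index_def by measurable
qed

lemma measurable_out: "(\<lambda>z. out (fst z) (snd z)) \<in> P \<Otimes>\<^sub>M Book \<rightarrow>\<^sub>M Q"
proof -
  have "(\<lambda>z. decode (snd z) j) \<in> P \<Otimes>\<^sub>M Book \<rightarrow>\<^sub>M Q" for j
  proof (cases "j < N")
    case True
    have "(\<lambda>z. fst (snd z j)) \<in> P \<Otimes>\<^sub>M Book \<rightarrow>\<^sub>M Q"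
      by (rule measurable_compose[OF measurable_compose[OF measurable_snd
        measurable_Book_component[OF True]] measurable_fst])
    then show ?thesis using True by (simp add: decode_def)
  qed (simp add: decode_def)
  from measurable_compose_countable[where f = "\<lambda>j z. decode (snd z) j", OF this measurable_index]
  show ?thesis unfolding out_def .
qed

lemma decode_in_space:
  assumes "\<psi> \<in> space Book"
  shows "decode \<psi> j \<in> space Q"
proof (cases "j < N")
  case True
  from measurable_space[OF measurable_Book_component[OF this] assms] show ?thesis
    by (simp add: True decode_def space_pair_measure mem_Times_iff)
qed (simp add: decode_def)

lemma nn_integral_out_le:
  assumes x: "x \<in> space P" and h: "h \<in> borel_measurable Q"
  shows "(\<integral>\<^sup>+\<psi>. h (out x \<psi>) \<partial>Book) \<le> ennreal (1 / (1 - \<eta>)) * (\<integral>\<^sup>+c. ennreal (\<rho> x c) * h c \<partial>Q)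
    + ennreal (exp (- ((1 - \<eta>) / L * N))) * h y0 + (if good x then 0 else h y0)"
proof (cases "good x")
  case True
  have "\<rho> x \<in> borel_measurable Q"
    using measurable_compose[OF measurable_Pair1'[OF x] measurable_\<rho>] by simp
  note le = nn_integral_rejection_le[OF prob_space_Q this \<rho>_nonneg L \<eta>(2)
    True[unfolded typical_def] h, of N "h y0"]
  let ?hit = "\<lambda>\<psi>. first_hit (\<lambda>z. snd z * L \<le> \<rho> x (fst z)) \<psi> N"
  have "h (out x \<psi>) = (if ?hit \<psi> < N then h (fst (\<psi> (?hit \<psi>))) else h y0)" for \<psi>
    using True by (simp add: out_def decode_def index_def)
  then show ?thesis using le by (simp only: True if_True add_0_right)
next
  case False
  then have "(\<integral>\<^sup>+\<psi>. h (out x \<psi>) \<partial>Book) = 0 + h y0"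
    by (simp add: out_def index_def decode_def Book.P.emeasure_space_1)
  also have "\<dots> \<le> ennreal (1 / (1 - \<eta>)) * (\<integral>\<^sup>+c. ennreal (\<rho> x c) * h c \<partial>Q)
      + ennreal (exp (- ((1 - \<eta>) / L * N))) * h y0 + h y0"
    by (rule add_right_mono) (rule zero_le)
  finally show ?thesis using False by simp
qed

lemma measurable_source_out:
  "h \<in> borel_measurable (P \<Otimes>\<^sub>M Q) \<Longrightarrow>
      (\<lambda>z. h (fst z, out (fst z) (snd z))) \<in> borel_measurable (P \<Otimes>\<^sub>M Book)"
  by (rule measurable_compose[OF measurable_Pair[OF measurable_fst measurable_out]])

definition mean_out :: "('a \<times> 'b \<Rightarrow> ennreal) \<Rightarrow> ennreal" where
  "mean_out h = (\<integral>\<^sup>+z. h (fst z, out (fst z) (snd z)) \<partial>(P \<Otimes>\<^sub>M Book))"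

lemma mean_out_cmult_sum:
  assumes "\<And>i. i \<in> I \<Longrightarrow> h i \<in> borel_measurable (P \<Otimes>\<^sub>M Q)"
  shows "mean_out (\<lambda>z. a * (\<Sum>i\<in>I. h i z)) = a * (\<Sum>i\<in>I. mean_out (h i))"
  unfolding mean_out_def using measurable_source_out[OF assms]
  by (simp add: nn_integral_cmult nn_integral_sum)

lemma mean_out_le_bound:
  assumes h[measurable]: "h \<in> borel_measurable (P \<Otimes>\<^sub>M Q)"
  shows "mean_out h \<le> bound h"
proof -
  have [measurable]: "(\<lambda>x. h (x, y0)) \<in> borel_measurable P"
    by (rule measurable_compose[OF measurable_Pair2'[OF y0] h])
  have [measurable]: "(\<lambda>x. \<integral>\<^sup>+c. ennreal (\<rho> x c) * h (x, c) \<partial>Q) \<in> borel_measurable P"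
    by measurable
  have "mean_out h = (\<integral>\<^sup>+x. \<integral>\<^sup>+\<psi>. h (x, out x \<psi>) \<partial>Book \<partial>P)"
    using Book.P.nn_integral_fst[OF measurable_source_out[OF h]] by (simp add: mean_out_def)
  also have "\<dots> \<le> (\<integral>\<^sup>+x. ennreal (1 / (1 - \<eta>)) * (\<integral>\<^sup>+c. ennreal (\<rho> x c) * h (x, c) \<partial>Q)
      + ennreal (exp (- ((1 - \<eta>) / L * N))) * h (x, y0) + (if good x then 0 else h (x, y0)) \<partial>P)"
    by (intro nn_integral_mono nn_integral_out_le measurable_compose[OF measurable_Pair1' h])
  also have "\<dots> = bound h"
    by (simp add: rejection_bound_def nn_integral_add nn_integral_cmult)
  finally show ?thesis .
qed

lemma powr_excess_le:
  fixes t :: real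
  assumes "0 \<le> t" "0 < s"
  shows "t - L \<le> L powr (- s) * t powr (1 + s)"
proof (cases "L < t")
  case True
  then have "t * 1 \<le> t * (t / L) powr s"
    using assms L by (intro mult_left_mono ge_one_powr_ge_zero) auto
  also have "\<dots> = L powr (- s) * t powr (1 + s)"
    using True L by (simp add: powr_divide powr_minus powr_add field_simps)
  finally show ?thesis using L by simp
next
  case False
  then show ?thesis using powr_ge_zero[of L "- s"] powr_ge_zero[of t "1 + s"]
    by (smt (verit) mult_nonneg_nonneg)
qed

definition deficit :: "'a \<Rightarrow> ennreal" where
  "deficit x = (1 - (\<integral>\<^sup>+c. ennreal (\<rho> x c) \<partial>Q)) + (\<integral>\<^sup>+c. ennreal (\<rho> x c - L) \<partial>Q)"

lemma measurable_deficit [measurable]: "deficit \<in> borel_measurable P"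
  unfolding deficit_def by measurable

lemma nn_integral_min_plus_deficit:
  assumes x: "x \<in> space P" and sub: "(\<integral>\<^sup>+c. ennreal (\<rho> x c) \<partial>Q) \<le> 1"
  shows "(\<integral>\<^sup>+c. ennreal (min (\<rho> x c) L) \<partial>Q) + deficit x = 1"
proof -
  have [measurable]: "\<rho> x \<in> borel_measurable Q"
    using measurable_compose[OF measurable_Pair1'[OF x] measurable_\<rho>] by simp
  have "ennreal (\<rho> x c) = ennreal (min (\<rho> x c) L) + ennreal (\<rho> x c - L)" for c
    using \<rho>_nonneg[of x c] L by (cases "\<rho> x c \<le> L") (auto simp: ennreal_neg simp flip: ennreal_plus)
  then have split: "(\<integral>\<^sup>+c. ennreal (\<rho> x c) \<partial>Q) = (\<integral>\<^sup>+c. ennreal (min (\<rho> x c) L) \<partial>Q)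
      + (\<integral>\<^sup>+c. ennreal (\<rho> x c - L) \<partial>Q)"
    by (simp add: nn_integral_add)
  have "(\<integral>\<^sup>+c. ennreal (min (\<rho> x c) L) \<partial>Q) + deficit x = (1 - (\<integral>\<^sup>+c. ennreal (\<rho> x c) \<partial>Q))
      + (\<integral>\<^sup>+c. ennreal (\<rho> x c) \<partial>Q)"
    unfolding deficit_def split by (simp add: ac_simps)
  then show ?thesis using sub by (simp add: diff_add_cancel_ennreal)
qed

lemma deficit_ge_of_not_good:
  assumes x: "x \<in> space P" "\<not> good x" and sub: "(\<integral>\<^sup>+c. ennreal (\<rho> x c) \<partial>Q) \<le> 1"
  shows "ennreal \<eta> \<le> deficit x"
proof (rule ccontr)
  assume "\<not> ?thesis"
  then have "deficit x \<le> ennreal \<eta>" by simp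
  then have "1 \<le> (\<integral>\<^sup>+c. ennreal (min (\<rho> x c) L) \<partial>Q) + ennreal \<eta>"
    unfolding nn_integral_min_plus_deficit[OF x(1) sub, symmetric] by (rule add_left_mono)
  then have "1 - ennreal \<eta> \<le> (\<integral>\<^sup>+c. ennreal (min (\<rho> x c) L) \<partial>Q)"
    by (simp add: ennreal_minus_le_iff add.commute)
  then show False
    using x(2) \<eta> by (simp add: typical_def ennreal_minus flip: ennreal_1)
qed

lemma emeasure_not_good_le:
  assumes \<eta>_pos: "0 < \<eta>" and s: "0 < s" and sub: "\<And>x. x \<in> space P \<Longrightarrow> (\<integral>\<^sup>+c. ennreal (\<rho> x c) \<partial>Q) \<le> 1"
    and total: "(\<integral>\<^sup>+x. \<integral>\<^sup>+c. ennreal (\<rho> x c) \<partial>Q \<partial>P) = 1"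
  shows "emeasure P {x \<in> space P. \<not> good x} \<le>
    ennreal (1 / \<eta> * L powr (- s)) * (\<integral>\<^sup>+x. \<integral>\<^sup>+c. ennreal (\<rho> x c powr (1 + s)) \<partial>Q \<partial>P)"
proof -
  have "(\<integral>\<^sup>+x. deficit x \<partial>P) = (1 - (\<integral>\<^sup>+x. \<integral>\<^sup>+c. ennreal (\<rho> x c) \<partial>Q \<partial>P))
      + (\<integral>\<^sup>+x. \<integral>\<^sup>+c. ennreal (\<rho> x c - L) \<partial>Q \<partial>P)"
    unfolding deficit_def
    by (subst nn_integral_add, measurable, subst nn_integral_diff)
      (auto simp: total P.emeasure_space_1 intro!: AE_I2 sub)
  also have "\<dots> \<le> (\<integral>\<^sup>+x. \<integral>\<^sup>+c. ennreal (L powr (- s)) * ennreal (\<rho> x c powr (1 + s)) \<partial>Q \<partial>P)"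
    unfolding total using powr_excess_le[OF \<rho>_nonneg s]
    by (auto intro!: nn_integral_mono ennreal_leI simp flip: ennreal_mult')
  also have "\<dots> = (\<integral>\<^sup>+x. ennreal (L powr (- s)) * (\<integral>\<^sup>+c. ennreal (\<rho> x c powr (1 + s)) \<partial>Q) \<partial>P)"
    by (intro nn_integral_cong nn_integral_cmult) measurable
  also have "\<dots> = ennreal (L powr (- s)) * (\<integral>\<^sup>+x. \<integral>\<^sup>+c. ennreal (\<rho> x c powr (1 + s)) \<partial>Q \<partial>P)"
    by (rule nn_integral_cmult) measurable
  finally have deficit_le: "(\<integral>\<^sup>+x. deficit x \<partial>P)
      \<le> ennreal (L powr (- s)) * (\<integral>\<^sup>+x. \<integral>\<^sup>+c. ennreal (\<rho> x c powr (1 + s)) \<partial>Q \<partial>P)" .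
  have "1 \<le> ennreal (1 / \<eta>) * deficit x" if "x \<in> space P" "\<not> good x" for x
    using mult_left_mono[OF deficit_ge_of_not_good[OF that sub[OF that(1)]], of "ennreal (1 / \<eta>)"]
      \<eta>_pos
    by (simp flip: ennreal_mult')
  then have "emeasure P {x \<in> space P. \<not> good x}
      \<le> emeasure P {x \<in> space P. 1 \<le> ennreal (1 / \<eta>) * deficit x}"
    by (intro emeasure_mono) auto
  also have "\<dots> \<le> ennreal (1 / \<eta>) * (\<integral>\<^sup>+x. deficit x * indicator (space P) x \<partial>P)"
    by (rule nn_integral_Markov_inequality) auto
  also have "(\<integral>\<^sup>+x. deficit x * indicator (space P) x \<partial>P) = (\<integral>\<^sup>+x. deficit x \<partial>P)"
    by (intro nn_integral_cong) auto
  finally have "emeasure P {x \<in> space P. \<not> good x} \<le>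
      ennreal (1 / \<eta>) * (ennreal (L powr (- s)) * (\<integral>\<^sup>+x. \<integral>\<^sup>+c. ennreal (\<rho> x c powr (1 + s)) \<partial>Q \<partial>P))"
    using mult_left_mono[OF deficit_le] by (rule order_trans) simp
  moreover have "ennreal (1 / \<eta> * L powr (- s)) = ennreal (1 / \<eta>) * ennreal (L powr (- s))"
    using \<eta>_pos by (intro ennreal_mult) auto
  ultimately show ?thesis by (simp only: mult.assoc)
qed

lemma codebooks_as_code:
  fixes label :: "'a \<Rightarrow> 'c"
  assumes B: "finite B" "label \<in> P \<rightarrow>\<^sub>M count_space B" and \<Psi>: "\<Psi> \<in> B \<rightarrow> space Book"
  obtains enc :: "'a \<Rightarrow> nat" and dec where "enc \<in> P \<rightarrow>\<^sub>M count_space UNIV" "\<And>z. dec z \<in> space Q"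
    "finite (enc ` space P)" "card (enc ` space P) \<le> card B * (N + 1)"
    "\<And>x. x \<in> space P \<Longrightarrow> dec (enc x) = out x (\<Psi> (label x))"
proof
  let ?enc = "\<lambda>x. prod_encode (to_nat_on B (label x), index x (\<Psi> (label x)))"
  let ?dec = "\<lambda>z. decode (\<Psi> (from_nat_into B (fst (prod_decode z)))) (snd (prod_decode z))"
  have label_in: "label x \<in> B" if "x \<in> space P" for x
    using measurable_space[OF B(2) that] by simp
  obtain x0 where "x0 \<in> space P" using P.not_empty by blast
  then have "B \<noteq> {}" using label_in by blast
  show "?enc \<in> P \<rightarrow>\<^sub>M count_space UNIV"
  proof (rule measurable_compose_countable'[OF _ B(2)])
    fix b assume "b \<in> B"
    then have "\<Psi> b \<in> space Book" using \<Psi> by blast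
    from measurable_compose[OF measurable_compose[OF measurable_Pair2'[OF this] measurable_index],
        of "\<lambda>j. prod_encode (to_nat_on B b, j)" "count_space UNIV"]
    show "(\<lambda>x. prod_encode (to_nat_on B b, index x (\<Psi> b))) \<in> P \<rightarrow>\<^sub>M count_space UNIV" by simp
  qed (rule countable_finite[OF B(1)])
  show "?dec z \<in> space Q" for z
    using \<Psi> from_nat_into[OF \<open>B \<noteq> {}\<close>] by (intro decode_in_space) blast
  have sub: "?enc ` space P \<subseteq> prod_encode ` (to_nat_on B ` B \<times> {..N})"
    using label_in index_le by auto
  then show "finite (?enc ` space P)"
    by (rule finite_subset) (use B(1) in simp)
  have "card (?enc ` space P) \<le> card (to_nat_on B ` B \<times> {..N})"
    using B(1) by (intro order_trans[OF card_mono[OF _ sub] card_image_le]) auto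
  also have "\<dots> \<le> card B * (N + 1)"
    using card_image_le[OF B(1), of "to_nat_on B"]
    by (simp add: card_cartesian_product add_mono mult_mono)
  finally show "card (?enc ` space P) \<le> card B * (N + 1)" .
  show "?dec (?enc x) = out x (\<Psi> (label x))" if "x \<in> space P" for x
    using label_in[OF that] by (simp add: out_def countable_finite[OF B(1)])
qed

context
  fixes label :: "'a \<Rightarrow> 'c" and B :: "'c set" and I :: "'i set" and h :: "'i \<Rightarrow> 'a \<times> 'b \<Rightarrow> real"
    and u :: "'i \<Rightarrow> real" and p :: real
  assumes B: "finite B" "label \<in> P \<rightarrow>\<^sub>M count_space B"
    "\<And>b. b \<in> B \<Longrightarrow> measure P {x \<in> space P. label x = b} \<le> p"
    and I: "finite I" and h: "\<And>i. i \<in> I \<Longrightarrow> h i \<in> borel_measurable (P \<Otimes>\<^sub>M Q)"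
      "\<And>i z. i \<in> I \<Longrightarrow> 0 \<le> h i z" "\<And>i z. i \<in> I \<Longrightarrow> h i z \<le> 1"
    and u: "\<And>i. i \<in> I \<Longrightarrow> mean_out (\<lambda>z. ennreal (h i z)) \<le> ennreal (u i)" "\<And>i. i \<in> I \<Longrightarrow> 0 \<le> u i"
    and p: "0 \<le> p"
begin

lemma ex_codebooks:
  fixes v :: real
  assumes F: "F \<in> borel_measurable (P \<Otimes>\<^sub>M Q)" "mean_out F \<le> ennreal v" and v: "0 \<le> v"
  shows "\<exists>\<Psi>. \<Psi> \<in> B \<rightarrow> space Book \<and>
    (\<forall>i\<in>I. (\<integral>x. h i (x, out x (\<Psi> (label x))) \<partial>P) \<le> u i + sqrt (card I * p + v)) \<and>
    (\<integral>\<^sup>+x. F (x, out x (\<Psi> (label x))) \<partial>P) \<le> ennreal (card I * p + v)"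
proof -
  interpret random_selection P Book label B p by standard (fact B)+
  let ?out = "\<lambda>z. (fst z, out (fst z) (snd z))"
  define mean where "mean i = (\<integral>z. h i (?out z) \<partial>(P \<Otimes>\<^sub>M Book))" for i
  define dev where "dev i \<Psi> = (\<integral>x. h i (x, out x (\<Psi> (label x))) \<partial>P) - mean i" for i \<Psi>
  note meas = measurable_source_out[OF h(1)] measurable_source_out[OF F(1)]
  obtain \<Psi> where \<Psi>: "\<Psi> \<in> B \<rightarrow> space Book" and
    "(\<Sum>i\<in>I. ennreal ((dev i \<Psi>)\<^sup>2)) + (\<integral>\<^sup>+x. F (x, out x (\<Psi> (label x))) \<partial>P) \<le>
      of_nat (card I) * ennreal p + (\<integral>\<^sup>+z. F (?out z) \<partial>(P \<Otimes>\<^sub>M Book))"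
    using ex_selection[of I "\<lambda>i z. h i (?out z)" "\<lambda>z. F (?out z)"] meas h(2,3)
    unfolding dev_def mean_def by auto
  note this(2)
  also have "of_nat (card I) * ennreal p + (\<integral>\<^sup>+z. F (?out z) \<partial>(P \<Otimes>\<^sub>M Book))
      \<le> of_nat (card I) * ennreal p + ennreal v"
    using F(2) unfolding mean_out_def by (rule add_left_mono)
  also have "\<dots> = ennreal (card I * p + v)"
    using p v by (simp add: ennreal_of_nat_eq_real_of_nat ennreal_mult)
  finally have total: "(\<Sum>i\<in>I. ennreal ((dev i \<Psi>)\<^sup>2)) + (\<integral>\<^sup>+x. F (x, out x (\<Psi> (label x))) \<partial>P)
      \<le> ennreal (card I * p + v)" .
  show ?thesis
  proof (intro exI[of _ \<Psi>] conjI ballI \<Psi>)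
    fix i assume i: "i \<in> I"
    have "ennreal ((dev i \<Psi>)\<^sup>2) \<le> (\<Sum>i\<in>I. ennreal ((dev i \<Psi>)\<^sup>2))"
      using i I by (intro member_le_sum) auto
    also have "\<dots> \<le> ennreal (card I * p + v)"
      using total by (rule order_trans[rotated]) simp
    finally have "(dev i \<Psi>)\<^sup>2 \<le> card I * p + v" using p v by (subst (asm) ennreal_le_iff) auto
    then have "\<bar>dev i \<Psi>\<bar> \<le> sqrt (card I * p + v)" by (intro real_le_rsqrt) simp
    moreover have "mean i \<le> u i"
    proof -
      have "ennreal (mean i) = (\<integral>\<^sup>+z. ennreal (h i (?out z)) \<partial>(P \<Otimes>\<^sub>M Book))"
        unfolding mean_def using meas(1)[OF i] h(2,3)[OF i]
        by (intro nn_integral_eq_integral[symmetric] P_Book.integrable_const_bound[of _ 1]) auto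
      also have "\<dots> \<le> ennreal (u i)"
        using u(1)[OF i] by (simp add: mean_out_def)
      finally show ?thesis using u(2)[OF i] by (subst (asm) ennreal_le_iff) auto
    qed
    ultimately show "(\<integral>x. h i (x, out x (\<Psi> (label x))) \<partial>P) \<le> u i + sqrt (card I * p + v)"
      unfolding dev_def by linarith
  next
    show "(\<integral>\<^sup>+x. F (x, out x (\<Psi> (label x))) \<partial>P) \<le> ennreal (card I * p + v)"
      using total by (rule order_trans[rotated]) simp
  qed
qed

proposition ex_code:
  fixes v :: real
  assumes F: "F \<in> borel_measurable (P \<Otimes>\<^sub>M Q)" "mean_out F \<le> ennreal v" and v: "0 \<le> v"
  obtains enc :: "'a \<Rightarrow> nat" and dec where "enc \<in> P \<rightarrow>\<^sub>M count_space UNIV" "\<And>z. dec z \<in> space Q"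
    "finite (enc ` space P)" "card (enc ` space P) \<le> card B * (N + 1)"
    "\<And>i. i \<in> I \<Longrightarrow> (\<integral>x. h i (x, dec (enc x)) \<partial>P) \<le> u i + sqrt (card I * p + v)"
    "(\<integral>\<^sup>+x. F (x, dec (enc x)) \<partial>P) \<le> ennreal (card I * p + v)"
proof -
  obtain \<Psi> where \<Psi>: "\<Psi> \<in> B \<rightarrow> space Book"
    and h_le: "\<And>i. i \<in> I \<Longrightarrow> (\<integral>x. h i (x, out x (\<Psi> (label x))) \<partial>P) \<le> u i + sqrt (card I * p + v)"
    and F_le: "(\<integral>\<^sup>+x. F (x, out x (\<Psi> (label x))) \<partial>P) \<le> ennreal (card I * p + v)"
    using ex_codebooks[OF F v] by blast
  obtain enc :: "'a \<Rightarrow> nat" and dec where code: "enc \<in> P \<rightarrow>\<^sub>M count_space UNIV" "\<And>z. dec z \<in> space Q"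
    "finite (enc ` space P)" "card (enc ` space P) \<le> card B * (N + 1)"
    and dec_enc: "\<And>x. x \<in> space P \<Longrightarrow> dec (enc x) = out x (\<Psi> (label x))"
    using codebooks_as_code[OF B(1,2) \<Psi>] by blast
  have "(\<integral>x. h i (x, dec (enc x)) \<partial>P) = (\<integral>x. h i (x, out x (\<Psi> (label x))) \<partial>P)" for i
    by (intro Bochner_Integration.integral_cong) (simp_all add: dec_enc)
  moreover have "(\<integral>\<^sup>+x. F (x, dec (enc x)) \<partial>P) = (\<integral>\<^sup>+x. F (x, out x (\<Psi> (label x))) \<partial>P)"
    by (intro nn_integral_cong) (simp add: dec_enc)
  ultimately show thesis
    using code h_le F_le by (intro that[of enc dec]) simp_all
qed

lemma ex_code_sum:
  fixes F :: "'j \<Rightarrow> 'a \<times> 'b \<Rightarrow> ennreal" and v T :: real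
  assumes J: "finite J" "J \<noteq> {}"
    and F: "\<And>j. j \<in> J \<Longrightarrow> F j \<in> borel_measurable (P \<Otimes>\<^sub>M Q)" "\<And>j. j \<in> J \<Longrightarrow> mean_out (F j) \<le> ennreal v"
    and v: "0 \<le> v" and T: "0 < T"
  obtains enc :: "'a \<Rightarrow> nat" and dec where "enc \<in> P \<rightarrow>\<^sub>M count_space UNIV" "\<And>z. dec z \<in> space Q"
    "finite (enc ` space P)" "card (enc ` space P) \<le> card B * (N + 1)"
    "\<And>i. i \<in> I \<Longrightarrow> (\<integral>x. h i (x, dec (enc x)) \<partial>P) \<le> u i + sqrt (card I * p + T * v)"
    "(\<Sum>j\<in>J. \<integral>\<^sup>+x. F j (x, dec (enc x)) \<partial>P) \<le> ennreal (card J * (card I * p / T + v))"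
proof -
  define m where "m = real (card J)"
  have m: "0 < m" using J by (simp add: m_def card_gt_0_iff)
  let ?G = "\<lambda>z. ennreal (T / m) * (\<Sum>j\<in>J. F j z)"
  have "mean_out ?G = ennreal (T / m) * (\<Sum>j\<in>J. mean_out (F j))"
    by (rule mean_out_cmult_sum) (rule F(1))
  also have "\<dots> \<le> ennreal (T / m) * (\<Sum>j\<in>J. ennreal v)"
    by (intro mult_left_mono sum_mono F(2)) auto
  also have "\<dots> = ennreal (T * v)"
    using m T p v by (simp add: m_def ennreal_of_nat_eq_real_of_nat flip: ennreal_mult)
  finally have G: "mean_out ?G \<le> ennreal (T * v)" .
  have G_meas: "?G \<in> borel_measurable (P \<Otimes>\<^sub>M Q)" using F(1) by measurable
  show thesis
  proof (rule ex_code[OF G_meas G])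
    fix enc :: "'a \<Rightarrow> nat" and dec
    assume code: "enc \<in> P \<rightarrow>\<^sub>M count_space UNIV" "\<And>z. dec z \<in> space Q"
        "finite (enc ` space P)" "card (enc ` space P) \<le> card B * (N + 1)"
        "\<And>i. i \<in> I \<Longrightarrow> (\<integral>x. h i (x, dec (enc x)) \<partial>P) \<le> u i + sqrt (card I * p + T * v)"
      and G_le: "(\<integral>\<^sup>+x. ?G (x, dec (enc x)) \<partial>P) \<le> ennreal (card I * p + T * v)"
    have "(\<lambda>x. (x, dec (enc x))) \<in> P \<rightarrow>\<^sub>M P \<Otimes>\<^sub>M Q"
      using measurable_compose[OF code(1), of dec] code(2) by (intro measurable_Pair) auto
    from measurable_compose[OF this F(1)]
    have "ennreal (T / m) * (\<Sum>j\<in>J. \<integral>\<^sup>+x. F j (x, dec (enc x)) \<partial>P) \<le> ennreal (card I * p + T * v)"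
      using G_le by (simp add: nn_integral_cmult nn_integral_sum)
    from mult_left_mono[OF this, of "ennreal (m / T)"]
    have "(\<Sum>j\<in>J. \<integral>\<^sup>+x. F j (x, dec (enc x)) \<partial>P) \<le> ennreal (m / T * (card I * p + T * v))"
      using m T p v by (simp add: mult.assoc[symmetric] ennreal_mult''[symmetric] del: ennreal_plus)
    also have "m / T * (card I * p + T * v) = card J * (card I * p / T + v)"
      using T by (simp add: m_def field_simps)
    finally show thesis by (intro that[of enc dec] code)
  qed (use T v in auto)
qed

end

end

section \<open>Exponents\<close>

lemma mult_ln_le_powr_quotient:
  fixes t s :: real
  assumes "0 \<le> t" "0 < s" "s \<le> 1"
  shows "t * ln t \<le> (t powr (1 + s) - t) / s" "(t powr (1 + s) - t) / s \<le> t * (t - 1)"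
proof -
  have powr_eq: "t powr (1 + s) - t = t * (t powr s - 1)"
    using assms by (cases "t = 0") (auto simp: powr_add algebra_simps)
  have "s * ln t \<le> t powr s - 1" if "t \<noteq> 0"
    using that exp_ge_add_one_self[of "s * ln t"] by (simp add: powr_def del: exp_ge_add_one_self)
  then have "t * (s * ln t) \<le> t * (t powr s - 1)"
    using assms by (cases "t = 0") (auto intro: mult_left_mono)
  then show "t * ln t \<le> (t powr (1 + s) - t) / s"
    unfolding powr_eq using assms by (simp add: field_simps)
  have "t powr s - 1 \<le> s * (t - 1)"
  proof (cases "t = 0")
    case False
    then have "1 powr (1 - s) * t powr s \<le> (1 - s) * 1 + s * t"
      using assms by (intro Youngs_inequality_0) auto
    then show ?thesis by (simp add: algebra_simps)
  qed (use assms in simp)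
  then have "t * (t powr s - 1) \<le> t * (s * (t - 1))" using assms by (intro mult_left_mono) auto
  then show "(t powr (1 + s) - t) / s \<le> t * (t - 1)"
    unfolding powr_eq using assms by (simp add: field_simps)
qed

lemma mult_ln_ge_minus_one: "0 \<le> (t::real) \<Longrightarrow> - 1 \<le> t * ln t"
  using kl_fun_nonneg[of t]
  by (cases "t = 0") (auto simp: kl_fun_def log_def divide_simps split: if_splits)

lemma abs_powr_quotient_le:
  fixes t s :: real
  assumes "0 \<le> t" "t \<le> B" "0 < s" "s \<le> 1"
  shows "\<bar>(t powr (1 + s) - t) / s\<bar> \<le> 1 + B\<^sup>2" "\<bar>t * ln t\<bar> \<le> 1 + B\<^sup>2"
proof -
  have "t * t \<le> B * B" using assms by (intro mult_mono) auto
  then have "t * (t - 1) \<le> B\<^sup>2" using assms(1) by (simp add: power2_eq_square right_diff_distrib)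
  then show "\<bar>(t powr (1 + s) - t) / s\<bar> \<le> 1 + B\<^sup>2" "\<bar>t * ln t\<bar> \<le> 1 + B\<^sup>2"
    using mult_ln_le_powr_quotient[of t s] mult_ln_ge_minus_one[of t] assms zero_le_power2[of B]
    by linarith+
qed

lemma powr_quotient_tendsto:
  assumes "0 \<le> (t::real)"
  shows "(\<lambda>k. (t powr (1 + 1 / real (Suc k)) - t) / (1 / real (Suc k))) \<longlonglongrightarrow> t * ln t"
proof (cases "t = 0")
  case False
  then have "0 < t" using assms by simp
  then show ?thesis by real_asymp
qed simp

lemma (in prob_space) expectation_mult_ln_le:
  fixes f :: "'a \<Rightarrow> real"
  assumes [measurable]: "f \<in> borel_measurable M" and f: "\<And>z. 0 \<le> f z" "\<And>z. f z \<le> B"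
    and mean: "expectation f = 1"
    and info: "(\<integral>\<^sup>+z. ennreal (kl_fun (f z)) \<partial>M) \<le> ennreal I" "0 \<le> I"
  shows "expectation (\<lambda>z. f z * ln (f z)) \<le> I * ln 2"
proof -
  have int_f: "integrable M f" by (rule integrable_const_bound[of _ B]) (use f in auto)
  have int_ln: "integrable M (\<lambda>z. f z * ln (f z))"
    using abs_powr_quotient_le(2)[OF f zero_less_one order_refl]
    by (intro integrable_const_bound[of _ "1 + B\<^sup>2"]) auto
  have kl: "kl_fun (f z) = (f z * ln (f z) - (f z - 1)) / ln 2" for z
    by (simp add: kl_fun_def log_def diff_divide_distrib)
  have "expectation (\<lambda>z. kl_fun (f z)) = expectation (\<lambda>z. f z * ln (f z)) / ln 2"
    unfolding kl using int_f int_ln by (simp add: mean prob_space)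
  moreover have "ennreal (expectation (\<lambda>z. kl_fun (f z))) \<le> ennreal I"
    using info(1) int_f int_ln kl_fun_nonneg[OF f(1)]
    by (subst nn_integral_eq_integral[symmetric]) (auto simp: kl)
  ultimately have "expectation (\<lambda>z. f z * ln (f z)) / ln 2 \<le> I" using info(2) by simp
  then show ?thesis by (simp add: pos_divide_le_eq)
qed

text \<open>The moment of order \<open>1 + s\<close> has derivative \<open>\<integral> f ln f\<close> at \<open>s = 0\<close>.\<close>

lemma (in prob_space) ex_powr_moment_le_exp:
  fixes f :: "'a \<Rightarrow> real"
  assumes [measurable]: "f \<in> borel_measurable M" and f: "\<And>z. 0 \<le> f z" "\<And>z. f z \<le> B"
    and total: "(\<integral>\<^sup>+z. ennreal (f z) \<partial>M) = 1"
    and info: "(\<integral>\<^sup>+z. ennreal (kl_fun (f z)) \<partial>M) \<le> ennreal I" "0 \<le> I" and \<delta>: "0 < \<delta>"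
  obtains s
    where "0 < s" "(\<integral>\<^sup>+z. ennreal (f z powr (1 + s)) \<partial>M) \<le> ennreal (exp (s * (I * ln 2 + \<delta>)))"
proof -
  have int_f: "integrable M f" by (rule integrable_const_bound[of _ B]) (use f in auto)
  then have mean: "expectation f = 1" using total nn_integral_eq_integral[of M f] f by simp
  define quot where "quot k z
      = (f z powr (1 + 1 / real (Suc k)) - f z) / (1 / real (Suc k))" for k z
  have [measurable]: "quot k \<in> borel_measurable M" for k unfolding quot_def by measurable
  have abs_quot_le: "\<bar>quot k z\<bar> \<le> 1 + B\<^sup>2" for k z
    unfolding quot_def by (rule abs_powr_quotient_le(1)[OF f]) auto
  have "(\<lambda>k. expectation (quot k)) \<longlonglongrightarrow> expectation (\<lambda>z. f z * ln (f z))"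
  proof (rule integral_dominated_convergence[where w = "\<lambda>_. 1 + B\<^sup>2"])
    show "AE z in M. (\<lambda>k. quot k z) \<longlonglongrightarrow> f z * ln (f z)"
      unfolding quot_def using powr_quotient_tendsto[OF f(1)] by simp
    show "AE z in M. norm (quot k z) \<le> 1 + B\<^sup>2" for k
      using abs_quot_le by simp
  qed auto
  moreover have "expectation (\<lambda>z. f z * ln (f z)) < I * ln 2 + \<delta>"
    using expectation_mult_ln_le[OF assms(1) f mean info] \<delta> by simp
  ultimately have "\<forall>\<^sub>F k in sequentially. expectation (quot k) < I * ln 2 + \<delta>"
    by (rule order_tendstoD(2))
  then obtain k where k: "expectation (quot k) < I * ln 2 + \<delta>"
    by (auto simp: eventually_sequentially)
  define s where "s = 1 / real (Suc k)"
  have s: "0 < s" by (simp add: s_def)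
  have int_quot: "integrable M (quot k)"
    using abs_quot_le by (intro integrable_const_bound[of _ "1 + B\<^sup>2"]) auto
  have powr_eq: "f z powr (1 + s) = f z + s * quot k z" for z
    using s by (simp add: quot_def s_def)
  have "expectation (\<lambda>z. f z powr (1 + s)) = 1 + s * expectation (quot k)"
    unfolding powr_eq using int_f int_quot by (simp add: mean)
  also have "\<dots> \<le> 1 + s * (I * ln 2 + \<delta>)" using k s by simp
  also have "\<dots> \<le> exp (s * (I * ln 2 + \<delta>))" by (rule exp_ge_add_one_self)
  finally have "(\<integral>\<^sup>+z. ennreal (f z powr (1 + s)) \<partial>M) \<le> ennreal (exp (s * (I * ln 2 + \<delta>)))"
    using int_f int_quot
    by (subst nn_integral_eq_integral) (auto simp: powr_eq[symmetric] intro: ennreal_leI, simp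
      add: powr_eq)
  then show thesis using that s by blast
qed

lemma ex_tail_nn_integral_le:
  assumes [measurable]: "h \<in> borel_measurable M" and fin: "(\<integral>\<^sup>+x. h x \<partial>M) < \<infinity>" and \<epsilon>: "0 < \<epsilon>"
  obtains \<tau> :: real where "0 \<le> \<tau>" "(\<integral>\<^sup>+x. (if h x \<le> ennreal \<tau> then 0 else h x) \<partial>M) \<le> ennreal \<epsilon>"
proof -
  have "(\<lambda>i. \<integral>\<^sup>+x. (if h x \<le> ennreal (real i) then 0 else h x) \<partial>M) \<longlonglongrightarrow> (\<integral>\<^sup>+x. 0 \<partial>M)"
  proof (rule nn_integral_dominated_convergence[where w = h])
    have "AE x in M. h x \<noteq> \<infinity>" using fin by (intro nn_integral_noteq_infinite) auto
    then show "AE x in M. (\<lambda>i. if h x \<le> ennreal (real i) then 0 else h x) \<longlonglongrightarrow> 0"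
    proof eventually_elim
      fix x assume "h x \<noteq> \<infinity>"
      then obtain y where y: "0 \<le> y" "h x = ennreal y" by (cases "h x") auto
      have "\<forall>\<^sub>F i in sequentially. (if h x \<le> ennreal (real i) then 0 else h x) = 0"
        using eventually_ge_at_top[of "nat \<lceil>y\<rceil>"]
        by eventually_elim (auto simp: y nat_le_iff ceiling_le_iff intro: ennreal_leI)
      then show "(\<lambda>i. if h x \<le> ennreal (real i) then 0 else h x) \<longlonglongrightarrow> 0" by (rule tendsto_eventually)
    qed
  qed (use fin in auto)
  then have "\<forall>\<^sub>F i in sequentially. (\<integral>\<^sup>+x. (if h x \<le> ennreal (real i) then 0 else h x) \<partial>M)
      < ennreal \<epsilon>"
    using \<epsilon> by (intro order_tendstoD(2)[of _ 0]) auto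
  then obtain i where "(\<integral>\<^sup>+x. (if h x \<le> ennreal (real i) then 0 else h x) \<partial>M) < ennreal \<epsilon>"
    by (auto simp: eventually_sequentially)
  then show thesis by (intro that[of "real i"]) auto
qed

section \<open>Rejection sampling for memoryless sources\<close>

lemma nn_integral_iid_coord:
  assumes "prob_space M" "t < n" "h \<in> borel_measurable M"
  shows "(\<integral>\<^sup>+x. h (x t) \<partial>iid n M) = (\<integral>\<^sup>+x. h x \<partial>M)"
proof -
  interpret M: prob_space M by fact
  interpret product_prob_space "\<lambda>_. M" "{..<n}" ..
  have "distr (iid n M) M (\<lambda>x. x t) = M" using assms by (intro PiM_component) auto
  then have "(\<integral>\<^sup>+x. h x \<partial>M) = (\<integral>\<^sup>+x. h x \<partial>distr (iid n M) M (\<lambda>x. x t))" by simp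
  also have "\<dots> = (\<integral>\<^sup>+x. h (x t) \<partial>iid n M)"
    using assms by (intro nn_integral_distr measurable_component_singleton) auto
  finally show ?thesis ..
qed

lemma nn_integral_iid_prod:
  fixes u :: "nat \<Rightarrow> 'a \<times> 'b \<Rightarrow> ennreal"
  assumes "prob_space M" "prob_space q" and u: "\<And>t. t < n \<Longrightarrow> u t \<in> borel_measurable (M \<Otimes>\<^sub>M q)"
  shows "(\<integral>\<^sup>+x. \<integral>\<^sup>+c. (\<Prod>t<n. u t (x t, c t)) \<partial>iid n q \<partial>iid n M) = (\<Prod>t<n. \<integral>\<^sup>+z. u t z \<partial>(M \<Otimes>\<^sub>M q))"
proof -
  interpret M: prob_space M by fact
  interpret q: prob_space q by fact
  interpret Mn: product_prob_space "\<lambda>_. M" "{..<n}" ..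
  interpret qn: product_prob_space "\<lambda>_. q" "{..<n}" ..
  have "(\<integral>\<^sup>+x. \<integral>\<^sup>+c. (\<Prod>t<n. u t (x t, c t)) \<partial>iid n q \<partial>iid n M)
      = (\<integral>\<^sup>+x. (\<Prod>t<n. \<integral>\<^sup>+y. u t (x t, y) \<partial>q) \<partial>iid n M)"
  proof (rule nn_integral_cong)
    fix x assume "x \<in> space (iid n M)"
    then have "x t \<in> space M" if "t < n" for t using that by (auto simp: space_PiM)
    then have "(\<lambda>y. u t (x t, y)) \<in> borel_measurable q" if "t < n" for t
      using measurable_compose[OF measurable_Pair1' u] that by blast
    then show "(\<integral>\<^sup>+c. (\<Prod>t<n. u t (x t, c t)) \<partial>iid n q) = (\<Prod>t<n. \<integral>\<^sup>+y. u t (x t, y) \<partial>q)"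
      by (intro qn.product_nn_integral_prod) auto
  qed
  also have "\<dots> = (\<Prod>t<n. \<integral>\<^sup>+x. \<integral>\<^sup>+y. u t (x, y) \<partial>q \<partial>M)"
    using u by (intro Mn.product_nn_integral_prod q.borel_measurable_nn_integral_fst) auto
  also have "\<dots> = (\<Prod>t<n. \<integral>\<^sup>+z. u t z \<partial>(M \<Otimes>\<^sub>M q))"
    using u by (intro prod.cong q.nn_integral_fst) auto
  finally show ?thesis .
qed

definition block_density :: "('a \<Rightarrow> 'b \<Rightarrow> real) \<Rightarrow> nat \<Rightarrow> (nat \<Rightarrow> 'a) \<Rightarrow> (nat \<Rightarrow> 'b) \<Rightarrow> real" where
  "block_density r n x c = (\<Prod>t<n. r (x t) (c t))"

locale memoryless_density =
  fixes M :: "'a measure" and q :: "'b measure" and r :: "'a \<Rightarrow> 'b \<Rightarrow> real" and B I :: real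
    and y0 :: 'b
  assumes prob_space_M: "prob_space M" and prob_space_q: "prob_space q"
    and measurable_r [measurable]: "case_prod r \<in> borel_measurable (M \<Otimes>\<^sub>M q)"
    and r_nonneg: "\<And>x y. 0 \<le> r x y" and r_le: "\<And>x y. r x y \<le> B"
    and r_sub: "\<And>x. x \<in> space M \<Longrightarrow> (\<integral>\<^sup>+y. ennreal (r x y) \<partial>q) \<le> 1"
    and r_total: "(\<integral>\<^sup>+z. ennreal (case_prod r z) \<partial>(M \<Otimes>\<^sub>M q)) = 1"
    and info: "(\<integral>\<^sup>+z. ennreal (kl_fun (case_prod r z)) \<partial>(M \<Otimes>\<^sub>M q)) \<le> ennreal I" "0 \<le> I"
    and y0: "y0 \<in> space q"
begin

sublocale M: prob_space M by (rule prob_space_M)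
sublocale q: prob_space q by (rule prob_space_q)
sublocale M_q: pair_prob_space M q ..
sublocale Mn: product_prob_space "\<lambda>_. M" "{..<n}" for n ..
sublocale qn: product_prob_space "\<lambda>_. q" "{..<n}" for n ..

abbreviation "\<rho> \<equiv> block_density r"
abbreviation "y0_block n \<equiv> \<lambda>_\<in>{..<n}. y0"

lemma measurable_coord_pair:
  assumes "t < n"
  shows "(\<lambda>z. (fst z t, snd z t)) \<in> iid n M \<Otimes>\<^sub>M iid n q \<rightarrow>\<^sub>M M \<Otimes>\<^sub>M q"
  using assms measurable_compose[OF measurable_fst measurable_component_singleton[of t "{..<n}"
    "\<lambda>_. M"]]
    measurable_compose[OF measurable_snd measurable_component_singleton[of t "{..<n}" "\<lambda>_. q"]]
  by (intro measurable_Pair) auto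

lemma measurable_block_density: "case_prod (\<rho> n) \<in> borel_measurable (iid n M \<Otimes>\<^sub>M iid n q)"
proof -
  have "(\<lambda>z. \<Prod>t<n. r (fst z t) (snd z t)) \<in> borel_measurable (iid n M \<Otimes>\<^sub>M iid n q)"
    using measurable_compose[OF measurable_coord_pair measurable_r]
    by (intro borel_measurable_prod) auto
  then show ?thesis by (simp add: block_density_def case_prod_beta')
qed

lemma block_density_nonneg: "0 \<le> \<rho> n x c"
  unfolding block_density_def by (intro prod_nonneg) (simp add: r_nonneg)

lemma nn_integral_block_density_mult:
  assumes "t < n" and [measurable]: "h \<in> borel_measurable (M \<Otimes>\<^sub>M q)"
  shows "(\<integral>\<^sup>+x. \<integral>\<^sup>+c. ennreal (\<rho> n x c) * h (x t, c t) \<partial>iid n q \<partial>iid n M)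
      = (\<integral>\<^sup>+z. ennreal (case_prod r z) * h z \<partial>(M \<Otimes>\<^sub>M q))"
proof -
  let ?u = "\<lambda>i z. ennreal (case_prod r z) * (if i = t then h z else 1)"
  have "ennreal (\<rho> n x c) * h (x t, c t) = (\<Prod>i<n. ?u i (x i, c i))" for x c
    using assms(1) by (simp add: block_density_def prod.distrib prod_ennreal r_nonneg prod.delta)
  then have "(\<integral>\<^sup>+x. \<integral>\<^sup>+c. ennreal (\<rho> n x c) * h (x t, c t) \<partial>iid n q \<partial>iid n M)
      = (\<Prod>i<n. \<integral>\<^sup>+z. ?u i z \<partial>(M \<Otimes>\<^sub>M q))"
    using nn_integral_iid_prod[OF prob_space_M prob_space_q, of n ?u] by simp
  also have "\<dots> = (\<Prod>i\<in>{t}. \<integral>\<^sup>+z. ?u i z \<partial>(M \<Otimes>\<^sub>M q))"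
    using assms(1) by (intro prod.mono_neutral_right) (auto simp: r_total)
  finally show ?thesis by simp
qed

lemma nn_integral_block_density_total: "(\<integral>\<^sup>+x. \<integral>\<^sup>+c. ennreal (\<rho> n x c) \<partial>iid n q \<partial>iid n M) = 1"
  using nn_integral_iid_prod[OF prob_space_M prob_space_q, of n "\<lambda>_ z. ennreal (case_prod r z)"]
  by (simp add: block_density_def prod_ennreal r_nonneg r_total)

lemma nn_integral_block_density_powr:
  "(\<integral>\<^sup>+x. \<integral>\<^sup>+c. ennreal (\<rho> n x c powr a) \<partial>iid n q \<partial>iid n M)
      = (\<integral>\<^sup>+z. ennreal (case_prod r z powr a) \<partial>(M \<Otimes>\<^sub>M q)) ^ n"
  using nn_integral_iid_prod[OF prob_space_M prob_space_q, of n
    "\<lambda>_ z. ennreal (case_prod r z powr a)"]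
  by (simp add: block_density_def prod_ennreal prod_powr_distrib r_nonneg)

lemma nn_integral_block_density_le_1:
  assumes "x \<in> space (iid n M)"
  shows "(\<integral>\<^sup>+c. ennreal (\<rho> n x c) \<partial>iid n q) \<le> 1"
proof -
  have x: "x t \<in> space M" if "t < n" for t using assms that by (auto simp: space_PiM)
  have "(\<lambda>y. ennreal (r (x t) y)) \<in> borel_measurable q" if "t < n" for t
    using measurable_compose[OF measurable_Pair1'[OF x[OF that]] measurable_r] by simp
  then have "(\<integral>\<^sup>+c. ennreal (\<rho> n x c) \<partial>iid n q) = (\<Prod>t<n. \<integral>\<^sup>+y. ennreal (r (x t) y) \<partial>q)"
    using qn.product_nn_integral_prod[of "{..<n}" "\<lambda>t y. ennreal (r (x t) y)"]
    by (simp add: block_density_def prod_ennreal r_nonneg)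
  also have "\<dots> \<le> 1" using x r_sub by (intro prod_le_1) auto
  finally show ?thesis .
qed

lemma rejection_sampler_block:
  assumes "0 < L" "0 \<le> \<eta>" "\<eta> < 1"
  shows "rejection_sampler (iid n M) (iid n q) (\<rho> n) L \<eta> (y0_block n)"
  using assms measurable_block_density block_density_nonneg y0 Mn.P.prob_space_axioms
    qn.P.prob_space_axioms
  by unfold_locales (auto simp: space_PiM)

definition atypical_exponent :: "real \<Rightarrow> real \<Rightarrow> bool" where
  "atypical_exponent a b \<longleftrightarrow> 0 < b \<and> (\<forall>n>0. emeasure (iid n M)
     {x \<in> space (iid n M). \<not> typical (iid n q) (\<rho> n) (exp (n * a)) (exp (- (n * b))) x}
         \<le> ennreal (exp (- (n * b))))"

lemma ex_atypical_exponent: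
  assumes \<delta>: "0 < \<delta>"
  obtains b where "atypical_exponent (I * ln 2 + \<delta>) b"
proof -
  obtain s where s: "0 < s"
    and moment: "(\<integral>\<^sup>+z. ennreal (case_prod r z powr (1 + s)) \<partial>(M \<Otimes>\<^sub>M q))
      \<le> ennreal (exp (s * (I * ln 2 + \<delta> / 2)))"
    using M_q.ex_powr_moment_le_exp[OF measurable_r, of B I "\<delta> / 2"] r_nonneg r_le r_total info \<delta>
    by (auto simp: case_prod_beta')
  define b where "b = s * \<delta> / 4"
  have b: "0 < b" using s \<delta> by (simp add: b_def)
  have "emeasure (iid n M) {x
      \<in> space (iid n M). \<not> typical (iid n q) (\<rho> n) (exp (n * (I * ln 2 + \<delta>))) (exp (- (n * b))) x}
      \<le> ennreal (exp (- (n * b)))" if n: "0 < n" for n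
  proof -
    define L where "L = exp (n * (I * ln 2 + \<delta>))"
    define \<eta> where "\<eta> = exp (- (n * b))"
    have \<eta>: "0 < \<eta>" "\<eta> < 1" using n b by (auto simp: \<eta>_def)
    interpret S: rejection_sampler "iid n M" "iid n q" "\<rho> n" L \<eta> 0 "y0_block n"
      using \<eta> by (intro rejection_sampler_block) (auto simp: L_def)
    have "emeasure (iid n M) {x \<in> space (iid n M). \<not> S.good x} \<le>
        ennreal (1 / \<eta> * L powr (- s))
            * (\<integral>\<^sup>+z. ennreal (case_prod r z powr (1 + s)) \<partial>(M \<Otimes>\<^sub>M q)) ^ n"
      using S.emeasure_not_good_le[OF \<eta>(1) s nn_integral_block_density_le_1
        nn_integral_block_density_total]
      by (simp add: nn_integral_block_density_powr)
    also have "\<dots> \<le> ennreal (1 / \<eta> * L powr (- s)) * ennreal (exp (s * (I * ln 2 + \<delta> / 2))) ^ n"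
      by (intro mult_left_mono power_mono moment) auto
    also have "\<dots> = ennreal (1 / \<eta> * L powr (- s) * exp (s * (I * ln 2 + \<delta> / 2)) ^ n)"
    proof -
      have "0 \<le> 1 / \<eta> * L powr (- s)" using \<eta> by simp
      then show ?thesis by (simp only: ennreal_mult ennreal_power exp_ge_zero zero_le_power)
    qed
    also have "1 / \<eta> * L powr (- s) * exp (s * (I * ln 2 + \<delta> / 2)) ^ n = \<eta>"
    proof -
      have "1 / \<eta> = exp (n * b)" by (simp add: \<eta>_def exp_minus inverse_eq_divide)
      moreover have "L powr (- s) = exp (- (s * (n * (I * ln 2 + \<delta>))))"
        by (simp add: L_def powr_def)
      moreover have "exp (s * (I * ln 2 + \<delta> / 2)) ^ n = exp (n * (s * (I * ln 2 + \<delta> / 2)))"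
        by (simp add: exp_of_nat_mult)
      moreover have "n * b + - (s * (n * (I * ln 2 + \<delta>))) + n * (s * (I * ln 2 + \<delta> / 2))
          = - (n * b)"
        by (simp add: b_def algebra_simps)
      ultimately show ?thesis unfolding \<eta>_def by (simp only: exp_add[symmetric])
    qed
    finally show ?thesis unfolding L_def \<eta>_def .
  qed
  then show thesis using b by (intro that[of b]) (auto simp: atypical_exponent_def)
qed

definition block_bound :: "real \<Rightarrow> real \<Rightarrow> nat \<Rightarrow> ((nat \<Rightarrow> 'a) \<times> (nat \<Rightarrow> 'b) \<Rightarrow> ennreal) \<Rightarrow> ennreal" where
  "block_bound a b n = rejection_bound (iid n M) (iid n q) (\<rho> n)
     (exp (n * a)) (exp (- (n * b))) (nat \<lceil>n * exp (n * a)\<rceil>) (y0_block n)"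

lemma block_bound_coord_le:
  fixes h :: "'a \<times> 'b \<Rightarrow> ennreal"
  assumes t: "t < n" and ab: "atypical_exponent a b"
    and h[measurable]: "h \<in> borel_measurable (M \<Otimes>\<^sub>M q)"
    and \<tau>: "(\<integral>\<^sup>+x. (if h (x, y0) \<le> ennreal \<tau> then 0 else h (x, y0)) \<partial>M) \<le> \<epsilon>"
  shows "block_bound a b n (\<lambda>(x, c). h (x t, c t)) \<le>
    ennreal (1 / (1 - exp (- (n * b)))) * (\<integral>\<^sup>+z. ennreal (case_prod r z) * h z \<partial>(M \<Otimes>\<^sub>M q))
    + ennreal (exp (- ((1 - exp (- (n * b))) * n))) * (\<integral>\<^sup>+x. h (x, y0) \<partial>M)
        + (\<epsilon> + ennreal \<tau> * ennreal (exp (- (n * b))))"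
proof -
  define \<eta> where "\<eta> = exp (- (n * b))"
  let ?good = "typical (iid n q) (\<rho> n) (exp (n * a)) \<eta>"
  have \<eta>: "0 < \<eta>" "\<eta> < 1"
    and atypical: "emeasure (iid n M) {x \<in> space (iid n M). \<not> ?good x} \<le> ennreal \<eta>"
    using t ab by (auto simp: \<eta>_def atypical_exponent_def)
  interpret S: rejection_sampler "iid n M" "iid n q" "\<rho> n" "exp (n * a)" \<eta> 0 "y0_block n"
    using \<eta> by (intro rejection_sampler_block) auto
  have hy[measurable]: "(\<lambda>x. h (x, y0)) \<in> borel_measurable M"
    by (rule measurable_compose[OF measurable_Pair2'[OF y0] h])
  let ?tail = "\<lambda>x. if h (x, y0) \<le> ennreal \<tau> then 0 else h (x, y0)"
  have tail[measurable]: "(\<lambda>x. ?tail (x t)) \<in> borel_measurable (iid n M)"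
    using t by (intro measurable_compose[OF measurable_component_singleton[of t "{..<n}"
      "\<lambda>_. M"]]) auto
  have "(\<integral>\<^sup>+x. (if ?good x then 0 else h (x t, y0)) \<partial>iid n M)
      \<le> (\<integral>\<^sup>+x. ?tail (x t) + ennreal \<tau> * indicator {x \<in> space (iid n M). \<not> ?good x} x \<partial>iid n M)"
    by (rule nn_integral_mono) auto
  also have "\<dots> = (\<integral>\<^sup>+x. ?tail (x t) \<partial>iid n M)
      + ennreal \<tau> * emeasure (iid n M) {x \<in> space (iid n M). \<not> ?good x}"
    by (simp add: nn_integral_add nn_integral_cmult)
  also have "\<dots> \<le> \<epsilon> + ennreal \<tau> * ennreal \<eta>"
    using \<tau> atypical t nn_integral_iid_coord[OF prob_space_M t, of ?tail]
    by (intro add_mono mult_left_mono) auto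
  finally have atyp: "(\<integral>\<^sup>+x. (if ?good x then 0 else h (x t, y0)) \<partial>iid n M)
      \<le> \<epsilon> + ennreal \<tau> * ennreal \<eta>" .
  have "real n \<le> nat \<lceil>n * exp (n * a)\<rceil> / exp (n * a)"
    using of_nat_ceiling[of "n * exp (n * a)"] by (simp add: pos_le_divide_eq)
  from mult_left_mono[OF this, of "1 - \<eta>"] \<eta>
  have rejected: "exp (- ((1 - \<eta>) / exp (n * a) * nat \<lceil>n * exp (n * a)\<rceil>)) \<le> exp (- ((1 - \<eta>) * n))"
    by simp
  have "block_bound a b n (\<lambda>(x, c). h (x t, c t)) =
      ennreal (1 / (1 - \<eta>)) * (\<integral>\<^sup>+z. ennreal (case_prod r z) * h z \<partial>(M \<Otimes>\<^sub>M q))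
      + ennreal (exp (- ((1 - \<eta>) / exp (n * a) * nat \<lceil>n * exp (n * a)\<rceil>))) * (\<integral>\<^sup>+x. h (x, y0) \<partial>M)
      + (\<integral>\<^sup>+x. (if ?good x then 0 else h (x t, y0)) \<partial>iid n M)"
    unfolding block_bound_def rejection_bound_def \<eta>_def[symmetric]
    using t nn_integral_iid_coord[OF prob_space_M t hy] nn_integral_block_density_mult[OF t h]
    by (simp cong: if_cong)
  also have "\<dots> \<le> ennreal (1 / (1 - \<eta>)) * (\<integral>\<^sup>+z. ennreal (case_prod r z) * h z \<partial>(M \<Otimes>\<^sub>M q))
      + ennreal (exp (- ((1 - \<eta>) * n))) * (\<integral>\<^sup>+x. h (x, y0) \<partial>M) + (\<epsilon> + ennreal \<tau> * ennreal \<eta>)"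
    using rejected atyp by (intro add_mono mult_right_mono ennreal_leI) auto
  finally show ?thesis unfolding \<eta>_def .
qed

proposition eventually_block_bound_coord_le:
  fixes h :: "'a \<times> 'b \<Rightarrow> ennreal"
  assumes ab: "atypical_exponent a b"
    and h[measurable]: "h \<in> borel_measurable (M \<Otimes>\<^sub>M q)"
    and mean: "(\<integral>\<^sup>+z. ennreal (case_prod r z) * h z \<partial>(M \<Otimes>\<^sub>M q)) \<le> ennreal j" and j: "0 \<le> j" "j < j'"
    and default_fin: "(\<integral>\<^sup>+x. h (x, y0) \<partial>M) < \<infinity>"
  shows "\<forall>\<^sub>F n in sequentially. \<forall>t<n. block_bound a b n (\<lambda>(x, c). h (x t, c t)) \<le> ennreal j'"
proof -
  have b: "0 < b" using ab by (simp add: atypical_exponent_def)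
  define \<epsilon> where "\<epsilon> = (j' - j) / 2"
  have \<epsilon>: "0 < \<epsilon>" using j by (simp add: \<epsilon>_def)
  obtain \<kappa> where \<kappa>: "0 \<le> \<kappa>" "(\<integral>\<^sup>+x. h (x, y0) \<partial>M) = ennreal \<kappa>"
    using default_fin by (cases "\<integral>\<^sup>+x. h (x, y0) \<partial>M") auto
  have "(\<lambda>x. h (x, y0)) \<in> borel_measurable M"
    by (rule measurable_compose[OF measurable_Pair2'[OF y0] h])
  then obtain \<tau>
    where \<tau>: "0 \<le> \<tau>" "(\<integral>\<^sup>+x. (if h (x, y0) \<le> ennreal \<tau> then 0 else h (x, y0)) \<partial>M) \<le> ennreal \<epsilon>"
    using ex_tail_nn_integral_le[OF _ default_fin \<epsilon>] by blast
  let ?f = "\<lambda>n. 1 / (1 - exp (- (real n * b))) * j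
      + exp (- ((1 - exp (- (real n * b))) * real n)) * \<kappa> + (\<epsilon> + \<tau> * exp (- (real n * b)))"
  have "?f \<longlonglongrightarrow> j + \<epsilon>" using b by real_asymp
  moreover have "j + \<epsilon> < j'" using j by (simp add: \<epsilon>_def field_simps)
  ultimately have "\<forall>\<^sub>F n in sequentially. ?f n < j'" by (rule order_tendstoD(2))
  then show ?thesis
  proof eventually_elim
    fix n assume lt: "?f n < j'"
    show "\<forall>t<n. block_bound a b n (\<lambda>(x, c). h (x t, c t)) \<le> ennreal j'"
    proof (intro allI impI)
      fix t assume t: "t < n"
      then have \<eta>: "exp (- (real n * b)) < 1" using b by simp
      have "block_bound a b n (\<lambda>(x, c). h (x t, c t))
          \<le> ennreal (1 / (1 - exp (- (n * b)))) * (\<integral>\<^sup>+z. ennreal (case_prod r z) * h z \<partial>(M \<Otimes>\<^sub>M q))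
          + ennreal (exp (- ((1 - exp (- (n * b))) * n))) * (\<integral>\<^sup>+x. h (x, y0) \<partial>M)
              + (ennreal \<epsilon> + ennreal \<tau> * ennreal (exp (- (n * b))))"
        using t by (intro block_bound_coord_le ab h \<tau>(2))
      also have "\<dots> \<le> ennreal (1 / (1 - exp (- (n * b)))) * ennreal j
          + ennreal (exp (- ((1 - exp (- (n * b))) * n))) * ennreal \<kappa>
              + (ennreal \<epsilon> + ennreal \<tau> * ennreal (exp (- (n * b))))"
        unfolding \<kappa>(2) by (intro add_mono mult_left_mono mean order_refl) simp
      also have "\<dots> = ennreal (?f n)"
      proof -
        have "0 \<le> 1 / (1 - exp (- (real n * b)))" using \<eta> by simp
        then show ?thesis
          using j(1) \<kappa>(1) \<tau>(1) \<epsilon>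
          by (simp only: ennreal_mult ennreal_plus exp_ge_zero mult_nonneg_nonneg add_nonneg_nonneg
            less_imp_le)
      qed
      also have "\<dots> \<le> ennreal j'" using lt by (intro ennreal_leI) simp
      finally show "block_bound a b n (\<lambda>(x, c). h (x t, c t)) \<le> ennreal j'" .
    qed
  qed
qed

end

section \<open>Deterministic block codes\<close>

lemma entropy_disc_le_log_card:
  fixes f :: "'b \<Rightarrow> nat"
  assumes "prob_space N" and f: "f \<in> N \<rightarrow>\<^sub>M count_space UNIV" and fin: "finite (f ` space N)"
  shows "entropy_disc N f \<le> ennreal (log 2 (card (f ` space N)))"
proof -
  interpret N: prob_space N by fact
  interpret information_space N 2 by standard simp
  define p where "p z = measure N (f -` {z} \<inter> space N)" for z
  have "simple_function N f"
    using fin measurable_sets[OF f] by (auto simp: simple_function_def)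
  then have dist: "simple_distributed N f p"
    by (rule N.simple_distributedI) (auto simp: p_def)
  have "0 \<le> p z" "p z \<le> 1" for z by (auto simp: p_def)
  then have nonneg: "0 \<le> - (p z * log 2 (p z))" for z
    by (cases "p z = 0") (auto simp: mult_nonneg_nonpos less_le)
  have "f -` {z} \<inter> space N = {}" if "z \<notin> f ` space N" for z using that by auto
  then have "entropy_disc N f = (\<Sum>z\<in>f ` space N. ennreal (- (p z * log 2 (p z))))"
    unfolding entropy_disc_def p_def[symmetric] by (intro suminf_finite fin) (simp add: p_def)
  also have "\<dots> = ennreal (N.entropy 2 (count_space (f ` space N)) f)"
    using nonneg by (simp add: entropy_simple_distributed[OF dist] sum_negf)
  also have "\<dots> \<le> ennreal (log 2 (card (f ` space N)))"
    by (intro ennreal_leI entropy_le_card[OF dist])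
  finally show ?thesis .
qed

definition pattern :: "'a set \<Rightarrow> nat \<Rightarrow> (nat \<Rightarrow> 'a) \<Rightarrow> nat set" where
  "pattern E k x = {i. i < k \<and> x i \<in> E}"

lemma pattern_eq_Collect:
  assumes "k \<le> n" "b \<subseteq> {..<k}"
  shows "{x \<in> space (iid n M). pattern E k x = b} =
    {x \<in> space (iid n M). \<forall>i\<in>{..<k}. x i \<in> (if i \<in> b then E else space M - E)}"
proof -
  have "x i \<in> space M" if "x \<in> space (iid n M)" "i < k" for x i
    using that assms(1) by (auto simp: space_PiM PiE_iff)
  then show ?thesis using assms(2) by (auto simp: pattern_def)
qed

lemma measurable_pattern:
  assumes "E \<in> sets M" "k \<le> n"
  shows "pattern E k \<in> iid n M \<rightarrow>\<^sub>M count_space (Pow {..<k})"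
proof (subst measurable_count_space_eq2)
  have "{x \<in> space (iid n M). pattern E k x = b} \<in> sets (iid n M)" if "b \<subseteq> {..<k}" for b
    unfolding pattern_eq_Collect[OF assms(2) that]
  proof (rule sets.sets_Collect_finite_All)
    fix i assume "i \<in> {..<k}"
    then have "(\<lambda>x. x i) \<in> iid n M \<rightarrow>\<^sub>M M" using assms(2)
      by (intro measurable_component_singleton) auto
    then have "(\<lambda>x. x i) -` (if i \<in> b then E else space M - E) \<inter> space (iid n M) \<in> sets (iid n M)"
      using assms(1) by (intro measurable_sets) auto
    then show "{x \<in> space (iid n M). x i \<in> (if i \<in> b then E else space M - E)} \<in> sets (iid n M)"
      by (rule back_subst[of "\<lambda>A. A \<in> sets (iid n M)"]) auto
  qed simp
  moreover have "pattern E k -` {b} \<inter> space (iid n M) = {x \<in> space (iid n M). pattern E k x = b}"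
    for b by auto
  ultimately show "pattern E k \<in> space (iid n M) \<rightarrow> Pow {..<k} \<and>
      (\<forall>b\<in>Pow {..<k}. pattern E k -` {b} \<inter> space (iid n M) \<in> sets (iid n M))"
    by (auto simp: pattern_def)
qed simp

lemma prob_pattern_le:
  assumes "prob_space M" and E: "E \<in> sets M" and k: "k \<le> n"
    and p: "measure M E \<le> p" "1 - measure M E \<le> p"
    and b: "b \<in> Pow {..<k}"
  shows "measure (iid n M) {x \<in> space (iid n M). pattern E k x = b} \<le> p ^ k"
proof -
  interpret M: prob_space M by fact
  interpret product_prob_space "\<lambda>_. M" "{..<n}" ..
  let ?A = "\<lambda>i. if i \<in> b then E else space M - E"
  have p_nonneg: "0 \<le> p" using p(1) by (rule order_trans[rotated]) simp
  have "emeasure (iid n M) {x \<in> space (iid n M). pattern E k x = b} = (\<Prod>i<k. emeasure M (?A i))"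
    using E k b emeasure_PiM_Collect[of "{..<k}" ?A] by (simp add: pattern_eq_Collect)
  also have "\<dots> \<le> (\<Prod>i<k. ennreal p)"
    using p E
    by (intro prod_mono_ennreal) (auto simp: M.emeasure_eq_measure M.prob_compl intro!: ennreal_leI)
  finally have "emeasure (iid n M) {x \<in> space (iid n M). pattern E k x = b} \<le> ennreal (p ^ k)"
    using p_nonneg by (simp add: ennreal_power)
  then show ?thesis
    using p_nonneg by (simp add: P.emeasure_eq_measure)
qed

lemma measure_Collect_eq_integral_indicator:
  "measure M {x \<in> space M. f x \<in> A} = (\<integral>x. indicator A (f x) \<partial>M)"
proof -
  have "measure M {x \<in> space M. f x \<in> A} = (\<integral>x. indicator {x \<in> space M. f x \<in> A} x \<partial>M)"
    by (simp add: Int_absorb2)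
  also have "\<dots> = (\<integral>x. indicator A (f x) \<partial>M)"
    by (intro Bochner_Integration.integral_cong) (auto split: split_indicator)
  finally show ?thesis .
qed

context memoryless_density
begin

lemma mean_out_le_block_bound:
  assumes "0 < n" "0 < b" "f \<in> borel_measurable (iid n M \<Otimes>\<^sub>M iid n q)"
  shows "rejection_sampler.mean_out (iid n M) (iid n q) (\<rho> n)
    (exp (n * a)) (exp (- (n * b))) (nat \<lceil>n * exp (n * a)\<rceil>) (y0_block n) f \<le> block_bound a b n f"
  unfolding block_bound_def using assms
  by (intro rejection_sampler.mean_out_le_bound rejection_sampler_block) auto

lemma borel_measurable_coord_indicator:
  assumes "t < n" and [measurable]: "A \<in> sets q"
  shows "(\<lambda>z. indicator A (snd z t) :: real) \<in> borel_measurable (iid n M \<Otimes>\<^sub>M iid n q)"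
proof -
  have "(\<lambda>z. indicator A (snd z) :: real) \<in> borel_measurable (M \<Otimes>\<^sub>M q)" by measurable
  from measurable_compose[OF measurable_coord_pair[OF assms(1)] this] show ?thesis by simp
qed

lemma ex_block_code:
  fixes A :: "'s \<Rightarrow> 'b set" and F :: "'a \<times> 'b \<Rightarrow> ennreal" and a b T v p :: real
  assumes n: "0 < n" and b: "0 < b" and E: "E \<in> sets M" and k: "k \<le> n"
    and p: "measure M E \<le> p" "1 - measure M E \<le> p"
    and S: "finite S" and A: "\<And>s. s \<in> S \<Longrightarrow> A s \<in> sets q"
    and u: "\<And>t s. t < n \<Longrightarrow> s \<in> S \<Longrightarrow> block_bound a b n (\<lambda>(x, c). indicator (A s) (c t))
        \<le> ennreal (u s)"
      "\<And>s. s \<in> S \<Longrightarrow> 0 \<le> u s"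
    and F[measurable]: "F \<in> borel_measurable (M \<Otimes>\<^sub>M q)"
    and v: "\<And>t. t < n \<Longrightarrow> block_bound a b n (\<lambda>(x, c). F (x t, c t)) \<le> ennreal v" "0 \<le> v"
    and T: "0 < T"
  obtains enc :: "(nat \<Rightarrow> 'a) \<Rightarrow> nat" and dec
    where "enc \<in> iid n M \<rightarrow>\<^sub>M count_space UNIV" "\<And>z. dec z \<in> space (iid n q)"
    "finite (enc ` space (iid n M))"
      "card (enc ` space (iid n M)) \<le> 2 ^ k * (nat \<lceil>n * exp (n * a)\<rceil> + 1)"
    "\<And>t s. t < n \<Longrightarrow> s \<in> S \<Longrightarrow>
      measure (iid n M) {x \<in> space (iid n M). dec (enc x) t \<in> A s}
          \<le> u s + sqrt (n * card S * p ^ k + T * v)"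
    "(\<Sum>t<n. \<integral>\<^sup>+x. F (x t, dec (enc x) t) \<partial>iid n M) \<le> ennreal (n * (n * card S * p ^ k / T + v))"
proof -
  have p_nonneg: "0 \<le> p" using p(1) by (rule order_trans[rotated]) simp
  let ?N = "nat \<lceil>n * exp (n * a)\<rceil>"
  interpret S: rejection_sampler "iid n M" "iid n q" "\<rho> n" "exp (n * a)"
    "exp (- (n * b))" ?N "y0_block n"
    using n b by (intro rejection_sampler_block) auto
  note bound = mean_out_le_block_bound[OF n b, where a = a]
  define h where "h i z = (indicator (A (snd i)) (snd z (fst i)) :: real)" for i :: "nat \<times> 's"
    and z :: "(nat \<Rightarrow> 'a) \<times> (nat \<Rightarrow> 'b)"
  define cost where "cost t z = F (fst z t, snd z t)" for t :: nat
    and z :: "(nat \<Rightarrow> 'a) \<times> (nat \<Rightarrow> 'b)"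
  have h_meas: "h (t, s) \<in> borel_measurable (iid n M \<Otimes>\<^sub>M iid n q)" if "t < n" "s \<in> S" for t s
    using borel_measurable_coord_indicator[OF that(1) A[OF that(2)]] by (simp add: h_def[abs_def])
  have h_mean: "S.mean_out (\<lambda>z. ennreal (h (t, s) z)) \<le> ennreal (u s)" if "t < n" "s \<in> S" for t s
  proof -
    have "(\<lambda>z. ennreal (h (t, s) z)) = (\<lambda>(x, c). indicator (A s) (c t))"
      by (auto simp: h_def ennreal_indicator)
    then show ?thesis
      using bound[OF measurable_compose[OF h_meas[OF that] measurable_ennreal]] u(1)[OF that]
      by simp
  qed
  have cost_meas: "cost t \<in> borel_measurable (iid n M \<Otimes>\<^sub>M iid n q)" if "t < n" for t
    using measurable_compose[OF measurable_coord_pair[OF that] F] by (simp add: cost_def[abs_def])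
  have cost_mean: "S.mean_out (cost t) \<le> ennreal v" if "t < n" for t
    using bound[OF cost_meas[OF that]] v(1)[OF that]
    by (simp add: cost_def[abs_def] case_prod_beta')
  show thesis
  proof (rule S.ex_code_sum[where label = "pattern E k" and I = "{..<n} \<times> S" and h = h
        and u = "\<lambda>i. u (snd i)" and p = "p ^ k" and J = "{..<n}" and F = cost and v = v and T = T])
    fix enc :: "(nat \<Rightarrow> 'a) \<Rightarrow> nat" and dec
    assume code: "enc \<in> iid n M \<rightarrow>\<^sub>M count_space UNIV" "\<And>z. dec z \<in> space (iid n q)"
      "finite (enc ` space (iid n M))"
      and card_le: "card (enc ` space (iid n M)) \<le> card (Pow {..<k}) * (?N + 1)"
      and h_le: "\<And>i. i \<in> {..<n} \<times> S \<Longrightarrow>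
        (\<integral>x. h i (x, dec (enc x)) \<partial>iid n M) \<le> u (snd i) + sqrt (card ({..<n} \<times> S) * p ^ k + T * v)"
      and cost_le: "(\<Sum>t<n. \<integral>\<^sup>+x. cost t (x, dec (enc x)) \<partial>iid n M)
        \<le> ennreal (card {..<n} * (card ({..<n} \<times> S) * p ^ k / T + v))"
    have "measure (iid n M) {x \<in> space (iid n M). dec (enc x) t \<in> A s}
        \<le> u s + sqrt (n * card S * p ^ k + T * v)"
      if "t < n" "s \<in> S" for t s
      using h_le[of "(t, s)"] that
      by (simp add: measure_Collect_eq_integral_indicator h_def card_cartesian_product)
    then show thesis
      using code card_le cost_le
      by (intro that[of enc dec]) (simp_all add: card_Pow cost_def card_cartesian_product)
  qed (use measurable_pattern[OF E k] prob_pattern_le[OF prob_space_M E k p] S h_meas h_mean u(2) n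
    cost_meas cost_mean p_nonneg T v(2)
    in \<open>auto simp: h_def\<close>)
qed

end

section \<open>Measures with finite support\<close>

lemma sum_measure_singletons:
  assumes "prob_meas \<nu>" "finite S" "emeasure \<nu> S = 1"
  shows "(\<Sum>s\<in>S. measure \<nu> {s}) = 1"
proof -
  interpret prob_space \<nu> by (rule prob_measD[OF assms(1)])
  have "measure \<nu> S = (\<Sum>s\<in>S. measure \<nu> {s})"
    using assms(2) by (intro finite_measure_eq_sum_singleton) (auto simp: prob_measD[OF assms(1)])
  then show ?thesis using assms(3) by (simp add: measure_def)
qed

lemma finite_mixture_atoms:
  assumes \<nu>: "prob_meas \<nu>" and S: "finite S" "emeasure \<nu> S = 1"
  shows "finite_mixture S (\<lambda>s. measure \<nu> {s}) (return borel) \<nu>"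
proof -
  interpret prob_space \<nu> by (rule prob_measD[OF \<nu>])
  have AE_S: "AE y in \<nu>. y \<in> S"
    using \<nu> S by (simp add: AE_mem_iff_emeasure_eq_1 finite_imp_borel)
  have "emeasure \<nu> A = (\<Sum>s\<in>S. ennreal (measure \<nu> {s}) * emeasure (return borel s) A)"
    if A: "A \<in> sets borel" for A
  proof -
    have "emeasure \<nu> A = (\<integral>\<^sup>+y. indicator A y \<partial>\<nu>)" using A by (simp add: prob_measD[OF \<nu>])
    also have "\<dots> = (\<integral>\<^sup>+s. indicator A s * emeasure \<nu> {s} \<partial>count_space S)"
      using \<nu> S A AE_S
      by (intro nn_integral_countable_support) (auto simp: prob_measD countable_finite)
    also have "\<dots> = (\<Sum>s\<in>S. indicator A s * emeasure \<nu> {s})"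
      using S by (simp add: nn_integral_count_space_finite)
    also have "\<dots> = (\<Sum>s\<in>S. ennreal (measure \<nu> {s}) * emeasure (return borel s) A)"
      using A by (simp add: emeasure_eq_measure mult.commute)
    finally show ?thesis .
  qed
  then show ?thesis using \<nu> by (simp add: finite_mixture_def)
qed

lemma mix_convex_le_of_atoms_ge:
  assumes \<phi>: "mix_convex \<phi>" and q: "prob_meas q" "emeasure q S = 1"
    and \<gamma>: "prob_meas \<gamma>" "emeasure \<gamma> S = 1"
    and S: "finite S" and l: "0 < l" "l \<le> 1"
    and c: "\<And>s. s \<in> S \<Longrightarrow> \<phi> (return borel s) \<le> c"
    and ge: "\<And>s. s \<in> S \<Longrightarrow> (1 - l) * measure q {s} \<le> measure \<gamma> {s}"
  shows "\<phi> \<gamma> \<le> ennreal (1 - l) * \<phi> q + ennreal l * c"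
proof -
  define w where "w s = (measure \<gamma> {s} - (1 - l) * measure q {s}) / l" for s
  have w: "0 \<le> w s" if "s \<in> S" for s using ge[OF that] l by (simp add: w_def)
  have w_sum: "sum w S = 1"
    unfolding w_def sum_divide_distrib[symmetric] sum_subtractf sum_distrib_left[symmetric]
    using l by (simp add: sum_measure_singletons \<gamma> q S)
  obtain \<nu> where \<nu>: "finite_mixture S w (return borel) \<nu>"
    and \<phi>_\<nu>: "\<phi> \<nu> \<le> (\<Sum>s\<in>S. ennreal (w s) * \<phi> (return borel s))"
    by (rule mix_convex_ex_finite_mixture[OF \<phi> S, of "return borel" w])
      (auto simp: prob_meas_return w w_sum)
  have pm_\<nu>: "prob_meas \<nu>" using \<nu> by (simp add: finite_mixture_def)
  have "emeasure (mix (1 - l) q \<nu>) A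
      = (\<Sum>s\<in>S. ennreal (measure \<gamma> {s}) * emeasure (return borel s) A)"
    if A: "A \<in> sets borel" for A
  proof -
    have "emeasure (mix (1 - l) q \<nu>) A
        = (\<Sum>s\<in>S. (ennreal (1 - l) * ennreal (measure q {s}) + ennreal l * ennreal (w s))
        * emeasure (return borel s) A)"
      using finite_mixture_atoms[OF q(1) S q(2)] \<nu> A
      unfolding emeasure_mix[OF q(1) pm_\<nu> A] finite_mixture_def distrib_right sum.distrib mult.assoc
      by (simp add: sum_distrib_left del: emeasure_return)
    also have "\<dots> = (\<Sum>s\<in>S. ennreal (measure \<gamma> {s}) * emeasure (return borel s) A)"
    proof (rule sum.cong)
      fix s assume "s \<in> S"
      have "ennreal (1 - l) * ennreal (measure q {s}) + ennreal l * ennreal (w s)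
          = ennreal ((1 - l) * measure q {s} + l * w s)"
        using w[OF \<open>s \<in> S\<close>] l by (simp add: ennreal_mult)
      also have "(1 - l) * measure q {s} + l * w s = measure \<gamma> {s}" using l by (simp add: w_def)
      finally show "(ennreal (1 - l) * ennreal (measure q {s}) + ennreal l * ennreal (w s))
          * emeasure (return borel s) A =
        ennreal (measure \<gamma> {s}) * emeasure (return borel s) A" by simp
    qed simp
    finally show ?thesis .
  qed
  then have "finite_mixture S (\<lambda>s. measure \<gamma> {s}) (return borel) (mix (1 - l) q \<nu>)"
    using l by (auto simp: finite_mixture_def intro!: prob_meas_mix q(1) pm_\<nu>)
  from finite_mixture_unique[OF finite_mixture_atoms[OF \<gamma>(1) S \<gamma>(2)] this]
  have "\<phi> \<gamma> \<le> ennreal (1 - l) * \<phi> q + ennreal l * \<phi> \<nu>"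
    using mix_convexD[OF \<phi> q(1) pm_\<nu>, of "1 - l"] l by simp
  also have "\<dots> \<le> ennreal (1 - l) * \<phi> q + ennreal l * c"
    using order_trans[OF \<phi>_\<nu> weighted_sum_le_ennreal[OF w w_sum c]]
    by (intro add_left_mono mult_left_mono) auto
  finally show ?thesis .
qed

lemma measure_singleton_ge_of_upper_bounds:
  fixes \<zeta> :: real
  assumes q: "prob_meas q" "emeasure q S = 1" and \<gamma>: "prob_meas \<gamma>" "emeasure \<gamma> S = 1"
    and S: "finite S" "s \<in> S" and \<zeta>: "0 \<le> \<zeta>" and le: "\<And>s. s \<in> S \<Longrightarrow> measure \<gamma> {s} \<le> measure q {s} + \<zeta>"
  shows "measure q {s} - card S * \<zeta> \<le> measure \<gamma> {s}"
proof -
  have "(\<Sum>x\<in>S - {s}. measure \<gamma> {x}) \<le> (\<Sum>x\<in>S - {s}. measure q {x} + \<zeta>)"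
    by (intro sum_mono le) auto
  also have "\<dots> = (\<Sum>x\<in>S - {s}. measure q {x}) + card (S - {s}) * \<zeta>" by (simp add: sum.distrib)
  also have "\<dots> \<le> (\<Sum>x\<in>S - {s}. measure q {x}) + card S * \<zeta>"
    using S \<zeta> by (intro add_left_mono mult_right_mono) (auto intro: card_mono)
  finally show ?thesis
    using sum_measure_singletons[OF \<gamma>(1) S(1) \<gamma>(2)] sum_measure_singletons[OF q(1) S(1) q(2)] S
    by (simp add: sum_diff1)
qed

lemma mix_convex_upper_neighborhood:
  assumes \<phi>: "mix_convex \<phi>" and q: "prob_meas q" "emeasure q S = 1"
    and S: "finite S" "\<And>s. s \<in> S \<Longrightarrow> 0 < measure q {s}" and fin: "\<And>s. s \<in> S \<Longrightarrow> \<phi> (return borel s) < \<infinity>"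
    and P: "\<phi> q < ennreal P"
  obtains \<zeta> where "0 < \<zeta>" "\<And>\<gamma>. prob_meas \<gamma> \<Longrightarrow> emeasure \<gamma> S = 1 \<Longrightarrow>
    (\<And>s. s \<in> S \<Longrightarrow> measure \<gamma> {s} \<le> measure q {s} + \<zeta>) \<Longrightarrow> \<phi> \<gamma> \<le> ennreal P"
proof -
  obtain P' where P': "0 \<le> P'" "\<phi> q = ennreal P'" "P' < P"
    using P by (cases "\<phi> q") (auto simp: ennreal_less_iff)
  have "(\<Sum>s\<in>S. \<phi> (return borel s)) < \<infinity>" using fin S(1) by simp
  then obtain c where c: "0 \<le> c" "(\<Sum>s\<in>S. \<phi> (return borel s)) = ennreal c"
    by (cases "\<Sum>s\<in>S. \<phi> (return borel s)") auto
  define l where "l = min 1 ((P - P') / (c + 1))"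
  have l: "0 < l" "l \<le> 1" using P' c by (auto simp: l_def)
  have "l * c \<le> (P - P') / (c + 1) * (c + 1)" using P' c by (intro mult_mono) (auto simp: l_def)
  then have slack: "P' + l * c \<le> P" using c by simp
  have S_ne: "S \<noteq> {}" using q(2) by auto
  then have card_pos: "0 < card S" using S by (simp add: card_gt_0_iff)
  define m where "m = Min ((\<lambda>s. measure q {s}) ` S)"
  have m: "0 < m" "\<And>s. s \<in> S \<Longrightarrow> m \<le> measure q {s}" using S S_ne by (auto simp: m_def)
  show thesis
  proof (rule that)
    show \<zeta>: "0 < l * m / card S" using l m card_pos by simp
    fix \<gamma> assume \<gamma>: "prob_meas \<gamma>" "emeasure \<gamma> S = 1"
      and le: "\<And>s. s \<in> S \<Longrightarrow> measure \<gamma> {s} \<le> measure q {s} + l * m / card S"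
    have "(1 - l) * measure q {s} \<le> measure \<gamma> {s}" if "s \<in> S" for s
    proof -
      have "measure q {s} - l * m \<le> measure \<gamma> {s}"
        using measure_singleton_ge_of_upper_bounds[OF q \<gamma> S(1) that less_imp_le[OF \<zeta>] le] card_pos
        by simp
      moreover have "l * m \<le> l * measure q {s}" using l m(2)[OF that] by simp
      ultimately show ?thesis by (simp add: algebra_simps)
    qed
    moreover have "\<phi> (return borel s) \<le> ennreal c" if "s \<in> S" for s
      unfolding c(2)[symmetric] using S(1) that by (intro member_le_sum) auto
    ultimately have "\<phi> \<gamma> \<le> ennreal (1 - l) * \<phi> q + ennreal l * ennreal c"
      by (intro mix_convex_le_of_atoms_ge[OF \<phi> q \<gamma> S(1) l]) auto
    also have "\<dots> \<le> 1 * ennreal P' + ennreal l * ennreal c"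
      using P' l by (intro add_mono mult_mono) (auto simp: ennreal_le_1)
    also have "\<dots> = ennreal (P' + l * c)" using P' l c by (simp add: ennreal_mult)
    also have "\<dots> \<le> ennreal P" by (rule ennreal_leI[OF slack])
    finally show "\<phi> \<gamma> \<le> ennreal P" .
  qed
qed

section \<open>Achievability\<close>

text \<open>The infinite cost forces outputs into \<open>S\<close> almost surely.\<close>

definition restricted_cost :: "'a set \<Rightarrow> ('a \<Rightarrow> 'a \<Rightarrow> real) \<Rightarrow> 'a \<times> 'a \<Rightarrow> ennreal" where
  "restricted_cost S \<Delta> z = (if snd z \<in> S then ennreal (case_prod \<Delta> z) else \<infinity>)"

lemma measurable_restricted_cost:
  assumes "finite S" and [measurable]: "case_prod \<Delta> \<in> borel_measurable (borel \<Otimes>\<^sub>M borel)"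
  shows "restricted_cost S \<Delta> \<in> borel_measurable (borel \<Otimes>\<^sub>M (borel :: 'a::polish_space measure))"
proof -
  have [measurable]: "S \<in> sets borel" using assms(1) by (rule finite_imp_borel)
  show ?thesis unfolding restricted_cost_def[abs_def] by measurable
qed

lemma nr_code_of_finite_code:
  fixes enc :: "(nat \<Rightarrow> 'a::polish_space) \<Rightarrow> nat" and dec :: "nat \<Rightarrow> nat \<Rightarrow> 'a" and D R P :: real
  assumes M: "prob_meas M" and S: "finite S" and enc: "enc \<in> iid n M \<rightarrow>\<^sub>M count_space UNIV"
    and range: "finite (enc ` space (iid n M))" "log 2 (card (enc ` space (iid n M))) \<le> n * R"
    and cost: "(\<Sum>t<n. \<integral>\<^sup>+x. restricted_cost S \<Delta> (x t, dec (enc x) t) \<partial>iid n M) \<le> ennreal (n * D)"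
      "0 \<le> D"
    and marginal: "\<And>t s. t < n \<Longrightarrow> s \<in> S \<Longrightarrow> measure (iid n M) {x \<in> space (iid n M). dec (enc x) t = s}
        \<le> w s"
    and perception: "\<And>\<gamma>. prob_meas \<gamma> \<Longrightarrow> emeasure \<gamma> S = 1 \<Longrightarrow> (\<And>s. s \<in> S \<Longrightarrow> measure \<gamma> {s} \<le> w s) \<Longrightarrow>
        d M \<gamma> \<le> ennreal P"
    and P: "0 \<le> P"
  shows "nr_code M \<Delta> d D P R n"
proof -
  interpret M: prob_space M by (rule prob_measD[OF M])
  interpret iid: product_prob_space "\<lambda>_. M" "{..<n}" ..
  have measurable_out [measurable]: "(\<lambda>x. dec (enc x) t) \<in> iid n M \<rightarrow>\<^sub>M borel" for t
    by (rule measurable_compose[OF enc]) simp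
  have [measurable]: "S \<in> sets borel" using S by (rule finite_imp_borel)
  have "d M (distr (iid n M) borel (\<lambda>x. dec (enc x) t)) \<le> ennreal P" if t: "t < n" for t
  proof (rule perception)
    show "prob_meas (distr (iid n M) borel (\<lambda>x. dec (enc x) t))"
      by (auto simp: prob_meas_def intro: iid.P.prob_space_distr)
    let ?off = "{x \<in> space (iid n M). dec (enc x) t \<notin> S}"
    have "\<infinity> * emeasure (iid n M) ?off = (\<integral>\<^sup>+x. \<infinity> * indicator ?off x \<partial>iid n M)"
      by (intro nn_integral_cmult_indicator[symmetric]) measurable
    also have "\<dots> \<le> (\<integral>\<^sup>+x. restricted_cost S \<Delta> (x t, dec (enc x) t) \<partial>iid n M)"
      by (intro nn_integral_mono) (auto simp: restricted_cost_def split: split_indicator)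
    also have "\<dots> \<le> ennreal (n * D)"
      using t by (intro order_trans[OF member_le_sum cost(1)]) auto
    finally have "emeasure (iid n M) ?off = 0"
      by (auto simp: ennreal_top_mult top_unique split: if_splits)
    then have "AE x in iid n M. dec (enc x) t \<in> S" by (intro AE_I[of _ _ ?off]) auto
    then show "emeasure (distr (iid n M) borel (\<lambda>x. dec (enc x) t)) S = 1"
      by (simp add: emeasure_distr iid.P.emeasure_eq_1_AE)
    show "measure (distr (iid n M) borel (\<lambda>x. dec (enc x) t)) {s} \<le> w s" if "s \<in> S" for s
      using marginal[OF t that] by (simp add: measure_distr vimage_def Int_def conj_commute)
  qed
  moreover have "(\<Sum>t<n. \<integral>\<^sup>+x. ennreal (\<Delta> (x t) (dec (enc x) t)) \<partial>iid n M) \<le> ennreal (n * D)"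
    by (intro order_trans[OF _ cost(1)] sum_mono nn_integral_mono) (auto simp: restricted_cost_def)
  moreover have "entropy_disc (iid n M) enc \<le> ennreal (n * R)"
    using entropy_disc_le_log_card[OF iid.P.prob_space_axioms enc range(1)]
      ennreal_leI[OF range(2)] by (rule order_trans)
  moreover have "0 \<le> n * R"
  proof -
    have "1 \<le> card (enc ` space (iid n M))"
      using range(1) iid.P.not_empty by (simp add: Suc_le_eq card_gt_0_iff)
    then show ?thesis by (intro order_trans[OF _ range(2)]) simp
  qed
  moreover have "enc \<in> iid n borel \<rightarrow>\<^sub>M count_space UNIV"
    using enc
    by (subst measurable_cong_sets[OF sets_PiM_cong[OF refl prob_measD(2)[OF M, symmetric]] refl])
  ultimately show ?thesis
    unfolding nr_code_def using P cost(2)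
    by (intro exI[of _ enc] exI[of _ dec]) (auto simp: enn2ereal_le_ereal_iff)
qed

lemma nn_integral_kernel_density_pair:
  assumes M: "prob_meas M" and K: "markov_kernel K" and C: "countable C" "AE y in outlaw M K. y \<in> C"
    and h: "h \<in> borel_measurable (borel \<Otimes>\<^sub>M borel)"
  shows "(\<integral>\<^sup>+z. ennreal (case_prod (kernel_density M K) z) * h z \<partial>(M \<Otimes>\<^sub>M outlaw M K))
      = (\<integral>\<^sup>+x. \<integral>\<^sup>+y. h (x, y) \<partial>K x \<partial>M)"
proof -
  interpret q: prob_space "outlaw M K" by (rule prob_measD[OF prob_meas_outlaw[OF M K]])
  have "(\<lambda>z. ennreal (case_prod (kernel_density M K) z) * h z) \<in> borel_measurable (borel \<Otimes>\<^sub>M borel)"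
    using measurable_kernel_density[OF M K] h by measurable
  then have "(\<lambda>z. ennreal (case_prod (kernel_density M K) z) * h z)
      \<in> borel_measurable (M \<Otimes>\<^sub>M outlaw M K)"
    using prob_measD(2)[OF M] prob_measD(2)[OF prob_meas_outlaw[OF M K]]
    by (subst measurable_cong_sets[OF sets_pair_measure_cong refl])
  from q.nn_integral_fst[OF this] show ?thesis
    by (simp add: nn_integral_kernel_eq_density[OF M K C h])
qed

locale finite_output_kernel =
  fixes M :: "'a::polish_space measure" and \<Delta> :: "'a \<Rightarrow> 'a \<Rightarrow> real"
    and d :: "'a measure \<Rightarrow> 'a measure \<Rightarrow> ennreal"
    and K :: "'a \<Rightarrow> 'a measure" and S :: "'a set"
  assumes prob_meas_source: "prob_meas M" and kernel: "markov_kernel K"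
    and finite_S: "finite S" and outlaw_S: "emeasure (outlaw M K) S = 1"
    and atom_pos: "\<And>s. s \<in> S \<Longrightarrow> 0 < measure (outlaw M K) {s}"
    and mutual_info_finite: "mutual_info M K < \<infinity>"
    and distortion_finite: "\<And>s. s \<in> S \<Longrightarrow> (\<integral>\<^sup>+x. ennreal (\<Delta> x s) \<partial>M) < \<infinity>"
    and divergence_finite: "\<And>s. s \<in> S \<Longrightarrow> d M (return borel s) < \<infinity>"
begin

abbreviation "q \<equiv> outlaw M K"

lemma prob_meas_q: "prob_meas q"
  by (rule prob_meas_outlaw[OF prob_meas_source kernel])

lemma AE_q_S: "AE y in q. y \<in> S"
  using prob_meas_q outlaw_S by (simp add: AE_mem_iff_emeasure_eq_1 finite_imp_borel finite_S)

lemma S_nonempty: "S \<noteq> {}"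
  using outlaw_S by auto

lemma memoryless_density:
  "memoryless_density M q (kernel_density M K) (\<Sum>s\<in>S. 1
      / measure q {s}) (enn2real (mutual_info M K)) y0"
proof -
  have C: "countable S" using finite_S by (rule countable_finite)
  have sets_pair: "sets (M \<Otimes>\<^sub>M q) = sets (borel \<Otimes>\<^sub>M borel)"
    by (intro sets_pair_measure_cong prob_measD prob_meas_source prob_meas_q)
  show ?thesis
  proof (rule memoryless_density.intro)
    show "prob_space M" "prob_space q" using prob_meas_source prob_meas_q by (auto dest: prob_measD)
    show "case_prod (kernel_density M K) \<in> borel_measurable (M \<Otimes>\<^sub>M q)"
      using measurable_kernel_density[OF prob_meas_source kernel]
      by (subst measurable_cong_sets[OF sets_pair refl])
    show "0 \<le> kernel_density M K x y" for x y by (rule kernel_density_nonneg)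
    show "kernel_density M K x y \<le> (\<Sum>s\<in>S. 1 / measure q {s})" for x y
    proof (cases "y \<in> S")
      case True
      interpret Kx: prob_space "K x" by (intro prob_measD markov_kernelD kernel)
      have "kernel_density M K x y \<le> 1 / measure q {y}"
        unfolding kernel_density_def by (intro divide_right_mono) auto
      also have "\<dots> \<le> (\<Sum>s\<in>S. 1 / measure q {s})" using True finite_S by (intro member_le_sum) auto
      finally show ?thesis .
    next
      case False
      have "measure q {y} = 0"
        using AE_q_S False
        by (subst measure_singleton_eq_0_iff_AE[OF prob_meas_q]) (auto elim: eventually_mono)
      then show ?thesis by (simp add: kernel_density_def sum_nonneg)
    qed
    show "(\<integral>\<^sup>+y. ennreal (kernel_density M K x y) \<partial>q) \<le> 1" for x
      by (rule nn_integral_kernel_density_le_1[OF prob_meas_source kernel C AE_q_S])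
    show "(\<integral>\<^sup>+z. ennreal (case_prod (kernel_density M K) z) \<partial>(M \<Otimes>\<^sub>M q)) = 1"
      using nn_integral_kernel_density_pair[OF prob_meas_source kernel C AE_q_S, of "\<lambda>_. 1"]
        prob_space.emeasure_space_1[OF prob_measD(1)[OF markov_kernelD(2)[OF kernel]]]
        prob_space.emeasure_space_1[OF prob_measD(1)[OF prob_meas_source]] by simp
    show "(\<integral>\<^sup>+z. ennreal (kl_fun (case_prod (kernel_density M K) z)) \<partial>(M \<Otimes>\<^sub>M q))
        \<le> ennreal (enn2real (mutual_info M K))"
      using mutual_info_finite
      by (simp add: mutual_info_eq_nn_integral_kl[OF prob_meas_source kernel C AE_q_S, symmetric])
  qed (simp_all add: prob_measD[OF prob_meas_q])
qed

lemma nn_integral_density_restricted_cost: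
  assumes \<Delta>: "case_prod \<Delta> \<in> borel_measurable (borel \<Otimes>\<^sub>M borel)"
  shows "(\<integral>\<^sup>+z. ennreal (case_prod (kernel_density M K) z) * restricted_cost S \<Delta> z \<partial>(M \<Otimes>\<^sub>M q))
      = exp_dist M \<Delta> K"
proof -
  note C = countable_finite[OF finite_S]
  have "AE x in M. (\<integral>\<^sup>+y. restricted_cost S \<Delta> (x, y) \<partial>K x) = (\<integral>\<^sup>+y. ennreal (\<Delta> x y) \<partial>K x)"
    using AE_outlaw_memD[OF prob_meas_source kernel C AE_q_S]
  proof eventually_elim
    fix x assume "AE y in K x. y \<in> S"
    then show "(\<integral>\<^sup>+y. restricted_cost S \<Delta> (x, y) \<partial>K x) = (\<integral>\<^sup>+y. ennreal (\<Delta> x y) \<partial>K x)"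
      by (intro nn_integral_cong_AE) (auto simp: restricted_cost_def elim: eventually_mono)
  qed
  then show ?thesis
    by (simp add: nn_integral_kernel_density_pair[OF prob_meas_source kernel C AE_q_S
      measurable_restricted_cost[OF finite_S \<Delta>]]
        exp_dist_def nn_integral_cong_AE)
qed

lemma nn_integral_density_indicator:
  assumes [measurable]: "A \<in> sets borel"
  shows "(\<integral>\<^sup>+z. ennreal (case_prod (kernel_density M K) z) * indicator A (snd z) \<partial>(M \<Otimes>\<^sub>M q))
      = emeasure q A"
proof -
  have meas: "(\<lambda>z. indicator A (snd z) :: ennreal) \<in> borel_measurable (borel \<Otimes>\<^sub>M borel)"
    by measurable
  have "(\<integral>\<^sup>+z. ennreal (case_prod (kernel_density M K) z) * indicator A (snd z) \<partial>(M \<Otimes>\<^sub>M q))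
      = (\<integral>\<^sup>+x. \<integral>\<^sup>+y. indicator A y \<partial>K x \<partial>M)"
    using nn_integral_kernel_density_pair[OF prob_meas_source kernel countable_finite[OF finite_S]
      AE_q_S meas] by simp
  also have "\<dots> = (\<integral>\<^sup>+y. indicator A y \<partial>q)"
    by (intro nn_integral_outlaw[symmetric] prob_meas_source kernel) measurable
  finally show ?thesis by (simp add: prob_measD[OF prob_meas_q])
qed

end

lemma tendsto_mult_power_floor:
  fixes m p \<delta> :: real
  assumes p: "0 < p" "p < 1" and \<delta>: "0 < \<delta>"
  shows "(\<lambda>n. real n * m * p ^ nat \<lfloor>\<delta> * real n\<rfloor>) \<longlonglongrightarrow> 0"
proof -
  define c where "c = - ln p"
  have c: "0 < c" using p by (simp add: c_def)
  have "p ^ nat \<lfloor>\<delta> * real n\<rfloor> = exp (- c * real_of_int \<lfloor>\<delta> * real n\<rfloor>)" for n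
    using p \<delta>
    by (simp add: c_def exp_minus flip: powr_realpow powr_def) (simp add: powr_def mult.commute)
  moreover have "(\<lambda>n. real n * exp (- c * real_of_int \<lfloor>\<delta> * real n\<rfloor>)) \<longlonglongrightarrow> 0"
    using c \<delta> by real_asymp
  from tendsto_mult_left_zero[OF this, of m]
  have "(\<lambda>n. real n * m * exp (- c * real_of_int \<lfloor>\<delta> * real n\<rfloor>)) \<longlonglongrightarrow> 0" by (simp add: mult_ac)
  ultimately show ?thesis by simp
qed

lemma eventually_log_code_size_le:
  fixes \<delta> I :: real
  assumes \<delta>: "0 < \<delta>" and I: "0 \<le> I"
  shows "\<forall>\<^sub>F n in sequentially.
    log 2 (real (2 ^ nat \<lfloor>\<delta> * real n\<rfloor> * (nat \<lceil>real n * exp (real n * (I * ln 2 + \<delta> * ln 2))\<rceil> + 1)))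
        \<le> n * (I + 3 * \<delta>)"
proof -
  have "\<forall>\<^sub>F n in sequentially. log 2 (3 * real n) \<le> \<delta> * real n" using \<delta> by real_asymp
  then show ?thesis using eventually_gt_at_top[of 0]
  proof eventually_elim
    fix n :: nat assume log_le: "log 2 (3 * real n) \<le> \<delta> * real n" and n: "0 < n"
    define L where "L = exp (real n * (I * ln 2 + \<delta> * ln 2))"
    have L: "1 \<le> L" using I \<delta> by (simp add: L_def)
    have nL: "1 \<le> real n * L" using mult_mono[of 1 "real n" 1 L] n L by simp
    define N where "N = nat \<lceil>real n * L\<rceil>"
    have "real (N + 1) \<le> 3 * real n * L" using nL unfolding N_def by linarith
    then have "log 2 (2 ^ nat \<lfloor>\<delta> * real n\<rfloor> * real (N + 1))
        \<le> log 2 (2 ^ nat \<lfloor>\<delta> * real n\<rfloor> * (3 * real n * L))"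
      by (intro log_mono mult_left_mono mult_pos_pos) auto
    also have "\<dots> = nat \<lfloor>\<delta> * real n\<rfloor> + (log 2 (3 * real n) + log 2 L)"
      using n L by (simp add: log_mult log_nat_power)
    also have "log 2 L = n * (I + \<delta>)" by (simp add: L_def log_def field_simps)
    also have "nat \<lfloor>\<delta> * real n\<rfloor> + (log 2 (3 * real n) + n * (I + \<delta>))
        \<le> \<delta> * n + (\<delta> * n + n * (I + \<delta>))"
      using log_le \<delta> by (intro add_mono) auto
    also have "\<dots> = n * (I + 3 * \<delta>)" by (simp add: algebra_simps)
    finally show
      "log 2 (real (2 ^ nat \<lfloor>\<delta> * real n\<rfloor>
        * (nat \<lceil>real n * exp (real n * (I * ln 2 + \<delta> * ln 2))\<rceil> + 1))) \<le> n * (I + 3 * \<delta>)"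
      by (simp only: N_def L_def of_nat_mult of_nat_power of_nat_numeral)
  qed
qed

context finite_output_kernel
begin

abbreviation "block_bound y0 \<equiv> memoryless_density.block_bound M q (kernel_density M K) y0"

lemma measurable_restricted_cost_source_output:
  assumes "case_prod \<Delta> \<in> borel_measurable (borel \<Otimes>\<^sub>M borel)"
  shows "restricted_cost S \<Delta> \<in> borel_measurable (M \<Otimes>\<^sub>M q)"
  using measurable_restricted_cost[OF finite_S assms]
  by (subst measurable_cong_sets[OF sets_pair_measure_cong[OF prob_measD(2)[OF prob_meas_source]
    prob_measD(2)[OF prob_meas_q]] refl])

lemma nr_code_of_block_bounds:
  fixes a b p \<zeta> v T D R P :: real
  assumes \<Delta>: "case_prod \<Delta> \<in> borel_measurable (borel \<Otimes>\<^sub>M borel)" and n: "0 < n" and b: "0 < b"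
    and E: "E \<in> sets borel" and k: "k \<le> n" and p: "measure M E \<le> p" "1 - measure M E \<le> p"
    and marginal: "\<And>t s. t < n \<Longrightarrow> s \<in> S \<Longrightarrow>
      block_bound y0 a b n (\<lambda>(x, c). indicator {s} (c t)) \<le> ennreal (measure q {s} + \<zeta> / 2)"
        and \<zeta>: "0 \<le> \<zeta>"
    and cost: "\<And>t. t < n \<Longrightarrow> block_bound y0 a b n (\<lambda>(x, c). restricted_cost S \<Delta> (x t, c t))
        \<le> ennreal v" and v: "0 \<le> v"
    and T: "0 < T" and slack: "n * card S * p ^ k + T * v \<le> (\<zeta> / 2)\<^sup>2"
      "n * card S * p ^ k / T + v \<le> D"
    and rate: "log 2 (real (2 ^ k * (nat \<lceil>n * exp (n * a)\<rceil> + 1))) \<le> n * R"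
    and perception: "\<And>\<gamma>. prob_meas \<gamma> \<Longrightarrow> emeasure \<gamma> S = 1 \<Longrightarrow>
      (\<And>s. s \<in> S \<Longrightarrow> measure \<gamma> {s} \<le> measure q {s} + \<zeta>) \<Longrightarrow> d M \<gamma> \<le> ennreal P" and P: "0 \<le> P"
  shows "nr_code M \<Delta> d D P R n"
proof -
  interpret S: memoryless_density M q "kernel_density M K" "\<Sum>s\<in>S. 1 / measure q {s}"
    "enn2real (mutual_info M K)" y0
    by (rule memoryless_density)
  have p_nonneg: "0 \<le> p" using p(1) by (rule order_trans[rotated]) simp
  have "E \<in> sets M" using E by (simp add: prob_measD[OF prob_meas_source])
  then obtain enc :: "(nat \<Rightarrow> 'a) \<Rightarrow> nat" and dec
    where enc: "enc \<in> iid n M \<rightarrow>\<^sub>M count_space UNIV" "finite (enc ` space (iid n M))"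
    and card_le: "card (enc ` space (iid n M)) \<le> 2 ^ k * (nat \<lceil>n * exp (n * a)\<rceil> + 1)"
    and marginal_le: "\<And>t s. t < n \<Longrightarrow> s \<in> S \<Longrightarrow>
        measure (iid n M) {x \<in> space (iid n M). dec (enc x) t \<in> {s}}
      \<le> measure q {s} + \<zeta> / 2 + sqrt (n * card S * p ^ k + T * v)"
    and cost_le: "(\<Sum>t<n. \<integral>\<^sup>+x. restricted_cost S \<Delta> (x t, dec (enc x) t) \<partial>iid n M)
        \<le> ennreal (n * (n * card S * p ^ k / T + v))"
    using \<zeta> n b k p finite_S marginal cost v T measurable_restricted_cost_source_output[OF \<Delta>]
    by (elim S.ex_block_code[of n b E k p S "\<lambda>s. {s}" a "\<lambda>s. measure q {s} + \<zeta> / 2"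
      "restricted_cost S \<Delta>" v T])
      (auto simp: prob_measD[OF prob_meas_q])
  show ?thesis
  proof (rule nr_code_of_finite_code[OF prob_meas_source finite_S enc, where w = "\<lambda>s. measure q {s}
      + \<zeta>"])
    have "0 < card (enc ` space (iid n M))"
      using enc(2) S.Mn.P.not_empty by (simp add: card_gt_0_iff)
    then show "log 2 (card (enc ` space (iid n M))) \<le> n * R"
      using card_le by (intro order_trans[OF log_mono rate] of_nat_mono) simp_all
    have "n * (n * card S * p ^ k / T + v) \<le> n * D" using slack(2) by (intro mult_left_mono) auto
    then show "(\<Sum>t<n. \<integral>\<^sup>+x. restricted_cost S \<Delta> (x t, dec (enc x) t) \<partial>iid n M) \<le> ennreal (n * D)"
      using cost_le by (meson ennreal_leI order_trans)
    show "0 \<le> D" using slack(2) p_nonneg T v by (intro order_trans[OF _ slack(2)]) auto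
    have "sqrt (n * card S * p ^ k + T * v) \<le> \<zeta> / 2" using slack(1) \<zeta> by (intro real_le_lsqrt) auto
    then show "measure (iid n M) {x \<in> space (iid n M). dec (enc x) t = s} \<le> measure q {s} + \<zeta>"
      if "t < n" "s \<in> S" for t s
      using marginal_le[OF that] by simp
  qed (fact perception P)+
qed

lemma eventually_block_bound_restricted_cost_le:
  assumes y0: "y0 \<in> S" and ab: "memoryless_density.atypical_exponent M q (kernel_density M K) a b"
    and \<Delta>: "case_prod \<Delta> \<in> borel_measurable (borel \<Otimes>\<^sub>M borel)" and v: "exp_dist M \<Delta> K < ennreal v"
  shows "\<forall>\<^sub>F n in sequentially. \<forall>t<n. block_bound y0 a b n (\<lambda>(x, c). restricted_cost S \<Delta> (x t,
      c t)) \<le> ennreal v"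
proof -
  interpret S: memoryless_density M q "kernel_density M K" "\<Sum>s\<in>S. 1 / measure q {s}"
    "enn2real (mutual_info M K)" y0
    by (rule memoryless_density)
  obtain j where j: "0 \<le> j" "exp_dist M \<Delta> K = ennreal j" "j < v"
    using v by (cases "exp_dist M \<Delta> K") (auto simp: ennreal_less_iff)
  show ?thesis
  proof (rule S.eventually_block_bound_coord_le[OF ab _ _ j(1,3)])
    show "restricted_cost S \<Delta> \<in> borel_measurable (M \<Otimes>\<^sub>M q)"
      by (rule measurable_restricted_cost_source_output[OF \<Delta>])
    show "(\<integral>\<^sup>+z. ennreal (case_prod (kernel_density M K) z) * restricted_cost S \<Delta> z \<partial>(M \<Otimes>\<^sub>M q))
        \<le> ennreal j"
      by (simp add: nn_integral_density_restricted_cost[OF \<Delta>] j(2))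
    show "(\<integral>\<^sup>+x. restricted_cost S \<Delta> (x, y0) \<partial>M) < \<infinity>"
      using distortion_finite[OF y0] y0 by (simp add: restricted_cost_def)
  qed
qed

lemma eventually_block_bound_singleton_le:
  assumes y0: "y0 \<in> S" and ab: "memoryless_density.atypical_exponent M q (kernel_density M K) a b"
    and \<epsilon>: "0 < \<epsilon>"
  shows "\<forall>\<^sub>F n in sequentially. \<forall>s\<in>S. \<forall>t<n. block_bound y0 a b n (\<lambda>(x, c). indicator {s} (c t))
      \<le> ennreal (measure q {s} + \<epsilon>)"
proof (intro eventually_ball_finite finite_S ballI)
  interpret S: memoryless_density M q "kernel_density M K" "\<Sum>s\<in>S. 1 / measure q {s}"
    "enn2real (mutual_info M K)" y0
    by (rule memoryless_density)
  fix s assume "s \<in> S"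
  have [measurable]: "{s} \<in> sets q" by (simp add: prob_measD[OF prob_meas_q])
  have "(\<integral>\<^sup>+x. indicator {s} y0 \<partial>M) < (\<infinity> :: ennreal)"
    by (simp add: S.M.emeasure_space_1 split: split_indicator)
  then show "\<forall>\<^sub>F n in sequentially. \<forall>t<n. block_bound y0 a b n (\<lambda>(x, c). indicator {s} (c t))
      \<le> ennreal (measure q {s} + \<epsilon>)"
    using S.eventually_block_bound_coord_le[OF ab, of "\<lambda>z. indicator {s} (snd z)" "measure q {s}"
      "measure q {s} + \<epsilon>"] \<epsilon>
    by (simp add: nn_integral_density_indicator S.q.emeasure_eq_measure)
qed

text \<open>The event \<open>E\<close> supplies the labels: since \<open>0 < measure M E < 1\<close>, every pattern of its
  occurrences among the first \<open>\<lfloor>\<delta> n\<rfloor>\<close> source symbols is exponentially unlikely.\<close>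

lemma eventually_nr_code:
  fixes a b \<zeta> v \<delta> I D P R :: real
  assumes \<Delta>: "case_prod \<Delta> \<in> borel_measurable (borel \<Otimes>\<^sub>M borel)"
    and E: "E \<in> sets borel" "0 < measure M E" "measure M E < 1"
    and \<delta>: "0 < \<delta>" "\<delta> \<le> 1" and I: "0 \<le> I" "I + 3 * \<delta> \<le> R" and a: "a = I * ln 2 + \<delta> * ln 2"
    and b: "0 < b"
    and v: "0 \<le> v" "v < D" and \<zeta>: "0 < \<zeta>" and P: "0 \<le> P"
    and cost:
      "\<forall>\<^sub>F n in sequentially. \<forall>t<n. block_bound y0 a b n (\<lambda>(x, c). restricted_cost S \<Delta> (x t, c t))
        \<le> ennreal v"
    and marginal: "\<forall>\<^sub>F n in sequentially. \<forall>s\<in>S. \<forall>t<n.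
      block_bound y0 a b n (\<lambda>(x, c). indicator {s} (c t)) \<le> ennreal (measure q {s} + \<zeta> / 2)"
    and perception: "\<And>\<gamma>. prob_meas \<gamma> \<Longrightarrow> emeasure \<gamma> S = 1 \<Longrightarrow>
      (\<And>s. s \<in> S \<Longrightarrow> measure \<gamma> {s} \<le> measure q {s} + \<zeta>) \<Longrightarrow> d M \<gamma> \<le> ennreal P"
  shows "\<forall>\<^sub>F n in sequentially. nr_code M \<Delta> d D P R n"
proof -
  define p where "p = max (measure M E) (1 - measure M E)"
  have p: "0 < p" "p < 1" "measure M E \<le> p" "1 - measure M E \<le> p" using E by (auto simp: p_def)
  define T where "T = \<zeta>\<^sup>2 / (8 * (v + 1))"
  have T: "0 < T" "T * v \<le> \<zeta>\<^sup>2 / 8" using \<zeta> v by (auto simp: T_def field_simps)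
  have "\<forall>\<^sub>F n in sequentially. real n * card S * p ^ nat \<lfloor>\<delta> * real n\<rfloor> < min (\<zeta>\<^sup>2 / 8) (T * (D - v))"
    using \<zeta> T v p \<delta> by (intro order_tendstoD(2)[OF tendsto_mult_power_floor]) auto
  moreover note eventually_log_code_size_le[OF \<delta>(1) I(1), folded a]
  ultimately show ?thesis
    using cost marginal eventually_gt_at_top[of 0]
  proof eventually_elim
    fix n :: nat
    let ?k = "nat \<lfloor>\<delta> * real n\<rfloor>"
    assume cost: "\<forall>t<n. block_bound y0 a b n (\<lambda>(x, c). restricted_cost S \<Delta> (x t, c t)) \<le> ennreal v"
      and marginal: "\<forall>s\<in>S. \<forall>t<n. block_bound y0 a b n (\<lambda>(x, c). indicator {s} (c t))
          \<le> ennreal (measure q {s} + \<zeta> / 2)"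
      and small: "real n * card S * p ^ ?k < min (\<zeta>\<^sup>2 / 8) (T * (D - v))"
      and rate: "log 2 (real (2 ^ ?k * (nat \<lceil>real n * exp (real n * a)\<rceil> + 1))) \<le> n * (I + 3 * \<delta>)"
      and n: "0 < n"
    have "\<delta> * real n \<le> 1 * real n" using \<delta> by (intro mult_right_mono) auto
    then have k: "?k \<le> n" using \<delta> by linarith
    show "nr_code M \<Delta> d D P R n"
    proof (rule nr_code_of_block_bounds[OF \<Delta> n b E(1) k p(3,4)])
      show "n * card S * p ^ ?k + T * v \<le> (\<zeta> / 2)\<^sup>2" using small T(2) by (simp add: power_divide)
      have "n * card S * p ^ ?k / T \<le> T * (D - v) / T" using small T(1)
        by (intro divide_right_mono) auto
      then show "n * card S * p ^ ?k / T + v \<le> D" using T(1) by simp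
      show "log 2 (real (2 ^ ?k * (nat \<lceil>real n * exp (real n * a)\<rceil> + 1))) \<le> n * R"
        using rate mult_left_mono[OF I(2), of "real n"] by simp
    qed (use cost marginal \<zeta> v T P perception in auto)
  qed
qed

proposition achievable:
  fixes D P R :: real
  assumes \<Delta>: "case_prod \<Delta> \<in> borel_measurable (borel \<Otimes>\<^sub>M borel)" and d: "mix_convex (d M)"
    and E: "E \<in> sets borel" "0 < measure M E" "measure M E < 1"
    and I: "mutual_info M K < ennreal R" and D: "exp_dist M \<Delta> K < ennreal D"
    and P: "d M q < ennreal P"
  shows "achievable_nr M \<Delta> d D P R"
proof -
  obtain y0 where y0: "y0 \<in> S" using S_nonempty by blast
  interpret S: memoryless_density M q "kernel_density M K" "\<Sum>s\<in>S. 1 / measure q {s}"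
    "enn2real (mutual_info M K)" y0
    by (rule memoryless_density)
  define I' where "I' = enn2real (mutual_info M K)"
  have I': "0 \<le> I'" "I' < R"
    using I by (cases "mutual_info M K"; auto simp: I'_def ennreal_less_iff)+
  define \<delta> where "\<delta> = min 1 ((R - I') / 3)"
  have \<delta>: "0 < \<delta>" "\<delta> \<le> 1" "I' + 3 * \<delta> \<le> R" using I' by (auto simp: \<delta>_def min_def field_simps)
  define a where "a = I' * ln 2 + \<delta> * ln 2"
  obtain b where ab: "S.atypical_exponent a b"
    using S.ex_atypical_exponent[of "\<delta> * ln 2"] \<delta> unfolding a_def I'_def by auto
  then have b: "0 < b" by (simp add: S.atypical_exponent_def)
  obtain D' where D': "0 \<le> D'" "exp_dist M \<Delta> K = ennreal D'" "D' < D"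
    using D by (cases "exp_dist M \<Delta> K") (auto simp: ennreal_less_iff)
  define v where "v = (D' + D) / 2"
  have v: "exp_dist M \<Delta> K < ennreal v" "0 \<le> v" "v < D" using D'
    by (auto simp: v_def ennreal_less_iff)
  have P_nonneg: "0 \<le> P" using P by (cases "0 \<le> P") (auto simp: ennreal_neg)
  obtain \<zeta> where \<zeta>: "0 < \<zeta>" and perception: "\<And>\<gamma>. prob_meas \<gamma> \<Longrightarrow> emeasure \<gamma> S = 1 \<Longrightarrow>
      (\<And>s. s \<in> S \<Longrightarrow> measure \<gamma> {s} \<le> measure q {s} + \<zeta>) \<Longrightarrow> d M \<gamma> \<le> ennreal P"
    using mix_convex_upper_neighborhood[OF d prob_meas_q outlaw_S finite_S atom_pos
      divergence_finite P] by blast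
  note cost = eventually_block_bound_restricted_cost_le[OF y0 ab \<Delta> v(1)]
  note marginal = eventually_block_bound_singleton_le[OF y0 ab half_gt_zero[OF \<zeta>]]
  have "\<forall>\<^sub>F n in sequentially. nr_code M \<Delta> d D P R n"
    by (rule eventually_nr_code[OF \<Delta> E \<delta>(1,2) I'(1) \<delta>(3) a_def b v(2,3) \<zeta> P_nonneg cost marginal
      perception])
  then show ?thesis by (auto simp: achievable_nr_def eventually_sequentially)
qed

end

lemma prob_meas_eq_return:
  assumes M: "prob_meas M" and AE_eq: "AE x in M. x = a"
  shows "M = return borel a"
proof (rule prob_meas_eqI[OF M prob_meas_return])
  interpret prob_space M by (rule prob_measD[OF M])
  fix A :: "'a set" assume A: "A \<in> sets borel"
  have "emeasure M A = (\<integral>\<^sup>+x. indicator A x \<partial>M)" using A by (simp add: prob_measD[OF M])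
  also have "\<dots> = (\<integral>\<^sup>+x. indicator A a \<partial>M)"
    by (intro nn_integral_cong_AE, use AE_eq in eventually_elim) simp
  finally show "emeasure M A = emeasure (return borel a) A" using A by (simp add: emeasure_space_1)
qed

lemma zero_one_measure_eq_return:
  fixes M :: "'a::polish_space measure"
  assumes M: "prob_meas M" and zero_one: "\<And>E. E \<in> sets borel \<Longrightarrow> measure M E = 0 \<or> measure M E = 1"
  obtains a where "M = return borel a"
proof -
  interpret prob_space M by (rule prob_measD[OF M])
  note [simp] = prob_measD(2,3)[OF M]
  obtain \<B> :: "'a set set" where \<B>: "countable \<B>" "topological_basis \<B>"
    using ex_countable_basis by auto
  have "AE x in M. x \<in> B \<longleftrightarrow> measure M B = 1" if "B \<in> \<B>" for B
  proof -
    have B: "B \<in> sets borel" using topological_basis_open[OF \<B>(2) that] by simp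
    show ?thesis
    proof (cases "measure M B = 1")
      case True
      then show ?thesis using B by (simp add: prob_eq_1)
    next
      case False
      then have "measure M B = 0" using zero_one[OF B] by blast
      then show ?thesis using B False by (simp add: prob_eq_0)
    qed
  qed
  then have AE_basis: "AE x in M. \<forall>B\<in>\<B>. x \<in> B \<longleftrightarrow> measure M B = 1"
    by (subst AE_ball_countable[OF \<B>(1)]) blast
  moreover have "ae_filter M \<noteq> bot" using emeasure_space_1 by (simp add: ae_filter_eq_bot_iff)
  ultimately obtain a where a: "\<forall>B\<in>\<B>. a \<in> B \<longleftrightarrow> measure M B = 1"
    using eventually_happens' by blast
  have "AE x in M. x = a"
    using AE_basis
  proof eventually_elim
    fix x assume x: "\<forall>B\<in>\<B>. x \<in> B \<longleftrightarrow> measure M B = 1"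
    show "x = a"
    proof (rule ccontr)
      assume "x \<noteq> a"
      then obtain U where "open U" "x \<in> U" "a \<notin> U" using t1_space by blast
      then obtain B where "B \<in> \<B>" "x \<in> B" "B \<subseteq> U" using topological_basisE[OF \<B>(2)] by blast
      then show False using a x \<open>a \<notin> U\<close> by blast
    qed
  qed
  then show thesis by (intro that[of a] prob_meas_eq_return M)
qed

lemma point_mass_or_nontrivial_event:
  fixes M :: "'a::polish_space measure"
  assumes "prob_meas M"
  obtains (point_mass) a where "M = return borel a"
  | (nontrivial) E where "E \<in> sets borel" "0 < measure M E" "measure M E < 1"
proof (cases "\<forall>E\<in>sets borel. measure M E = 0 \<or> measure M E = 1")
  case True
  then show thesis using zero_one_measure_eq_return[OF assms] point_mass by blast
next
  case False
  then show thesis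
    using prob_space.prob_le_1[OF prob_measD(1)[OF assms]] nontrivial
    by (metis less_eq_real_def measure_nonneg)
qed

lemma achievable_return:
  fixes \<Delta> :: "'a::polish_space \<Rightarrow> 'a \<Rightarrow> real"
  assumes \<Delta>: "case_prod \<Delta> \<in> borel_measurable (borel \<Otimes>\<^sub>M borel)" and \<Delta>_zero: "\<Delta> a a = 0"
    and d_zero: "d (return borel a) (return borel a) = 0" and D: "0 \<le> D" and P: "0 \<le> P"
  shows "achievable_nr (return borel a) \<Delta> d D P 0"
proof -
  let ?M = "return borel a :: 'a measure"
  interpret M: prob_space ?M by (rule prob_measD[OF prob_meas_return])
  have "nr_code ?M \<Delta> d D P 0 n" for n
  proof -
    interpret iid: product_prob_space "\<lambda>_. ?M" "{..<n}" ..
    have "(\<lambda>_. 0) ` space (iid n ?M) = {0::nat}" using iid.P.not_empty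
      by (simp add: image_constant_conv)
    then have "entropy_disc (iid n ?M) (\<lambda>_. 0) \<le> 0"
      using entropy_disc_le_log_card[of "iid n ?M" "\<lambda>_. 0"] iid.P.prob_space_axioms by simp
    moreover have "(\<integral>\<^sup>+x. ennreal (\<Delta> (x t) a) \<partial>iid n ?M) = 0" if t: "t < n" for t
    proof -
      have "(\<lambda>x. ennreal (\<Delta> x a)) \<in> borel_measurable borel"
        using measurable_compose[OF measurable_Pair2' \<Delta>, of a] by simp
      then show ?thesis
        using nn_integral_iid_coord[OF M.prob_space_axioms t, of "\<lambda>x. ennreal (\<Delta> x a)"] \<Delta>_zero
        by (simp add: nn_integral_return)
    qed
    moreover have "distr (iid n ?M) borel (\<lambda>_. a) = ?M"
      by (rule iid.P.distr_const) simp
    ultimately show ?thesis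
      unfolding nr_code_def using D P d_zero
      by (intro exI[of _ "\<lambda>_. 0"] exI[of _ "\<lambda>_ _. a"]) (auto simp: enn2ereal_le_ereal_iff)
  qed
  then show ?thesis by (auto simp: achievable_nr_def)
qed

lemma finite_output_kernel_mix:
  assumes K0: "finite_output_kernel M \<Delta> d K0 S0" and K1: "finite_output_kernel M \<Delta> d K1 S1"
    and w: "0 < w" "w < 1"
  shows "finite_output_kernel M \<Delta> d (\<lambda>x. mix w (K0 x) (K1 x)) (S0 \<union> S1)"
    and "mutual_info M (\<lambda>x. mix w (K0 x) (K1 x)) \<le> ennreal w * mutual_info M K0
        + ennreal (1 - w) * mutual_info M K1"
proof -
  interpret K0: finite_output_kernel M \<Delta> d K0 S0 by fact
  interpret K1: finite_output_kernel M \<Delta> d K1 S1 by fact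
  note pX = K0.prob_meas_source
  have l: "0 \<le> w" "w \<le> 1" using w by auto
  note outlaw = outlaw_mix[OF pX K0.kernel K1.kernel l]
  have fin: "finite (S0 \<union> S1)" using K0.finite_S K1.finite_S by simp
  have AE: "AE y in K0.q. y \<in> S0 \<union> S1" "AE y in K1.q. y \<in> S0 \<union> S1"
    using K0.AE_q_S K1.AE_q_S by (auto elim: eventually_mono)
  then have emeasure_1: "emeasure K0.q (S0 \<union> S1) = 1" "emeasure K1.q (S0 \<union> S1) = 1"
    using K0.prob_meas_q K1.prob_meas_q fin
    by (simp_all add: AE_mem_iff_emeasure_eq_1[symmetric] finite_imp_borel)
  show "mutual_info M (\<lambda>x. mix w (K0 x) (K1 x)) \<le> ennreal w * mutual_info M K0
      + ennreal (1 - w) * mutual_info M K1"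
    by (rule mutual_info_mix_le[OF pX K0.kernel K1.kernel l countable_finite[OF fin] AE])
  also have "\<dots> < \<infinity>"
    using K0.mutual_info_finite K1.mutual_info_finite by (simp add: ennreal_mult_less_top)
  finally have "mutual_info M (\<lambda>x. mix w (K0 x) (K1 x)) < \<infinity>" .
  then show "finite_output_kernel M \<Delta> d (\<lambda>x. mix w (K0 x) (K1 x)) (S0 \<union> S1)"
  proof (unfold_locales)
    show "emeasure (outlaw M (\<lambda>x. mix w (K0 x) (K1 x))) (S0 \<union> S1) = 1"
      unfolding outlaw using emeasure_1 fin
      by (intro emeasure_mix_eq_1 K0.prob_meas_q K1.prob_meas_q l finite_imp_borel)
    show "0 < measure (outlaw M (\<lambda>x. mix w (K0 x) (K1 x))) {s}" if "s \<in> S0 \<union> S1" for s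
      using that w K0.atom_pos[of s] K1.atom_pos[of s]
      by (auto simp: outlaw measure_mix[OF K0.prob_meas_q K1.prob_meas_q l] add_pos_nonneg
        add_nonneg_pos)
  qed (use pX fin K0.distortion_finite K1.distortion_finite K0.divergence_finite
    K1.divergence_finite
      in \<open>auto intro: markov_kernel_mix[OF K0.kernel K1.kernel l]\<close>)
qed

lemma ennreal_convex_comb_less:
  assumes "x \<le> ennreal a" "y \<le> ennreal b" "0 \<le> a" "0 \<le> b" "0 \<le> l" "l \<le> 1" "l * a + (1 - l) * b < c"
  shows "ennreal l * x + ennreal (1 - l) * y < ennreal c"
proof -
  have "ennreal l * x + ennreal (1 - l) * y \<le> ennreal l * ennreal a + ennreal (1 - l) * ennreal b"
    using assms by (intro add_mono mult_left_mono) auto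
  also have "\<dots> = ennreal (l * a + (1 - l) * b)" using assms by (simp add: ennreal_mult)
  also have "\<dots> < ennreal c"
    using assms by (intro ennreal_lessI) (auto intro: order.strict_trans1[rotated])
  finally show ?thesis .
qed

lemma achievable_of_two_kernels:
  fixes I0 D0 P0 I1 D1 P1 R D P w :: real
  assumes \<Delta>: "case_prod \<Delta> \<in> borel_measurable (borel \<Otimes>\<^sub>M borel)" and d: "mix_convex (d M)"
    and E: "E \<in> sets borel" "0 < measure M E" "measure M E < 1" and w: "0 < w" "w < 1"
    and K0: "finite_output_kernel M \<Delta> d K0 S0" "mutual_info M K0 \<le> ennreal I0"
      "exp_dist M \<Delta> K0 \<le> ennreal D0" "d M (outlaw M K0) \<le> ennreal P0"
    and K1: "finite_output_kernel M \<Delta> d K1 S1" "mutual_info M K1 \<le> ennreal I1"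
      "exp_dist M \<Delta> K1 \<le> ennreal D1" "d M (outlaw M K1) \<le> ennreal P1"
    and nonneg: "0 \<le> I0" "0 \<le> D0" "0 \<le> P0" "0 \<le> I1" "0 \<le> D1" "0 \<le> P1"
    and less: "w * I0 + (1 - w) * I1 < R" "w * D0 + (1 - w) * D1 < D" "w * P0 + (1 - w) * P1 < P"
  shows "achievable_nr M \<Delta> d D P R"
proof -
  interpret K0: finite_output_kernel M \<Delta> d K0 S0 by fact
  interpret K1: finite_output_kernel M \<Delta> d K1 S1 by fact
  have l: "0 \<le> w" "w \<le> 1" using w by auto
  note mix = finite_output_kernel_mix[OF K0(1) K1(1) w]
  show ?thesis
  proof (rule finite_output_kernel.achievable[OF mix(1) \<Delta> d E])
    show "mutual_info M (\<lambda>x. mix w (K0 x) (K1 x)) < ennreal R"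
      by (rule le_less_trans[OF mix(2)
        ennreal_convex_comb_less[OF K0(2) K1(2) nonneg(1,4) l less(1)]])
    show "exp_dist M \<Delta> (\<lambda>x. mix w (K0 x) (K1 x)) < ennreal D"
      unfolding exp_dist_mix[OF K0.prob_meas_source K0.kernel K1.kernel l \<Delta>]
      by (rule ennreal_convex_comb_less[OF K0(3) K1(3) nonneg(2,5) l less(2)])
    show "d M (outlaw M (\<lambda>x. mix w (K0 x) (K1 x))) < ennreal P"
      unfolding outlaw_mix[OF K0.prob_meas_source K0.kernel K1.kernel l]
      by (rule le_less_trans[OF mix_convexD[OF d K0.prob_meas_q K1.prob_meas_q l]
          ennreal_convex_comb_less[OF K0(4) K1(4) nonneg(3,6) l less(3)]])
  qed
qed

text \<open>Mixing in a strictly better point with weight \<open>w\<close> gains slack of order \<open>w\<close>, which pays for an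
  error of \<open>w\<^sup>2\<close> in the other point.\<close>

lemma eventually_perturbed_mixture_less:
  fixes x0 x :: real
  assumes "x0 < x"
  shows "\<forall>\<^sub>F w in at_right 0. w * x0 + (1 - w) * (x + w\<^sup>2) < x"
proof -
  have "((\<lambda>w. x0 - x + (1 - w) * w) \<longlongrightarrow> x0 - x + (1 - 0) * 0) (at_right 0)"
    by (intro tendsto_intros)
  then have "\<forall>\<^sub>F w in at_right 0. x0 - x + (1 - w) * w < 0"
    using assms by (intro order_tendstoD(2)) auto
  then show ?thesis using eventually_at_right_less[of 0]
  proof eventually_elim
    fix w :: real assume "x0 - x + (1 - w) * w < 0" "0 < w"
    then have "w * (x0 - x + (1 - w) * w) < 0" by (simp add: mult_pos_neg)
    then show "w * x0 + (1 - w) * (x + w\<^sup>2) < x" by (simp add: power2_eq_square algebra_simps)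
  qed
qed

lemma ex_perturbed_mixture_weight:
  fixes I0 I \<epsilon> D0 D P0 P :: real
  assumes \<epsilon>: "0 < \<epsilon>" and less: "D0 < D" "P0 < P"
  obtains w where "0 < w" "w < 1" "w * I0 + (1 - w) * (I + w\<^sup>2) < I + \<epsilon>"
    "w * D0 + (1 - w) * (D + w\<^sup>2) < D" "w * P0 + (1 - w) * (P + w\<^sup>2) < P"
proof -
  have "((\<lambda>w. w * I0 + (1 - w) * (I + w\<^sup>2)) \<longlongrightarrow> 0 * I0 + (1 - 0) * (I + 0\<^sup>2)) (at_right 0)"
    by (intro tendsto_intros)
  then have "\<forall>\<^sub>F w in at_right 0. w * I0 + (1 - w) * (I + w\<^sup>2) < I + \<epsilon>"
    using \<epsilon> by (intro order_tendstoD(2)) auto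
  moreover have "\<forall>\<^sub>F w in at_right 0. w < (1::real)"
    by (auto simp: eventually_at_right_field intro: exI[of _ 1])
  ultimately have "\<forall>\<^sub>F w in at_right 0. 0 < w \<and> w < 1 \<and> w * I0 + (1 - w) * (I + w\<^sup>2) < I + \<epsilon>
      \<and> w * D0 + (1 - w) * (D + w\<^sup>2) < D \<and> w * P0 + (1 - w) * (P + w\<^sup>2) < P"
    by (intro eventually_conj eventually_at_right_less eventually_perturbed_mixture_less less)
  then show thesis
    using that eventually_happens'[OF trivial_limit_at_right_real] by blast
qed

lemma RDP_nonneg: "0 \<le> RDP M \<Delta> d D P"
  unfolding RDP_def by (intro Inf_greatest) auto

proposition R_nr_le_RDP:
  fixes M :: "'a::polish_space measure" and D P :: real
  assumes \<Delta>: "case_prod \<Delta> \<in> borel_measurable (borel \<Otimes>\<^sub>M borel)" and d: "mix_convex (d M)"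
    and E: "E \<in> sets borel" "0 < measure M E" "measure M E < 1"
    and finite: "\<And>D P. 0 < D \<Longrightarrow> 0 < P \<Longrightarrow> RDP M \<Delta> d D P < \<infinity>"
    and approx: "\<And>D P \<epsilon>. 0 < D \<Longrightarrow> 0 < P \<Longrightarrow> 0 < \<epsilon> \<Longrightarrow> \<exists>K S. finite_output_kernel M \<Delta> d K S
      \<and> enn2ereal (mutual_info M K) \<le> RDP M \<Delta> d D P + ereal \<epsilon>
      \<and> enn2ereal (exp_dist M \<Delta> K) \<le> ereal (D + \<epsilon>) \<and> enn2ereal (d M (outlaw M K)) \<le> ereal (P + \<epsilon>)"
    and pos: "0 < D" "0 < P"
  shows "R_nr M \<Delta> d D P \<le> RDP M \<Delta> d D P"
proof -
  have RDP_real: "\<exists>\<rho>\<ge>0. RDP M \<Delta> d D P = ereal \<rho>" if "0 < D" "0 < P" for D P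
    using finite[OF that] RDP_nonneg[of M \<Delta> d D P] by (cases "RDP M \<Delta> d D P") auto
  have ex_kernel: "\<exists>K S. finite_output_kernel M \<Delta> d K S \<and> mutual_info M K \<le> ennreal (\<rho> + \<epsilon>)
      \<and> exp_dist M \<Delta> K \<le> ennreal (D + \<epsilon>) \<and> d M (outlaw M K) \<le> ennreal (P + \<epsilon>)"
    if "0 < D" "0 < P" "0 < \<epsilon>" "RDP M \<Delta> d D P = ereal \<rho>" for D P \<epsilon> \<rho>
    using approx[OF that(1-3)] unfolding that(4) plus_ereal.simps enn2ereal_le_ereal_iff by blast
  obtain \<rho> where \<rho>: "0 \<le> \<rho>" "RDP M \<Delta> d D P = ereal \<rho>" using RDP_real[OF pos] by blast
  define \<epsilon>0 where "\<epsilon>0 = min D P / 4"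
  have \<epsilon>0: "0 < \<epsilon>0" "D / 2 + \<epsilon>0 < D" "P / 2 + \<epsilon>0 < P" using pos by (auto simp: \<epsilon>0_def min_def)
  obtain \<rho>0 where \<rho>0: "0 \<le> \<rho>0" "RDP M \<Delta> d (D / 2) (P / 2) = ereal \<rho>0"
    using RDP_real[of "D / 2" "P / 2"] pos by auto
  obtain K0 S0 where K0: "finite_output_kernel M \<Delta> d K0 S0"
    "mutual_info M K0 \<le> ennreal (\<rho>0 + \<epsilon>0)" "exp_dist M \<Delta> K0 \<le> ennreal (D / 2 + \<epsilon>0)"
      "d M (outlaw M K0) \<le> ennreal (P / 2 + \<epsilon>0)"
    using ex_kernel[OF _ _ \<epsilon>0(1) \<rho>0(2)] pos by auto
  have "R_nr M \<Delta> d D P \<le> RDP M \<Delta> d D P + ereal \<epsilon>" if \<epsilon>: "0 < \<epsilon>" for \<epsilon>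
  proof -
    obtain w where w: "0 < w" "w < 1" and less: "w * (\<rho>0 + \<epsilon>0) + (1 - w) * (\<rho> + w\<^sup>2) < \<rho> + \<epsilon>"
        "w * (D / 2 + \<epsilon>0) + (1 - w) * (D + w\<^sup>2) < D" "w * (P / 2 + \<epsilon>0) + (1 - w) * (P + w\<^sup>2) < P"
      using ex_perturbed_mixture_weight[OF \<epsilon> \<epsilon>0(2,3)] by blast
    obtain K1 S1 where K1: "finite_output_kernel M \<Delta> d K1 S1" "mutual_info M K1 \<le> ennreal (\<rho> + w\<^sup>2)"
        "exp_dist M \<Delta> K1 \<le> ennreal (D + w\<^sup>2)" "d M (outlaw M K1) \<le> ennreal (P + w\<^sup>2)"
      using ex_kernel[OF pos _ \<rho>(2), of "w\<^sup>2"] w by auto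
    have "achievable_nr M \<Delta> d D P (\<rho> + \<epsilon>)"
      using \<rho>0(1) \<rho>(1) \<epsilon>0(1) pos
      by (intro achievable_of_two_kernels[OF \<Delta> d E w K0 K1 _ _ _ _ _ _ less]) auto
    then show ?thesis unfolding R_nr_def \<rho>(2) by (intro Inf_lower) auto
  qed
  then show ?thesis by (rule ereal_le_epsilon2)
qed

lemma RDP_le_R_nr:
  assumes "prob_meas M" "case_prod \<Delta> \<in> borel_measurable (borel \<Otimes>\<^sub>M borel)" "mix_convex (d M)"
  shows "RDP M \<Delta> d D P \<le> R_nr M \<Delta> d D P"
  unfolding R_nr_def
proof (rule Inf_greatest, clarify)
  fix R assume "achievable_nr M \<Delta> d D P R"
  then obtain N where "nr_code M \<Delta> d D P R n" if "N \<le> n" "0 < n" for n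
    unfolding achievable_nr_def by blast
  from this[of "Suc N"] show "RDP M \<Delta> d D P \<le> ereal R"
    using assms by (intro RDP_le_of_nr_code[where d = d and n = "Suc N"]) auto
qed

lemma finite_output_kernelI:
  assumes M: "prob_meas M" and K: "markov_kernel K" and S: "finite S" "emeasure (outlaw M K) S = 1"
    and pos: "\<And>s. s \<in> S \<Longrightarrow> 0 < emeasure (outlaw M K) {s}"
    and I: "enn2ereal (mutual_info M K) \<le> r + ereal \<epsilon>" "r < \<infinity>"
    and Max: "(\<integral>\<^sup>+x. ennreal (Max (\<Delta> x ` S)) \<partial>M) < \<infinity>"
    and d: "\<And>\<gamma>. prob_meas \<gamma> \<Longrightarrow> emeasure \<gamma> S = 1 \<Longrightarrow> d M \<gamma> < \<infinity>"
  shows "finite_output_kernel M \<Delta> d K S"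
proof
  show "mutual_info M K < \<infinity>" using I by (cases "mutual_info M K"; cases r) auto
  interpret q: prob_space "outlaw M K" by (rule prob_measD[OF prob_meas_outlaw[OF M K]])
  fix s assume s: "s \<in> S"
  show "0 < measure (outlaw M K) {s}" using pos[OF s] by (simp add: q.emeasure_eq_measure)
  have "(\<integral>\<^sup>+x. ennreal (\<Delta> x s) \<partial>M) \<le> (\<integral>\<^sup>+x. ennreal (Max (\<Delta> x ` S)) \<partial>M)"
    using S s by (intro nn_integral_mono ennreal_leI Max_ge) auto
  also note Max
  finally show "(\<integral>\<^sup>+x. ennreal (\<Delta> x s) \<partial>M) < \<infinity>" .
  show "d M (return borel s) < \<infinity>"
    using s S by (intro d prob_meas_return) (simp add: finite_imp_borel)
qed fact+

theorem theorem2: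
  fixes M :: "'a::polish_space measure"
    and \<Delta> :: "'a \<Rightarrow> 'a \<Rightarrow> real"
    and d :: "'a measure \<Rightarrow> 'a measure \<Rightarrow> ennreal"
  assumes pX: "prob_meas M"
    and \<Delta>_meas: "case_prod \<Delta> \<in> borel_measurable (borel \<Otimes>\<^sub>M borel)"
    and \<Delta>_nonneg: "\<And>x y. \<Delta> x y \<ge> 0"
    and \<Delta>_zero: "\<And>x y. \<Delta> x y = 0 \<longleftrightarrow> x = y"
    and d_zero: "\<And>\<mu> \<nu>. prob_meas \<mu> \<Longrightarrow> prob_meas \<nu> \<Longrightarrow> d \<mu> \<nu> = 0 \<longleftrightarrow> \<mu> = \<nu>"
    and A1: "\<And>\<mu> \<nu>1 \<nu>2 l. prob_meas \<mu> \<Longrightarrow> prob_meas \<nu>1 \<Longrightarrow> prob_meas \<nu>2 \<Longrightarrow>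
               0 \<le> l \<Longrightarrow> l \<le> 1 \<Longrightarrow>
               d \<mu> (mix l \<nu>1 \<nu>2) \<le> ennreal l * d \<mu> \<nu>1 + ennreal (1 - l) * d \<mu> \<nu>2"
    and A2a: "\<And>D P. D > 0 \<Longrightarrow> P > 0 \<Longrightarrow> RDP M \<Delta> d D P < \<infinity>"
    and A2b: "\<And>D P \<epsilon>. D > 0 \<Longrightarrow> P > 0 \<Longrightarrow> \<epsilon> > 0 \<Longrightarrow>
               \<exists>K S. markov_kernel K \<and> finite S
                 \<and> emeasure (outlaw M K) S = 1
                 \<and> (\<forall>s\<in>S. emeasure (outlaw M K) {s} > 0)
                 \<and> enn2ereal (mutual_info M K) \<le> RDP M \<Delta> d D P + ereal \<epsilon>
                 \<and> enn2ereal (exp_dist M \<Delta> K) \<le> ereal (D + \<epsilon>)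
                 \<and> (\<integral>\<^sup>+ x. ennreal (Max ((\<Delta> x) ` S)) \<partial>M) < \<infinity>
                 \<and> enn2ereal (d M (outlaw M K)) \<le> ereal (P + \<epsilon>)
                 \<and> (\<forall>\<gamma>. prob_meas \<gamma> \<and> emeasure \<gamma> S = 1 \<longrightarrow> d M \<gamma> < \<infinity>)"
    and D_pos: "D > 0" and P_pos: "P > 0"
  shows "R_nr M \<Delta> d D P = RDP M \<Delta> d D P"
proof (rule antisym)
  have d: "mix_convex (d M)" unfolding mix_convex_def using A1[OF pX] by blast
  show "RDP M \<Delta> d D P \<le> R_nr M \<Delta> d D P" using pX \<Delta>_meas d by (rule RDP_le_R_nr)
  show "R_nr M \<Delta> d D P \<le> RDP M \<Delta> d D P"
    using pX
  proof (cases rule: point_mass_or_nontrivial_event)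
    case (point_mass a)
    then have "achievable_nr M \<Delta> d D P 0"
      using D_pos P_pos \<Delta>_zero[of a a] d_zero[OF pX pX] by (auto intro!: achievable_return \<Delta>_meas)
    then show ?thesis unfolding R_nr_def using RDP_nonneg
      by (intro Inf_lower2[of "ereal 0"]) (auto simp: zero_ereal_def[symmetric])
  next
    case (nontrivial E)
    have "\<exists>K S. finite_output_kernel M \<Delta> d K S
        \<and> enn2ereal (mutual_info M K) \<le> RDP M \<Delta> d D P + ereal \<epsilon>
        \<and> enn2ereal (exp_dist M \<Delta> K) \<le> ereal (D + \<epsilon>) \<and> enn2ereal (d M (outlaw M K)) \<le> ereal (P + \<epsilon>)"
      if "0 < D" "0 < P" "0 < \<epsilon>" for D P \<epsilon>
      using A2b[OF that] finite_output_kernelI[OF pX _ _ _ _ _ A2a[OF that(1,2)]] by blast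
    then show ?thesis
      using R_nr_le_RDP[of \<Delta> d M E D P] \<Delta>_meas d nontrivial A2a D_pos P_pos by blast
  qed
qed

end
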